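(* Let $(\mathcal{S}_n)_{n\ge 1}$, $\mathcal{S}_n=\{0=t_0^{(n)}<t_1^{(n)}<\cdots<t_k^{(n)}<\cdots\}$, be a sequence of partitions of $\mathbb{R}_+$ such that $\delta(\mathcal{S}_n)\to 0$. Write $P_n=P_{\mathcal{S}_n}$ and $a_i^{\varepsilon}(n)=a_i^{\varepsilon}(\mathcal{S}_n)$ for $\varepsilon\in\{+,-,\circ,\times\}$. Then: (1) For every $f\in\Phi$, $P_nf\to f$ in $\Phi$ as $n\to\infty$. (2) For all $t\in\mathbb{R}_+$, the operators $$a_t^{\pm}(n)=\sum_{i:\,t_i^{(n)}\le t}\sqrt{t_{i+1}^{(n)}-t_i^{(n)}}\;a_i^{\pm}(n),\qquad a_t^{\circ}(n)=\sum_{i:\,t_i^{(n)}\le t}a_i^{\circ}(n),\qquad a_t^{\times}(n)=\sum_{i:\,t_i^{(n)}\le t}\left(t_{i+1}^{(n)}-t_i^{(n)}\right)a_i^{\times}(n)$$ converge strongly on $\Phi$, as $n\to\infty$, to $a_t^{\pm}$, $a_t^{\circ}$ and $a_t^{\times}$ respectively.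
   Context: Free Fock space: $\Phi=\mathcal{F}(L^2(\mathbb{R}_+;\mathbb{C}))=\mathbb{C}\Omega\oplus\bigoplus_{n\ge1}L^2(\mathbb{R}_+;\mathbb{C})^{\otimes n}$ (orthogonal Hilbert sum), where $\Omega$ (the vacuum) has norm one and $L^2(\mathbb{R}_+)^{\otimes n}$ is identified with $L^2(\mathbb{R}_+^n)$. Operators on $\Phi$: for $h\in L^2(\mathbb{R}_+)$ real-valued, $b\in L^\infty(\mathbb{R}_+)$ and $f_n\in L^2(\mathbb{R}_+^n)$, $n\ge 1$, the following define bounded operators: - $a^+(h)\Omega=h$, $(a^+(h)f_n)(x_1,\dots,x_{n+1})=h(x_1)f_n(x_2,\dots,x_{n+1})$; - $a^-(h)\Omega=0$, $(a^-(h)f_n)(x_2,\dots,x_n)=\int h(x)f_n(x,x_2,\dots,x_n)\,dx$ (for $n=1$ this is the scalar $\int h f_1$ times $\Omega$); - $a^\circ(b)\Omega=0$, $(a^\circ(b)f_n)(x_1,\dots,x_n)=b(x_1)f_n(x_1,\dots,x_n)$; - $a^\times(b)=\left(\int b(x)\,dx\right)\mathrm{Id}$, for integrable $b$. For $t\in\mathbb{R}_+$ and $\varepsilon\in\{+,-,\circ,\times\}$, $a_t^\varepsilon=a^\varepsilon(\mathbf{1}_{[0,t)})$; in particular $a_t^\times=t\,\mathrm{Id}$. Partitions: a partition $\mathcal{S}=\{0=t_0<t_1<\cdots<t_k<\cdots\}$ of $\mathbb{R}_+$ is a strictly increasing sequence such that the intervals $[t_i,t_{i+1})$ cover $\mathbb{R}_+$;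 its diameter is $\delta(\mathcal{S})=\sup_i|t_{i+1}-t_i|$. Toy Fock space of $\mathcal{S}$: put $X_i=\mathbf{1}_{[t_i,t_{i+1})}/\sqrt{t_{i+1}-t_i}\in L^2(\mathbb{R}_+)$ for $i\in\mathbb{N}=\{0,1,2,\dots\}$. A finite word $\sigma=[\sigma_1,\dots,\sigma_n]$ with letters in $\mathbb{N}$ is adapted if $\sigma_j\ne\sigma_{j+1}$ for all $1\le j<n$; the empty word is adapted. Put $X_\sigma=X_{\sigma_1}\otimes\cdots\otimes X_{\sigma_n}\in L^2(\mathbb{R}_+^n)$ and $X_\emptyset=\Omega$. The space $T\Phi(\mathcal{S})$ is the closed subspace of $\Phi$ with orthonormal basis $\{X_\sigma:\sigma\text{ adapted}\}$, and $P_{\mathcal{S}}$ is the orthogonal projection of $\Phi$ onto $T\Phi(\mathcal{S})$. Discrete operators on $\Phi$ associated with $\mathcal{S}$: $$a_i^{\pm}(\mathcal{S})=P_{\mathcal{S}}\,a^{\pm}\!\left(\frac{\mathbf{1}_{[t_i,t_{i+1})}}{\sqrt{t_{i+1}-t_i}}\right)P_{\mathcal{S}},\quad a_i^\circ(\mathcal{S})=P_{\mathcal{S}}\,a^\circ(\mathbf{1}_{[t_i,t_{i+1})})P_{\mathcal{S}},\quad a_i^\times(\mathcal{S})=P_{\mathcal{S}}(\mathrm{Id}-a_i^\circ(\mathcal{S}))P_{\mathcal{S}}.$$ Strong convergence means convergence in the strong operator topology of bounded operators on $\Phi$. *)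

theory Defs
  imports "HOL-Analysis.Analysis"
begin

definition half_line :: "real measure"
  where "half_line = restrict_space lborel {0..}"

text \<open>
  The measure space \<open>orthant n\<close> is the nonnegative orthant of dimension \<open>n\<close>; its points are functions
  supported (in the sense of \<open>extensional\<close>) on the indices \<open>0, \<dots>, n - 1\<close>.  For \<open>n = 0\<close> it is a single
  point of mass one, so that its \<open>L\<^sup>2\<close> space is the line spanned by the vacuum \<open>\<Omega>\<close>.
\<close>

definition orthant :: "nat \<Rightarrow> (nat \<Rightarrow> real) measure"
  where "orthant n = (\<Pi>\<^sub>M i\<in>{..<n}. half_line)"

definition square_integrable :: "'a measure \<Rightarrow> ('a \<Rightarrow> 'b::{real_normed_vector}) \<Rightarrow> bool"
  where "square_integrable M f \<longleftrightarrow> f \<in> borel_measurable M \<and> integrable M (\<lambda>x. (norm (f x))\<^sup>2)"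

definition fock_carrier :: "(nat \<Rightarrow> (nat \<Rightarrow> real) \<Rightarrow> complex) set"
  where "fock_carrier = {f. (\<forall>n. square_integrable (orthant n) (f n)) \<and>
           summable (\<lambda>n. \<integral>x. (norm (f n x))\<^sup>2 \<partial>orthant n)}"

definition fock_rel ::
    "(nat \<Rightarrow> (nat \<Rightarrow> real) \<Rightarrow> complex) \<Rightarrow> (nat \<Rightarrow> (nat \<Rightarrow> real) \<Rightarrow> complex) \<Rightarrow> bool"
  where "fock_rel f g \<longleftrightarrow> f \<in> fock_carrier \<and> g \<in> fock_carrier \<and>
           (\<forall>n. AE x in orthant n. f n x = g n x)"

lemma square_integrable_zero: "square_integrable M (\<lambda>x. 0)"
  by (simp add: square_integrable_def)

lemma zero_in_fock_carrier: "(\<lambda>n x. 0) \<in> fock_carrier"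
  by (simp add: fock_carrier_def square_integrable_zero)

quotient_type fock = "nat \<Rightarrow> (nat \<Rightarrow> real) \<Rightarrow> complex" / partial: fock_rel
proof (rule part_equivpI)
  show "\<exists>f. fock_rel f f"
    using zero_in_fock_carrier by (auto simp: fock_rel_def)
  show "symp fock_rel"
  proof (rule sympI)
    fix f g assume a: "fock_rel f g"
    have "AE x in orthant n. g n x = f n x" for n
    proof -
      have "AE x in orthant n. f n x = g n x" using a by (auto simp: fock_rel_def)
      then show ?thesis by eventually_elim simp
    qed
    then show "fock_rel g f" using a by (auto simp: fock_rel_def)
  qed
  show "transp fock_rel"
  proof (rule transpI)
    fix f g h assume a: "fock_rel f g" "fock_rel g h"
    have "AE x in orthant n. f n x = h n x" for n
    proof -
      have "AE x in orthant n. f n x = g n x" "AE x in orthant n. g n x = h n x"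
        using a by (auto simp: fock_rel_def)
      then show ?thesis by eventually_elim simp
    qed
    then show "fock_rel f h" using a by (auto simp: fock_rel_def)
  qed
qed

lemma norm_add_sq_le: "(norm (a + b :: 'a::real_normed_vector))\<^sup>2 \<le> 2 * (norm a)\<^sup>2 + 2 * (norm b)\<^sup>2"
proof -
  have "(norm (a + b))\<^sup>2 \<le> (norm a + norm b)\<^sup>2"
    by (intro power_mono norm_triangle_ineq) auto
  also have "\<dots> \<le> 2 * (norm a)\<^sup>2 + 2 * (norm b)\<^sup>2"
    using sum_squares_bound[of "norm a" "norm b"] by (simp add: power2_sum)
  finally show ?thesis .
qed

lemma norm_cnj_mult_le: "norm (cnj a * b) \<le> (norm a)\<^sup>2 + (norm b)\<^sup>2"
proof -
  have "norm a * norm b \<ge> 0" by simp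
  then have "norm a * norm b \<le> (norm a)\<^sup>2 + (norm b)\<^sup>2"
    using sum_squares_bound[of "norm a" "norm b"] by linarith
  then show ?thesis by (simp add: norm_mult)
qed

lemma square_integrable_add:
  fixes f g :: "'a \<Rightarrow> complex"
  assumes f: "square_integrable M f" and g: "square_integrable M g"
  shows "square_integrable M (\<lambda>x. f x + g x)"
proof -
  have m[measurable]: "f \<in> borel_measurable M" "g \<in> borel_measurable M"
    using f g by (auto simp: square_integrable_def)
  have "integrable M (\<lambda>x. (norm (f x + g x))\<^sup>2)"
  proof (rule Bochner_Integration.integrable_bound)
    show "integrable M (\<lambda>x. 2 * (norm (f x))\<^sup>2 + 2 * (norm (g x))\<^sup>2)"
      using f g by (auto simp: square_integrable_def)
  qed (use norm_add_sq_le in \<open>auto\<close>)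
  then show ?thesis by (simp add: square_integrable_def)
qed

lemma square_integrable_scale:
  fixes f :: "'a \<Rightarrow> complex"
  assumes f: "square_integrable M f"
  shows "square_integrable M (\<lambda>x. c * f x)"
  using f by (auto simp: square_integrable_def norm_mult power_mult_distrib)

lemma integrable_cnj_mult:
  fixes f g :: "'a \<Rightarrow> complex"
  assumes f: "square_integrable M f" and g: "square_integrable M g"
  shows "integrable M (\<lambda>x. cnj (f x) * g x)"
proof (rule Bochner_Integration.integrable_bound)
  have m[measurable]: "f \<in> borel_measurable M" "g \<in> borel_measurable M"
    using f g by (auto simp: square_integrable_def)
  show "integrable M (\<lambda>x. (norm (f x))\<^sup>2 + (norm (g x))\<^sup>2)"
    using f g by (auto simp: square_integrable_def)
  have "(\<lambda>x. cnj (f x)) \<in> borel_measurable M"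
    using measurable_compose[OF m(1) borel_measurable_continuous_onI[OF continuous_on_cnj[OF continuous_on_id]]]
    by simp
  then show "(\<lambda>x. cnj (f x) * g x) \<in> borel_measurable M"
    by measurable
  show "AE x in M. norm (cnj (f x) * g x) \<le> norm ((norm (f x))\<^sup>2 + (norm (g x))\<^sup>2)"
    using norm_cnj_mult_le by auto
qed

lemma add_in_fock_carrier:
  assumes f: "f \<in> fock_carrier" and g: "g \<in> fock_carrier"
  shows "(\<lambda>n x. f n x + g n x) \<in> fock_carrier"
proof -
  have sq: "square_integrable (orthant n) (f n)" "square_integrable (orthant n) (g n)" for n
    using f g by (auto simp: fock_carrier_def)
  have sq': "square_integrable (orthant n) (\<lambda>x. f n x + g n x)" for n
    by (intro square_integrable_add sq)
  have "summable (\<lambda>n. \<integral>x. (norm (f n x + g n x))\<^sup>2 \<partial>orthant n)"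
  proof (rule summable_comparison_test')
    show "summable (\<lambda>n. 2 * (\<integral>x. (norm (f n x))\<^sup>2 \<partial>orthant n) + 2 * (\<integral>x. (norm (g n x))\<^sup>2 \<partial>orthant n))"
      using f g by (intro summable_add summable_mult) (auto simp: fock_carrier_def)
    fix n :: nat
    have "(\<integral>x. (norm (f n x + g n x))\<^sup>2 \<partial>orthant n)
          \<le> (\<integral>x. 2 * (norm (f n x))\<^sup>2 + 2 * (norm (g n x))\<^sup>2 \<partial>orthant n)"
      using sq sq' norm_add_sq_le by (intro integral_mono) (auto simp: square_integrable_def)
    also have "\<dots> = 2 * (\<integral>x. (norm (f n x))\<^sup>2 \<partial>orthant n) + 2 * (\<integral>x. (norm (g n x))\<^sup>2 \<partial>orthant n)"
      using sq[of n] by (subst Bochner_Integration.integral_add) (auto simp: square_integrable_def)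
    finally show "norm (\<integral>x. (norm (f n x + g n x))\<^sup>2 \<partial>orthant n) \<le>
       2 * (\<integral>x. (norm (f n x))\<^sup>2 \<partial>orthant n) + 2 * (\<integral>x. (norm (g n x))\<^sup>2 \<partial>orthant n)"
      by simp
  qed
  then show ?thesis using sq' by (simp add: fock_carrier_def)
qed

lemma scale_in_fock_carrier:
  assumes f: "f \<in> fock_carrier"
  shows "(\<lambda>n x. c * f n x) \<in> fock_carrier"
  using f by (auto simp: fock_carrier_def square_integrable_scale norm_mult power_mult_distrib summable_mult)

lift_definition fock_scale :: "complex \<Rightarrow> fock \<Rightarrow> fock" is "\<lambda>c f n x. c * f n x"
  unfolding fock_rel_def
proof (intro conjI allI)
  fix c f g n
  assume a: "f \<in> fock_carrier \<and> g \<in> fock_carrier \<and> (\<forall>n. AE x in orthant n. f n x = g n x)"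
  show "(\<lambda>n x. c * f n x) \<in> fock_carrier" "(\<lambda>n x. c * g n x) \<in> fock_carrier"
    using a by (auto intro: scale_in_fock_carrier)
  have "AE x in orthant n. f n x = g n x" using a by blast
  then show "AE x in orthant n. c * f n x = c * g n x" by eventually_elim simp
qed

lift_definition fock_cinner :: "fock \<Rightarrow> fock \<Rightarrow> complex"
  is "\<lambda>f g. \<Sum>n. \<integral>x. cnj (f n x) * g n x \<partial>orthant n"
proof -
  fix f f' g g' assume a: "fock_rel f f'" "fock_rel g g'"
  have "(\<integral>x. cnj (f n x) * g n x \<partial>orthant n) = (\<integral>x. cnj (f' n x) * g' n x \<partial>orthant n)" for n
  proof (rule integral_cong_AE)
    show "(\<lambda>x. cnj (f n x) * g n x) \<in> borel_measurable (orthant n)"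
      "(\<lambda>x. cnj (f' n x) * g' n x) \<in> borel_measurable (orthant n)"
      using a by (auto simp: fock_rel_def fock_carrier_def intro!: borel_measurable_integrable integrable_cnj_mult)
    have "AE x in orthant n. f n x = f' n x" "AE x in orthant n. g n x = g' n x"
      using a by (auto simp: fock_rel_def)
    then show "AE x in orthant n. cnj (f n x) * g n x = cnj (f' n x) * g' n x"
      by eventually_elim simp
  qed
  then show "(\<Sum>n. \<integral>x. cnj (f n x) * g n x \<partial>orthant n) = (\<Sum>n. \<integral>x. cnj (f' n x) * g' n x \<partial>orthant n)"
    by simp
qed

lemma summable_fock_cinner:
  assumes f: "f \<in> fock_carrier" and g: "g \<in> fock_carrier"
  shows "summable (\<lambda>n. \<integral>x. cnj (f n x) * g n x \<partial>orthant n)"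
proof (rule summable_comparison_test')
  have sq: "square_integrable (orthant n) (f n)" "square_integrable (orthant n) (g n)" for n
    using f g by (auto simp: fock_carrier_def)
  show "summable (\<lambda>n. (\<integral>x. (norm (f n x))\<^sup>2 \<partial>orthant n) + (\<integral>x. (norm (g n x))\<^sup>2 \<partial>orthant n))"
    using f g by (intro summable_add) (auto simp: fock_carrier_def)
  fix n :: nat
  have "norm (\<integral>x. cnj (f n x) * g n x \<partial>orthant n) \<le> (\<integral>x. norm (cnj (f n x) * g n x) \<partial>orthant n)"
    by (rule integral_norm_bound)
  also have "\<dots> \<le> (\<integral>x. (norm (f n x))\<^sup>2 + (norm (g n x))\<^sup>2 \<partial>orthant n)"
    using sq[of n] by (intro integral_mono integrable_norm integrable_cnj_mult norm_cnj_mult_le)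
       (auto simp: square_integrable_def)
  also have "\<dots> = (\<integral>x. (norm (f n x))\<^sup>2 \<partial>orthant n) + (\<integral>x. (norm (g n x))\<^sup>2 \<partial>orthant n)"
    using sq[of n] by (subst Bochner_Integration.integral_add) (auto simp: square_integrable_def)
  finally show "norm (\<integral>x. cnj (f n x) * g n x \<partial>orthant n) \<le>
    (\<integral>x. (norm (f n x))\<^sup>2 \<partial>orthant n) + (\<integral>x. (norm (g n x))\<^sup>2 \<partial>orthant n)" .
qed

instantiation fock :: real_inner
begin

lift_definition zero_fock :: fock is "\<lambda>n x. 0"
  by (simp add: fock_rel_def zero_in_fock_carrier)

lift_definition plus_fock :: "fock \<Rightarrow> fock \<Rightarrow> fock" is "\<lambda>f g n x. f n x + g n x"
  unfolding fock_rel_def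
proof (intro conjI allI)
  fix f f' g g' n
  assume a: "f \<in> fock_carrier \<and> f' \<in> fock_carrier \<and> (\<forall>n. AE x in orthant n. f n x = f' n x)"
    "g \<in> fock_carrier \<and> g' \<in> fock_carrier \<and> (\<forall>n. AE x in orthant n. g n x = g' n x)"
  show "(\<lambda>n x. f n x + g n x) \<in> fock_carrier" "(\<lambda>n x. f' n x + g' n x) \<in> fock_carrier"
    using a by (auto intro: add_in_fock_carrier)
  have "AE x in orthant n. f n x = f' n x" "AE x in orthant n. g n x = g' n x" using a by blast+
  then show "AE x in orthant n. f n x + g n x = f' n x + g' n x" by eventually_elim simp
qed

definition uminus_fock :: "fock \<Rightarrow> fock" where "uminus_fock f = fock_scale (- 1) f"

definition minus_fock :: "fock \<Rightarrow> fock \<Rightarrow> fock" where "minus_fock f g = f + (- g)"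

definition scaleR_fock :: "real \<Rightarrow> fock \<Rightarrow> fock" where "scaleR_fock r = fock_scale (of_real r)"

definition inner_fock :: "fock \<Rightarrow> fock \<Rightarrow> real" where "inner_fock f g = Re (fock_cinner f g)"

definition norm_fock :: "fock \<Rightarrow> real" where "norm_fock f = sqrt (inner f f)"

definition sgn_fock :: "fock \<Rightarrow> fock" where "sgn_fock f = scaleR (inverse (norm f)) f"

definition dist_fock :: "fock \<Rightarrow> fock \<Rightarrow> real" where "dist_fock f g = norm (f - g)"

definition uniformity_fock :: "(fock \<times> fock) filter"
  where "uniformity_fock = (INF e\<in>{0<..}. principal {(f, g). dist f g < e})"

definition open_fock :: "fock set \<Rightarrow> bool"
  where "open_fock U = (\<forall>f\<in>U. eventually (\<lambda>(f', g). f' = f \<longrightarrow> g \<in> U) uniformity)"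

lemma fock_rel_reflI: "f \<in> fock_carrier \<Longrightarrow> f = g \<Longrightarrow> fock_rel f g"
  by (auto simp: fock_rel_def)

lemma fock_rel_self: "fock_rel f f \<longleftrightarrow> f \<in> fock_carrier"
  by (auto simp: fock_rel_def)

lemma fock_add_zero: "0 + f = (f::fock)"
  by transfer (auto simp: fock_rel_def)

lemma fock_add_assoc: "f + g + h = f + (g + (h::fock))"
  by transfer (rule fock_rel_reflI, auto simp: fock_rel_self add.assoc intro!: add_in_fock_carrier)

lemma fock_add_commute: "f + g = g + (f::fock)"
  by transfer (rule fock_rel_reflI, auto simp: fock_rel_self add.commute intro!: add_in_fock_carrier)

lemma fock_scale_add_right: "fock_scale c (f + g) = fock_scale c f + fock_scale c g"
  by transfer (rule fock_rel_reflI,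
      auto simp: fock_rel_self distrib_left intro!: add_in_fock_carrier scale_in_fock_carrier)

lemma fock_scale_add_left: "fock_scale (c + d) f = fock_scale c f + fock_scale d f"
  by transfer (rule fock_rel_reflI,
      auto simp: fock_rel_self distrib_right intro!: add_in_fock_carrier scale_in_fock_carrier)

lemma fock_scale_scale: "fock_scale c (fock_scale d f) = fock_scale (c * d) f"
  by transfer (rule fock_rel_reflI,
      auto simp: fock_rel_self mult.assoc intro!: scale_in_fock_carrier)

lemma fock_scale_one: "fock_scale 1 f = f"
  by transfer (auto simp: fock_rel_def)

lemma fock_scale_zero: "fock_scale 0 f = 0"
  by transfer (auto simp: fock_rel_def zero_in_fock_carrier)

lemma fock_cinner_add_right: "fock_cinner f (g + h) = fock_cinner f g + fock_cinner f h"
proof (transfer, unfold fock_rel_self)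
  fix f g h assume c: "f \<in> fock_carrier" "g \<in> fock_carrier" "h \<in> fock_carrier"
  have "(\<integral>x. cnj (f n x) * (g n x + h n x) \<partial>orthant n) =
        (\<integral>x. cnj (f n x) * g n x \<partial>orthant n) + (\<integral>x. cnj (f n x) * h n x \<partial>orthant n)" for n
    unfolding distrib_left using c
    by (intro Bochner_Integration.integral_add integrable_cnj_mult) (auto simp: fock_carrier_def)
  then show "(\<Sum>n. \<integral>x. cnj (f n x) * (g n x + h n x) \<partial>orthant n) =
     (\<Sum>n. \<integral>x. cnj (f n x) * g n x \<partial>orthant n) + (\<Sum>n. \<integral>x. cnj (f n x) * h n x \<partial>orthant n)"
    using c by (simp add: suminf_add summable_fock_cinner)
qed

lemma fock_cinner_scale_right: "fock_cinner f (fock_scale c g) = c * fock_cinner f g"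
proof (transfer, unfold fock_rel_self)
  fix f g c assume c: "f \<in> fock_carrier" "g \<in> fock_carrier"
  have "(\<integral>x. cnj (f n x) * (c * g n x) \<partial>orthant n) = c * (\<integral>x. cnj (f n x) * g n x \<partial>orthant n)" for n
    by (simp add: mult.left_commute)
  then show "(\<Sum>n. \<integral>x. cnj (f n x) * (c * g n x) \<partial>orthant n) =
     c * (\<Sum>n. \<integral>x. cnj (f n x) * g n x \<partial>orthant n)"
    using c by (simp add: suminf_mult summable_fock_cinner)
qed

lemma fock_cinner_commute: "fock_cinner f g = cnj (fock_cinner g f)"
proof (transfer, unfold fock_rel_self)
  fix f g assume c: "f \<in> fock_carrier" "g \<in> fock_carrier"
  have "(\<integral>x. cnj (f n x) * g n x \<partial>orthant n) = cnj (\<integral>x. cnj (g n x) * f n x \<partial>orthant n)" for n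
    using Bochner_Integration.integral_cnj[of "orthant n" "\<lambda>x. cnj (g n x) * f n x"] by (simp add: mult.commute)
  then show "(\<Sum>n. \<integral>x. cnj (f n x) * g n x \<partial>orthant n) =
     cnj (\<Sum>n. \<integral>x. cnj (g n x) * f n x \<partial>orthant n)"
    using bounded_linear.suminf[OF bounded_linear_cnj summable_fock_cinner[OF c(2,1)]] by simp
qed

lemma fock_cinner_self:
  "fock_cinner (abs_fock f) (abs_fock f) = of_real (\<Sum>n. \<integral>x. (norm (f n x))\<^sup>2 \<partial>orthant n)"
  if "f \<in> fock_carrier"
proof -
  have eq: "(\<integral>x. cnj (f n x) * f n x \<partial>orthant n) = of_real (\<integral>x. (norm (f n x))\<^sup>2 \<partial>orthant n)" for n
    by (simp add: complex_norm_square[symmetric] mult.commute flip: integral_complex_of_real)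
  have "fock_cinner (abs_fock f) (abs_fock f) = (\<Sum>n. \<integral>x. cnj (f n x) * f n x \<partial>orthant n)"
    using that by (intro fock_cinner.abs_eq) (auto simp: fock_rel_self)
  then show ?thesis
    using that unfolding eq by (subst suminf_of_real) (auto simp: fock_carrier_def)
qed

lemma fock_abs_cases: obtains g where "g \<in> fock_carrier" "f = abs_fock g"
  using that Quotient3_fock by (metis Quotient3_abs_rep Quotient3_rep_reflp fock_rel_self)

lemma fock_inner_pos: "0 \<le> inner f (f::fock)"
proof -
  obtain g where "g \<in> fock_carrier" "f = abs_fock g" by (rule fock_abs_cases)
  then show ?thesis
    by (auto simp: inner_fock_def fock_cinner_self fock_carrier_def intro!: suminf_nonneg)
qed

lemma fock_inner_eq_0: "inner f f = 0 \<longleftrightarrow> f = (0::fock)"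
proof
  assume z: "inner f f = 0"
  obtain g where g: "g \<in> fock_carrier" "f = abs_fock g" by (rule fock_abs_cases)
  have "\<forall>n. (\<integral>x. (norm (g n x))\<^sup>2 \<partial>orthant n) = 0"
    using z g by (subst suminf_eq_zero_iff[symmetric])
      (auto simp: inner_fock_def fock_cinner_self fock_carrier_def)
  then have "AE x in orthant n. (norm (g n x))\<^sup>2 = 0" for n
    using g by (subst integral_nonneg_eq_0_iff_AE[symmetric])
      (auto simp: fock_carrier_def square_integrable_def)
  then have "fock_rel g (\<lambda>n x. 0)"
    using g zero_in_fock_carrier by (auto simp: fock_rel_def)
  then show "f = 0"
    using g by (simp add: zero_fock_def Quotient3_rel_abs[OF Quotient3_fock])
next
  assume "f = 0"
  then show "inner f f = 0"
    by (simp add: inner_fock_def) (transfer, simp)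
qed

instance
proof
  fix f g h :: fock and a b r :: real
  show "f + g + h = f + (g + h)" by (rule fock_add_assoc)
  show "f + g = g + f" by (rule fock_add_commute)
  show "0 + f = f" by (rule fock_add_zero)
  show "- f + f = 0"
    using fock_scale_add_left[of "-1" 1 f] by (simp add: uminus_fock_def fock_scale_one fock_scale_zero)
  show "f - g = f + - g" by (rule minus_fock_def)
  show "a *\<^sub>R (f + g) = a *\<^sub>R f + a *\<^sub>R g" by (simp add: scaleR_fock_def fock_scale_add_right)
  show "(a + b) *\<^sub>R f = a *\<^sub>R f + b *\<^sub>R f" by (simp add: scaleR_fock_def fock_scale_add_left)
  show "a *\<^sub>R b *\<^sub>R f = (a * b) *\<^sub>R f" by (simp add: scaleR_fock_def fock_scale_scale)
  show "1 *\<^sub>R f = f" by (simp add: scaleR_fock_def fock_scale_one)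
  show "dist f g = norm (f - g)" by (rule dist_fock_def)
  show "sgn f = scaleR (inverse (norm f)) f" by (rule sgn_fock_def)
  show "uniformity = (INF e\<in>{0<..}. principal {(f, g :: fock). dist f g < e})"
    by (rule uniformity_fock_def)
  show "open U = (\<forall>f\<in>U. eventually (\<lambda>(f', g). f' = f \<longrightarrow> g \<in> U) uniformity)" for U :: "fock set"
    by (rule open_fock_def)
  show comm: "inner f g = inner g f" for f g :: fock
    unfolding inner_fock_def by (subst fock_cinner_commute) simp
  show "inner (f + g) h = inner f h + inner g h"
    by (simp add: comm[of _ h]) (simp add: inner_fock_def fock_cinner_add_right)
  show "inner (r *\<^sub>R f) g = r * inner f g"
    by (simp add: comm[of _ g]) (simp add: inner_fock_def scaleR_fock_def fock_cinner_scale_right)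
  show "0 \<le> inner f f" by (rule fock_inner_pos)
  show "inner f f = 0 \<longleftrightarrow> f = 0" by (rule fock_inner_eq_0)
  show "norm f = sqrt (inner f f)" by (rule norm_fock_def)
qed

end

text \<open>
  Operators are given by their action on representatives.  Below, \<open>x i\<close> is the coordinate usually
  written \<open>x\<^sub>i\<^sub>+\<^sub>1\<close>, \<open>\<lambda>i. x (Suc i)\<close> drops the first coordinate, and \<open>case_nat y x\<close> inserts \<open>y\<close>
  in front of the others.  The resulting bounded operators are meaningful when \<open>h\<close> is square integrable
  on the half line and \<open>b\<close> is measurable and essentially bounded (integrable, for \<open>time_operator\<close>);
  \<open>creation_lift\<close>, \<open>annihilation_lift\<close> and \<open>conservation_lift\<close> show that the choice of
  representatives is then immaterial.
\<close>

definition creation_rep ::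
    "(real \<Rightarrow> real) \<Rightarrow> (nat \<Rightarrow> (nat \<Rightarrow> real) \<Rightarrow> complex) \<Rightarrow> nat \<Rightarrow> (nat \<Rightarrow> real) \<Rightarrow> complex"
  where "creation_rep h f n x =
           (case n of 0 \<Rightarrow> 0 | Suc m \<Rightarrow> of_real (h (x 0)) * f m (\<lambda>i. x (Suc i)))"

definition annihilation_rep ::
    "(real \<Rightarrow> real) \<Rightarrow> (nat \<Rightarrow> (nat \<Rightarrow> real) \<Rightarrow> complex) \<Rightarrow> nat \<Rightarrow> (nat \<Rightarrow> real) \<Rightarrow> complex"
  where "annihilation_rep h f n x = (\<integral>y. of_real (h y) * f (Suc n) (case_nat y x) \<partial>half_line)"

definition conservation_rep ::
    "(real \<Rightarrow> complex) \<Rightarrow> (nat \<Rightarrow> (nat \<Rightarrow> real) \<Rightarrow> complex) \<Rightarrow> nat \<Rightarrow> (nat \<Rightarrow> real) \<Rightarrow> complex"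
  where "conservation_rep b f n x = (case n of 0 \<Rightarrow> 0 | Suc m \<Rightarrow> b (x 0) * f (Suc m) x)"

definition fock_lift ::
    "((nat \<Rightarrow> (nat \<Rightarrow> real) \<Rightarrow> complex) \<Rightarrow> nat \<Rightarrow> (nat \<Rightarrow> real) \<Rightarrow> complex) \<Rightarrow> fock \<Rightarrow>\<^sub>L fock"
  where "fock_lift T = Blinfun (\<lambda>F. abs_fock (T (rep_fock F)))"

definition creation :: "(real \<Rightarrow> real) \<Rightarrow> fock \<Rightarrow>\<^sub>L fock"
  where "creation h = fock_lift (creation_rep h)"

definition annihilation :: "(real \<Rightarrow> real) \<Rightarrow> fock \<Rightarrow>\<^sub>L fock"
  where "annihilation h = fock_lift (annihilation_rep h)"

definition conservation :: "(real \<Rightarrow> complex) \<Rightarrow> fock \<Rightarrow>\<^sub>L fock"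
  where "conservation b = fock_lift (conservation_rep b)"

definition time_operator :: "(real \<Rightarrow> complex) \<Rightarrow> fock \<Rightarrow>\<^sub>L fock"
  where "time_operator b = Blinfun (fock_scale (\<integral>x. b x \<partial>half_line))"

definition nn_norm_sq :: "(nat \<Rightarrow> (nat \<Rightarrow> real) \<Rightarrow> complex) \<Rightarrow> ennreal"
  where "nn_norm_sq f = (\<Sum>n. \<integral>\<^sup>+x. ennreal ((norm (f n x))\<^sup>2) \<partial>orthant n)"

lemma fock_carrier_iff:
  "f \<in> fock_carrier \<longleftrightarrow> (\<forall>n. f n \<in> borel_measurable (orthant n)) \<and> nn_norm_sq f < \<infinity>"
proof (intro iffI conjI)
  assume f: "f \<in> fock_carrier"
  show "\<forall>n. f n \<in> borel_measurable (orthant n)"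
    using f by (auto simp: fock_carrier_def square_integrable_def)
  have "nn_norm_sq f = (\<Sum>n. ennreal (\<integral>x. (norm (f n x))\<^sup>2 \<partial>orthant n))"
    unfolding nn_norm_sq_def using f
    by (intro suminf_cong nn_integral_eq_integral) (auto simp: fock_carrier_def square_integrable_def)
  also have "\<dots> = ennreal (\<Sum>n. \<integral>x. (norm (f n x))\<^sup>2 \<partial>orthant n)"
    using f by (intro suminf_ennreal2) (auto simp: fock_carrier_def)
  finally show "nn_norm_sq f < \<infinity>" by simp
next
  assume f: "(\<forall>n. f n \<in> borel_measurable (orthant n)) \<and> nn_norm_sq f < \<infinity>"
  have fin: "(\<integral>\<^sup>+x. ennreal ((norm (f n x))\<^sup>2) \<partial>orthant n) < \<infinity>" for n
  proof -
    have "(\<integral>\<^sup>+x. ennreal ((norm (f n x))\<^sup>2) \<partial>orthant n) \<le> nn_norm_sq f"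
      unfolding nn_norm_sq_def
      using sum_le_suminf[OF summableI, of "{n}" "\<lambda>n. \<integral>\<^sup>+x. ennreal ((norm (f n x))\<^sup>2) \<partial>orthant n"] by simp
    then show ?thesis using f by (meson order.strict_trans1)
  qed
  have sq: "square_integrable (orthant n) (f n)" for n
  proof -
    have [measurable]: "f n \<in> borel_measurable (orthant n)" using f by blast
    have "integrable (orthant n) (\<lambda>x. (norm (f n x))\<^sup>2)"
      using fin[of n] by (intro integrableI_nonneg) auto
    then show ?thesis by (simp add: square_integrable_def)
  qed
  have "nn_norm_sq f = (\<Sum>n. ennreal (\<integral>x. (norm (f n x))\<^sup>2 \<partial>orthant n))"
    unfolding nn_norm_sq_def using sq
    by (intro suminf_cong nn_integral_eq_integral) (auto simp: square_integrable_def)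
  then have "summable (\<lambda>n. \<integral>x. (norm (f n x))\<^sup>2 \<partial>orthant n)"
    using f by (intro summable_suminf_not_top) auto
  then show "f \<in> fock_carrier" using sq by (simp add: fock_carrier_def)
qed

lemma fock_norm_abs:
  assumes f: "f \<in> fock_carrier"
  shows "ennreal ((norm (abs_fock f))\<^sup>2) = nn_norm_sq f"
proof -
  have "(norm (abs_fock f))\<^sup>2 = (\<Sum>n. \<integral>x. (norm (f n x))\<^sup>2 \<partial>orthant n)"
    using f by (simp add: power2_norm_eq_inner inner_fock_def fock_cinner_self)
  moreover have "nn_norm_sq f = (\<Sum>n. ennreal (\<integral>x. (norm (f n x))\<^sup>2 \<partial>orthant n))"
    unfolding nn_norm_sq_def using f
    by (intro suminf_cong nn_integral_eq_integral) (auto simp: fock_carrier_def square_integrable_def)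
  moreover have "\<dots> = ennreal (\<Sum>n. \<integral>x. (norm (f n x))\<^sup>2 \<partial>orthant n)"
    using f by (intro suminf_ennreal2) (auto simp: fock_carrier_def)
  ultimately show ?thesis by simp
qed

lemma fock_abs_eq: "fock_rel f g \<Longrightarrow> abs_fock f = abs_fock g"
  using Quotient3_rel_abs[OF Quotient3_fock] .

lemma fock_rep_abs: "f \<in> fock_carrier \<Longrightarrow> fock_rel (rep_fock (abs_fock f)) f"
  using Quotient3_fock by (simp add: fock_rel_self rep_abs_rsp_left)

lemma fock_rep_carrier: "rep_fock F \<in> fock_carrier"
  using Quotient3_rep_reflp[OF Quotient3_fock, of F] by (simp add: fock_rel_self)

lemma fock_abs_rep: "abs_fock (rep_fock F) = F"
  using Quotient3_abs_rep[OF Quotient3_fock] .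

lemma fock_lift:
  assumes meas: "\<And>f n. f \<in> fock_carrier \<Longrightarrow> T f n \<in> borel_measurable (orthant n)"
    and bound: "\<And>f. f \<in> fock_carrier \<Longrightarrow> nn_norm_sq (T f) \<le> ennreal K * nn_norm_sq f"
    and rel: "\<And>f g n. f \<in> fock_carrier \<Longrightarrow> g \<in> fock_carrier \<Longrightarrow>
        (\<And>n. AE x in orthant n. f n x = g n x) \<Longrightarrow> AE x in orthant n. T f n x = T g n x"
    and add: "\<And>f g n. f \<in> fock_carrier \<Longrightarrow> g \<in> fock_carrier \<Longrightarrow>
        AE x in orthant n. T (\<lambda>n x. f n x + g n x) n x = T f n x + T g n x"
    and scale: "\<And>f c n. f \<in> fock_carrier \<Longrightarrow>
        AE x in orthant n. T (\<lambda>n x. c * f n x) n x = c * T f n x"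
  shows "bounded_linear (\<lambda>F. abs_fock (T (rep_fock F)))"
    and "f \<in> fock_carrier \<Longrightarrow> T f \<in> fock_carrier"
    and "f \<in> fock_carrier \<Longrightarrow> blinfun_apply (fock_lift T) (abs_fock f) = abs_fock (T f)"
    and "blinfun_apply (fock_lift T) (fock_scale c F) = fock_scale c (blinfun_apply (fock_lift T) F)"
proof -
  have car: "T f \<in> fock_carrier" if "f \<in> fock_carrier" for f
    using meas[OF that] bound[OF that] that unfolding fock_carrier_iff
    by (auto intro: order.strict_trans1 simp: ennreal_mult_less_top)
  have T_rel: "fock_rel (T f) (T g)" if "fock_rel f g" for f g
    using that rel car by (auto simp: fock_rel_def)
  define A where "A F = abs_fock (T (rep_fock F))" for F
  have A: "A (abs_fock f) = abs_fock (T f)" if "f \<in> fock_carrier" for f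
    unfolding A_def by (intro fock_abs_eq T_rel fock_rep_abs that)
  have A_add: "A (F + G) = A F + A G" for F G
  proof -
    obtain f where f: "f \<in> fock_carrier" "F = abs_fock f" by (rule fock_abs_cases)
    obtain g where g: "g \<in> fock_carrier" "G = abs_fock g" by (rule fock_abs_cases)
    have "F + G = abs_fock (\<lambda>n x. f n x + g n x)"
      using f g by (simp add: plus_fock.abs_eq fock_rel_self)
    then have "A (F + G) = abs_fock (T (\<lambda>n x. f n x + g n x))"
      using f g by (simp add: A add_in_fock_carrier)
    also have "\<dots> = abs_fock (\<lambda>n x. T f n x + T g n x)"
      using f g add by (intro fock_abs_eq) (auto simp: fock_rel_def car add_in_fock_carrier)
    also have "\<dots> = A F + A G"
      using f g by (simp add: A plus_fock.abs_eq fock_rel_self car)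
    finally show ?thesis .
  qed
  have A_scale: "A (fock_scale c F) = fock_scale c (A F)" for c F
  proof -
    obtain f where f: "f \<in> fock_carrier" "F = abs_fock f" by (rule fock_abs_cases)
    have "fock_scale c F = abs_fock (\<lambda>n x. c * f n x)"
      using f by (simp add: fock_scale.abs_eq fock_rel_self)
    then have "A (fock_scale c F) = abs_fock (T (\<lambda>n x. c * f n x))"
      using f by (simp add: A scale_in_fock_carrier)
    also have "\<dots> = abs_fock (\<lambda>n x. c * T f n x)"
      using f scale by (intro fock_abs_eq) (auto simp: fock_rel_def car scale_in_fock_carrier)
    also have "\<dots> = fock_scale c (A F)"
      using f by (simp add: A fock_scale.abs_eq fock_rel_self car)
    finally show ?thesis .
  qed
  have A_norm: "norm (A F) \<le> norm F * sqrt \<bar>K\<bar>" for F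
  proof -
    obtain f where f: "f \<in> fock_carrier" "F = abs_fock f" by (rule fock_abs_cases)
    have "ennreal ((norm (A F))\<^sup>2) = nn_norm_sq (T f)" using f by (simp add: A fock_norm_abs car)
    also have "\<dots> \<le> ennreal K * nn_norm_sq f" using f by (intro bound)
    also have "nn_norm_sq f = ennreal ((norm F)\<^sup>2)" using f by (simp add: fock_norm_abs)
    also have "ennreal K * ennreal ((norm F)\<^sup>2) \<le> ennreal \<bar>K\<bar> * ennreal ((norm F)\<^sup>2)"
      by (intro mult_right_mono ennreal_leI) auto
    also have "\<dots> = ennreal (\<bar>K\<bar> * (norm F)\<^sup>2)" by (simp add: ennreal_mult)
    finally have "(norm (A F))\<^sup>2 \<le> \<bar>K\<bar> * (norm F)\<^sup>2" by (simp add: ennreal_le_iff)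
    then have "sqrt ((norm (A F))\<^sup>2) \<le> sqrt (\<bar>K\<bar> * (norm F)\<^sup>2)" by (rule real_sqrt_le_mono)
    then show ?thesis by (simp add: real_sqrt_mult mult.commute)
  qed
  have bl: "bounded_linear A"
    by (rule bounded_linear_intro[where K = "sqrt \<bar>K\<bar>"])
       (auto simp: A_add A_norm A_scale scaleR_fock_def)
  then show "bounded_linear (\<lambda>F. abs_fock (T (rep_fock F)))" by (simp add: A_def[abs_def])
  have ap: "blinfun_apply (fock_lift T) = A"
    unfolding fock_lift_def A_def[symmetric] using bl by (simp add: bounded_linear_Blinfun_apply)
  show "f \<in> fock_carrier \<Longrightarrow> T f \<in> fock_carrier" by (rule car)
  show "f \<in> fock_carrier \<Longrightarrow> blinfun_apply (fock_lift T) (abs_fock f) = abs_fock (T f)"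
    by (simp add: ap A)
  show "blinfun_apply (fock_lift T) (fock_scale c F) = fock_scale c (blinfun_apply (fock_lift T) F)"
    by (simp add: ap A_scale)
qed

lemma space_half_line: "space half_line = {0..}"
  by (simp add: half_line_def space_restrict_space)

lemma sigma_finite_half_line: "sigma_finite_measure half_line"
  unfolding half_line_def by (intro sigma_finite_measure_restrict_space lborel.sigma_finite_measure_axioms) auto

interpretation half_line: sigma_finite_measure half_line
  by (rule sigma_finite_half_line)

interpretation half_line_power: product_sigma_finite "\<lambda>i :: nat. half_line"
  by unfold_locales

lemma sigma_finite_orthant: "sigma_finite_measure (orthant n)"
  unfolding orthant_def by (rule half_line_power.sigma_finite) simp

interpretation half_line_orthant: pair_sigma_finite half_line "orthant n" for n
  by (intro pair_sigma_finite.intro sigma_finite_half_line sigma_finite_orthant)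

lemma measurable_coord[measurable]: "i < n \<Longrightarrow> (\<lambda>x. x i) \<in> measurable (orthant n) half_line"
  unfolding orthant_def by (rule measurable_component_singleton) simp

lemma measurable_cons_orthant[measurable]:
  "(\<lambda>q. case_nat (fst q) (snd q)) \<in> measurable (half_line \<Otimes>\<^sub>M orthant n) (orthant (Suc n))"
  unfolding orthant_def[of "Suc n"]
proof (rule measurable_PiM_single')
  fix i assume "i \<in> {..<Suc n}"
  then show "(\<lambda>q. case_nat (fst q) (snd q) i) \<in> measurable (half_line \<Otimes>\<^sub>M orthant n) half_line"
    using measurable_compose[OF measurable_snd measurable_coord]
    by (cases i) simp_all
next
  show "(\<lambda>q i. case_nat (fst q) (snd q) i) \<in> space (half_line \<Otimes>\<^sub>M orthant n) \<rightarrow> (\<Pi>\<^sub>E i\<in>{..<Suc n}. space half_line)"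
  proof
    fix q assume "q \<in> space (half_line \<Otimes>\<^sub>M orthant n)"
    then have y: "fst q \<in> space half_line" and "snd q \<in> space (orthant n)"
      by (simp_all only: space_pair_measure mem_Times_iff)
    then have x: "snd q \<in> (\<Pi>\<^sub>E i\<in>{..<n}. space half_line)"
      by (simp only: orthant_def space_PiM)
    show "(\<lambda>i. case_nat (fst q) (snd q) i) \<in> (\<Pi>\<^sub>E i\<in>{..<Suc n}. space half_line)"
    proof (rule PiE_I)
      show "case_nat (fst q) (snd q) i \<in> space half_line" if "i \<in> {..<Suc n}" for i
        using that y PiE_mem[OF x] by (cases i) simp_all
      show "case_nat (fst q) (snd q) i = undefined" if "i \<notin> {..<Suc n}" for i
        using that PiE_arb[OF x] by (cases i) simp_all
    qed
  qed
qed

lemma measurable_tail_orthant[measurable]: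
  "(\<lambda>x i. x (Suc i)) \<in> measurable (orthant (Suc n)) (orthant n)"
  unfolding orthant_def[of n]
proof (rule measurable_PiM_single')
  fix i assume "i \<in> {..<n}"
  then show "(\<lambda>x. x (Suc i)) \<in> measurable (orthant (Suc n)) half_line"
    by (intro measurable_coord) auto
next
  show "(\<lambda>x i. x (Suc i)) \<in> space (orthant (Suc n)) \<rightarrow> (\<Pi>\<^sub>E i\<in>{..<n}. space half_line)"
  proof
    fix x assume "x \<in> space (orthant (Suc n))"
    then have x: "x \<in> (\<Pi>\<^sub>E i\<in>{..<Suc n}. space half_line)"
      by (simp only: orthant_def space_PiM)
    show "(\<lambda>i. x (Suc i)) \<in> (\<Pi>\<^sub>E i\<in>{..<n}. space half_line)"
    proof (rule PiE_I)
      show "x (Suc i) \<in> space half_line" if "i \<in> {..<n}" for i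
        using that PiE_mem[OF x, of "Suc i"] by simp
      show "x (Suc i) = undefined" if "i \<notin> {..<n}" for i
        using that PiE_arb[OF x, of "Suc i"] by simp
    qed
  qed
qed

lemma distr_cons_orthant:
  "distr (half_line \<Otimes>\<^sub>M orthant n) (orthant (Suc n)) (\<lambda>q. case_nat (fst q) (snd q)) = orthant (Suc n)"
    (is "?D = _")
proof -
  have "?D = (\<Pi>\<^sub>M i\<in>{..<Suc n}. half_line)"
  proof (rule half_line_power.PiM_eqI)
    show "sets ?D = sets (\<Pi>\<^sub>M i\<in>{..<Suc n}. half_line)" by (simp add: orthant_def)
    fix A :: "nat \<Rightarrow> real set" assume A: "\<And>i. i \<in> {..<Suc n} \<Longrightarrow> A i \<in> sets half_line"
    have sub: "A i \<subseteq> {0..}" if "i < Suc n" for i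
      using sets.sets_into_space[OF A[of i]] that by (simp add: space_half_line)
    have PiE: "(\<Pi>\<^sub>E i\<in>{..<Suc n}. A i) \<in> sets (orthant (Suc n))"
      unfolding orthant_def using A by (intro sets_PiM_I_finite) auto
    have *: "(\<lambda>q. case_nat (fst q) (snd q)) -` (\<Pi>\<^sub>E i\<in>{..<Suc n}. A i) \<inter> space (half_line \<Otimes>\<^sub>M orthant n)
        = A 0 \<times> (\<Pi>\<^sub>E i\<in>{..<n}. A (Suc i))"
    proof (intro set_eqI iffI)
      fix q assume q: "q \<in> (\<lambda>q. case_nat (fst q) (snd q)) -` (\<Pi>\<^sub>E i\<in>{..<Suc n}. A i) \<inter> space (half_line \<Otimes>\<^sub>M orthant n)"
      then have 1: "\<And>i. i < Suc n \<Longrightarrow> case_nat (fst q) (snd q) i \<in> A i"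
        by (auto simp: PiE_iff)
      have "fst q \<in> A 0" using 1[of 0] by simp
      moreover have "snd q i \<in> A (Suc i)" if "i < n" for i using 1[of "Suc i"] that by simp
      moreover have "snd q \<in> extensional {..<n}"
        using q by (auto simp: space_pair_measure orthant_def space_PiM PiE_iff)
      ultimately show "q \<in> A 0 \<times> (\<Pi>\<^sub>E i\<in>{..<n}. A (Suc i))"
        by (cases q) (auto simp: PiE_iff)
    next
      fix q assume q: "q \<in> A 0 \<times> (\<Pi>\<^sub>E i\<in>{..<n}. A (Suc i))"
      obtain y x where qyx: "q = (y, x)" by (cases q)
      have y: "y \<in> A 0" and x: "\<And>i. i < n \<Longrightarrow> x i \<in> A (Suc i)" "x \<in> extensional {..<n}"
        using q by (auto simp: qyx PiE_iff)
      have "y \<in> {0..}" using y sub[of 0] by blast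
      moreover have "x i \<in> {0..}" if "i < n" for i
        using x(1)[OF that] sub[of "Suc i"] that by blast
      ultimately have "q \<in> space (half_line \<Otimes>\<^sub>M orthant n)"
        using x(2) by (simp add: qyx space_pair_measure orthant_def space_PiM PiE_iff space_half_line)
      moreover have "case_nat (fst q) (snd q) \<in> (\<Pi>\<^sub>E i\<in>{..<Suc n}. A i)"
      proof (rule PiE_I)
        show "case_nat (fst q) (snd q) i \<in> A i" if "i \<in> {..<Suc n}" for i
          using that x y by (cases i) (simp_all add: qyx)
        show "case_nat (fst q) (snd q) i = undefined" if "i \<notin> {..<Suc n}" for i
          using that x(2) by (cases i) (simp_all add: qyx extensional_def)
      qed
      ultimately show "q \<in> (\<lambda>q. case_nat (fst q) (snd q)) -` (\<Pi>\<^sub>E i\<in>{..<Suc n}. A i) \<inter> space (half_line \<Otimes>\<^sub>M orthant n)"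
        by simp
    qed
    have "emeasure ?D (\<Pi>\<^sub>E i\<in>{..<Suc n}. A i) = emeasure (half_line \<Otimes>\<^sub>M orthant n) (A 0 \<times> (\<Pi>\<^sub>E i\<in>{..<n}. A (Suc i)))"
      using PiE by (subst emeasure_distr) (auto simp: *)
    also have "\<dots> = emeasure half_line (A 0) * emeasure (orthant n) (\<Pi>\<^sub>E i\<in>{..<n}. A (Suc i))"
      using A by (intro sigma_finite_measure.emeasure_pair_measure_Times[OF sigma_finite_orthant])
        (auto simp: orthant_def intro!: sets_PiM_I_finite)
    also have "emeasure (orthant n) (\<Pi>\<^sub>E i\<in>{..<n}. A (Suc i)) = (\<Prod>i<n. emeasure half_line (A (Suc i)))"
      unfolding orthant_def using A by (subst half_line_power.emeasure_PiM) auto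
    finally show "emeasure ?D (\<Pi>\<^sub>E i\<in>{..<Suc n}. A i) = (\<Prod>i\<in>{..<Suc n}. emeasure half_line (A i))"
      by (simp only: prod.lessThan_Suc_shift)
  qed simp
  then show ?thesis by (simp add: orthant_def)
qed

lemma nn_integral_orthant_Suc:
  assumes [measurable]: "g \<in> borel_measurable (orthant (Suc n))"
  shows "(\<integral>\<^sup>+x. g x \<partial>orthant (Suc n)) = (\<integral>\<^sup>+y. \<integral>\<^sup>+x. g (case_nat y x) \<partial>orthant n \<partial>half_line)" (is "_ = ?A")
    and "(\<integral>\<^sup>+x. g x \<partial>orthant (Suc n)) = (\<integral>\<^sup>+x. \<integral>\<^sup>+y. g (case_nat y x) \<partial>half_line \<partial>orthant n)" (is "_ = ?B")
proof -
  have [measurable]: "(\<lambda>q. g (case_nat (fst q) (snd q))) \<in> borel_measurable (half_line \<Otimes>\<^sub>M orthant n)"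
    by (rule measurable_compose[OF measurable_cons_orthant]) simp
  have "(\<integral>\<^sup>+x. g x \<partial>orthant (Suc n)) = (\<integral>\<^sup>+q. g (case_nat (fst q) (snd q)) \<partial>(half_line \<Otimes>\<^sub>M orthant n))"
    by (subst distr_cons_orthant[symmetric], subst nn_integral_distr) auto
  moreover have "\<dots> = ?A"
    by (subst sigma_finite_measure.nn_integral_fst[OF sigma_finite_orthant, symmetric]) auto
  moreover have "(\<integral>\<^sup>+q. g (case_nat (fst q) (snd q)) \<partial>(half_line \<Otimes>\<^sub>M orthant n)) = ?B"
    by (subst half_line_orthant.nn_integral_snd[symmetric]) auto
  ultimately show "(\<integral>\<^sup>+x. g x \<partial>orthant (Suc n)) = ?A" "(\<integral>\<^sup>+x. g x \<partial>orthant (Suc n)) = ?B" by auto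
qed

lemma AE_tail_orthant:
  assumes "AE x in orthant n. P x"
  shows "AE x in orthant (Suc n). P (\<lambda>i. x (Suc i))"
proof -
  obtain N where N: "{x \<in> space (orthant n). \<not> P x} \<subseteq> N" "emeasure (orthant n) N = 0" "N \<in> sets (orthant n)"
    using assms by (rule AE_E)
  note [measurable] = N(3)
  let ?N = "(\<lambda>x i. x (Suc i)) -` N \<inter> space (orthant (Suc n))"
  have "emeasure (orthant (Suc n)) ?N = (\<integral>\<^sup>+x. indicator ?N x \<partial>orthant (Suc n))"
    using measurable_sets[OF measurable_tail_orthant N(3)] by simp
  also have "\<dots> = (\<integral>\<^sup>+x. indicator N (\<lambda>i. x (Suc i)) \<partial>orthant (Suc n))"
    by (intro nn_integral_cong) (simp add: indicator_def)
  also have "\<dots> = (\<integral>\<^sup>+y. \<integral>\<^sup>+x. indicator N x \<partial>orthant n \<partial>half_line)"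
    by (subst nn_integral_orthant_Suc) auto
  also have "\<dots> = 0" using N by simp
  finally have "?N \<in> null_sets (orthant (Suc n))" by auto
  then show ?thesis
    by (rule AE_I') (use N(1) measurable_space[OF measurable_tail_orthant] in \<open>blast\<close>)
qed

lemma measurable_cons_orthant_swap:
  "g \<in> borel_measurable (orthant (Suc n)) \<Longrightarrow>
    (\<lambda>q. g (case_nat (snd q) (fst q))) \<in> borel_measurable (orthant n \<Otimes>\<^sub>M half_line)"
  using measurable_compose[OF measurable_pair_swap' measurable_compose[OF measurable_cons_orthant]]
  by (simp add: case_prod_beta)

lemma AE_cons_orthant:
  assumes "AE x in orthant (Suc n). P x"
  shows "AE x in orthant n. AE y in half_line. P (case_nat y x)"
proof -
  obtain N where N: "{x \<in> space (orthant (Suc n)). \<not> P x} \<subseteq> N"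
      "emeasure (orthant (Suc n)) N = 0" "N \<in> sets (orthant (Suc n))"
    using assms by (rule AE_E)
  have m: "(\<lambda>q. indicator N (case_nat (snd q) (fst q)) :: ennreal) \<in> borel_measurable (orthant n \<Otimes>\<^sub>M half_line)"
    using N(3) by (intro measurable_cons_orthant_swap) simp
  have "(\<integral>\<^sup>+x. \<integral>\<^sup>+y. indicator N (case_nat y x) \<partial>half_line \<partial>orthant n) = (\<integral>\<^sup>+x. indicator N x \<partial>orthant (Suc n))"
    using N(3) by (intro nn_integral_orthant_Suc(2)[symmetric]) simp
  also have "\<dots> = 0" using N by simp
  finally have "AE x in orthant n. (\<integral>\<^sup>+y. indicator N (case_nat y x) \<partial>half_line) = 0"
    using half_line.borel_measurable_nn_integral_fst[OF m]
    by (subst (asm) nn_integral_0_iff_AE) simp_all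
  note * = this
  show ?thesis
  proof (rule AE_mp[OF *], rule AE_I2, rule impI)
    fix x assume x: "x \<in> space (orthant n)"
      and z: "(\<integral>\<^sup>+y. indicator N (case_nat y x) \<partial>half_line) = 0"
    have mx: "(\<lambda>y. indicator N (case_nat y x) :: ennreal) \<in> borel_measurable half_line"
      using measurable_compose[OF measurable_Pair1'[OF x] m] by simp
    have "AE y in half_line. (indicator N (case_nat y x) :: ennreal) = 0"
      using z nn_integral_0_iff_AE[OF mx] by simp
    note * = this
    show "AE y in half_line. P (case_nat y x)"
    proof (rule AE_mp[OF *], rule AE_I2, rule impI)
      fix y assume y: "y \<in> space half_line" and i: "(indicator N (case_nat y x) :: ennreal) = 0"
      have "case_nat y x \<in> space (orthant (Suc n))"
        using measurable_space[OF measurable_cons_orthant, of "(y, x)" n] x y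
        by (simp add: space_pair_measure)
      then show "P (case_nat y x)" using i N(1) by (auto simp: indicator_def split: if_splits)
    qed
  qed
qed

lemma suminf_ennreal_Suc: "(\<Sum>n. f n) = f 0 + (\<Sum>n. f (Suc n))" for f :: "nat \<Rightarrow> ennreal"
  using sums_unique[OF sums_Suc[OF summable_sums[OF summableI[of "\<lambda>n. f (Suc n)"]]]]
  by (simp add: add.commute)

definition l2_norm_sq :: "(real \<Rightarrow> real) \<Rightarrow> real"
  where "l2_norm_sq h = (\<integral>x. (h x)\<^sup>2 \<partial>half_line)"

lemma nn_l2_norm_sq:
  assumes "square_integrable half_line h"
  shows "(\<integral>\<^sup>+x. ennreal ((h x)\<^sup>2) \<partial>half_line) = ennreal (l2_norm_sq h)"
  unfolding l2_norm_sq_def using assms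
  by (intro nn_integral_eq_integral) (auto simp: square_integrable_def)

lemma creation_aux:
  assumes h: "square_integrable half_line h"
  shows "\<And>f n. f \<in> fock_carrier \<Longrightarrow> creation_rep h f n \<in> borel_measurable (orthant n)"
    and "\<And>f. f \<in> fock_carrier \<Longrightarrow> nn_norm_sq (creation_rep h f) \<le> ennreal (l2_norm_sq h) * nn_norm_sq f"
    and "\<And>f g n. f \<in> fock_carrier \<Longrightarrow> g \<in> fock_carrier \<Longrightarrow>
        (\<And>n. AE x in orthant n. f n x = g n x) \<Longrightarrow> AE x in orthant n. creation_rep h f n x = creation_rep h g n x"
    and "\<And>f g n. f \<in> fock_carrier \<Longrightarrow> g \<in> fock_carrier \<Longrightarrow>
        AE x in orthant n. creation_rep h (\<lambda>n x. f n x + g n x) n x = creation_rep h f n x + creation_rep h g n x"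
    and "\<And>f c n. f \<in> fock_carrier \<Longrightarrow> AE x in orthant n. creation_rep h (\<lambda>n x. c * f n x) n x = c * creation_rep h f n x"
proof -
  have hm[measurable]: "h \<in> borel_measurable half_line" using h by (simp add: square_integrable_def)
  show meas: "creation_rep h f n \<in> borel_measurable (orthant n)" if f: "f \<in> fock_carrier" for f n
  proof (cases n)
    case 0
    then show ?thesis by (simp add: creation_rep_def[abs_def])
  next
    case (Suc m)
    have [measurable]: "f m \<in> borel_measurable (orthant m)" using f by (simp add: fock_carrier_iff)
    have "(\<lambda>x. complex_of_real (h (x 0)) * f m (\<lambda>i. x (Suc i))) \<in> borel_measurable (orthant (Suc m))"
      by (intro borel_measurable_times borel_measurable_of_real measurable_compose[OF measurable_coord hm]
          measurable_compose[OF measurable_tail_orthant]) auto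
    then show ?thesis by (simp add: creation_rep_def[abs_def] Suc)
  qed
  show "nn_norm_sq (creation_rep h f) \<le> ennreal (l2_norm_sq h) * nn_norm_sq f" if f: "f \<in> fock_carrier" for f
  proof -
    have "(\<integral>\<^sup>+x. ennreal ((norm (creation_rep h f (Suc m) x))\<^sup>2) \<partial>orthant (Suc m)) =
        ennreal (l2_norm_sq h) * (\<integral>\<^sup>+x. ennreal ((norm (f m x))\<^sup>2) \<partial>orthant m)" for m
    proof -
      have [measurable]: "f m \<in> borel_measurable (orthant m)" using f by (simp add: fock_carrier_iff)
      note [measurable] = meas[OF f, of "Suc m"]
      have "(\<integral>\<^sup>+x. ennreal ((norm (creation_rep h f (Suc m) x))\<^sup>2) \<partial>orthant (Suc m)) =
        (\<integral>\<^sup>+y. \<integral>\<^sup>+x. ennreal ((norm (creation_rep h f (Suc m) (case_nat y x)))\<^sup>2) \<partial>orthant m \<partial>half_line)"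
        by (rule nn_integral_orthant_Suc(1)) measurable
      also have "\<dots> = (\<integral>\<^sup>+y. \<integral>\<^sup>+x. ennreal ((h y)\<^sup>2) * ennreal ((norm (f m x))\<^sup>2) \<partial>orthant m \<partial>half_line)"
        by (simp add: creation_rep_def norm_mult power_mult_distrib ennreal_mult)
      also have "\<dots> = (\<integral>\<^sup>+y. ennreal ((h y)\<^sup>2) * (\<integral>\<^sup>+x. ennreal ((norm (f m x))\<^sup>2) \<partial>orthant m) \<partial>half_line)"
        by (simp add: nn_integral_cmult)
      also have "\<dots> = (\<integral>\<^sup>+y. ennreal ((h y)\<^sup>2) \<partial>half_line) * (\<integral>\<^sup>+x. ennreal ((norm (f m x))\<^sup>2) \<partial>orthant m)"
        by (simp add: nn_integral_multc)
      finally show ?thesis by (simp add: nn_l2_norm_sq[OF h])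
    qed
    then have "nn_norm_sq (creation_rep h f) = (\<Sum>m. ennreal (l2_norm_sq h) * (\<integral>\<^sup>+x. ennreal ((norm (f m x))\<^sup>2) \<partial>orthant m))"
      unfolding nn_norm_sq_def by (subst suminf_ennreal_Suc) (simp add: creation_rep_def)
    then show ?thesis by (simp add: nn_norm_sq_def)
  qed
  show "AE x in orthant n. creation_rep h f n x = creation_rep h g n x"
    if "\<And>n. AE x in orthant n. f n x = g n x" for f g n
  proof (cases n)
    case 0
    then show ?thesis by (simp add: creation_rep_def)
  next
    case (Suc m)
    have "AE x in orthant (Suc m). f m (\<lambda>i. x (Suc i)) = g m (\<lambda>i. x (Suc i))"
      by (rule AE_tail_orthant) (rule that)
    then show ?thesis unfolding Suc by eventually_elim (simp add: creation_rep_def)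
  qed
  show "AE x in orthant n. creation_rep h (\<lambda>n x. f n x + g n x) n x = creation_rep h f n x + creation_rep h g n x" for f g n
    by (simp add: creation_rep_def distrib_left split: nat.split)
  show "AE x in orthant n. creation_rep h (\<lambda>n x. c * f n x) n x = c * creation_rep h f n x" for f c n
    by (simp add: creation_rep_def split: nat.split)
qed

lemmas creation_lift = fock_lift[OF creation_aux, folded creation_def]

lemma conservation_aux:
  assumes b: "b \<in> borel_measurable half_line" and bB: "AE x in half_line. norm (b x) \<le> B"
  shows "\<And>f n. f \<in> fock_carrier \<Longrightarrow> conservation_rep b f n \<in> borel_measurable (orthant n)"
    and "\<And>f. f \<in> fock_carrier \<Longrightarrow> nn_norm_sq (conservation_rep b f) \<le> ennreal (B\<^sup>2) * nn_norm_sq f"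
    and "\<And>f g n. f \<in> fock_carrier \<Longrightarrow> g \<in> fock_carrier \<Longrightarrow>
        (\<And>n. AE x in orthant n. f n x = g n x) \<Longrightarrow> AE x in orthant n. conservation_rep b f n x = conservation_rep b g n x"
    and "\<And>f g n. f \<in> fock_carrier \<Longrightarrow> g \<in> fock_carrier \<Longrightarrow>
        AE x in orthant n. conservation_rep b (\<lambda>n x. f n x + g n x) n x = conservation_rep b f n x + conservation_rep b g n x"
    and "\<And>f c n. f \<in> fock_carrier \<Longrightarrow> AE x in orthant n. conservation_rep b (\<lambda>n x. c * f n x) n x = c * conservation_rep b f n x"
proof -
  show meas: "conservation_rep b f n \<in> borel_measurable (orthant n)" if f: "f \<in> fock_carrier" for f n
  proof (cases n)
    case 0
    then show ?thesis by (simp add: conservation_rep_def[abs_def])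
  next
    case (Suc m)
    have [measurable]: "f (Suc m) \<in> borel_measurable (orthant (Suc m))" using f by (simp add: fock_carrier_iff)
    have "(\<lambda>x. b (x 0) * f (Suc m) x) \<in> borel_measurable (orthant (Suc m))"
      by (intro borel_measurable_times measurable_compose[OF measurable_coord b]) auto
    then show ?thesis by (simp add: conservation_rep_def[abs_def] Suc)
  qed
  show "nn_norm_sq (conservation_rep b f) \<le> ennreal (B\<^sup>2) * nn_norm_sq f" if f: "f \<in> fock_carrier" for f
  proof -
    have "(\<integral>\<^sup>+x. ennreal ((norm (conservation_rep b f n x))\<^sup>2) \<partial>orthant n) \<le>
        ennreal (B\<^sup>2) * (\<integral>\<^sup>+x. ennreal ((norm (f n x))\<^sup>2) \<partial>orthant n)" for n
    proof (cases n)
      case 0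
      then show ?thesis by (simp add: conservation_rep_def)
    next
      case (Suc m)
      note [measurable] = b
      have [measurable]: "f n \<in> borel_measurable (orthant n)" using f by (simp add: fock_carrier_iff)
      have "AE x in half_line. AE y in orthant m. norm (b x) \<le> B"
        using bB by eventually_elim simp
      then have "AE q in half_line \<Otimes>\<^sub>M orthant m. norm (b (fst q)) \<le> B"
        by (intro half_line_orthant.AE_pair_measure) simp_all
      then have "AE x in distr (half_line \<Otimes>\<^sub>M orthant m) (orthant (Suc m)) (\<lambda>q. case_nat (fst q) (snd q)).
          norm (b (x 0)) \<le> B"
        using measurable_compose[OF measurable_coord[of 0 "Suc m"] b]
        by (subst AE_distr_iff) simp_all
      then have "AE x in orthant n. norm (b (x 0)) \<le> B"
        unfolding distr_cons_orthant Suc .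
      then have "(\<integral>\<^sup>+x. ennreal ((norm (conservation_rep b f n x))\<^sup>2) \<partial>orthant n) \<le>
         (\<integral>\<^sup>+x. ennreal (B\<^sup>2) * ennreal ((norm (f n x))\<^sup>2) \<partial>orthant n)"
      proof (intro nn_integral_mono_AE, eventually_elim)
        fix x :: "nat \<Rightarrow> real" assume "norm (b (x 0)) \<le> B"
        then have "(norm (conservation_rep b f n x))\<^sup>2 \<le> B\<^sup>2 * (norm (f n x))\<^sup>2"
          by (auto simp: conservation_rep_def Suc norm_mult power_mult_distrib intro!: mult_right_mono power_mono)
        then show "ennreal ((norm (conservation_rep b f n x))\<^sup>2) \<le> ennreal (B\<^sup>2) * ennreal ((norm (f n x))\<^sup>2)"
          by (simp add: ennreal_mult[symmetric] ennreal_leI)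
      qed
      then show ?thesis by (simp add: nn_integral_cmult)
    qed
    then have "nn_norm_sq (conservation_rep b f) \<le> (\<Sum>n. ennreal (B\<^sup>2) * (\<integral>\<^sup>+x. ennreal ((norm (f n x))\<^sup>2) \<partial>orthant n))"
      unfolding nn_norm_sq_def by (intro suminf_le summableI)
    then show ?thesis by (simp add: nn_norm_sq_def)
  qed
  show "AE x in orthant n. conservation_rep b f n x = conservation_rep b g n x"
    if "\<And>n. AE x in orthant n. f n x = g n x" for f g n
    using that[of n] by eventually_elim (auto simp: conservation_rep_def split: nat.split)
  show "AE x in orthant n. conservation_rep b (\<lambda>n x. f n x + g n x) n x = conservation_rep b f n x + conservation_rep b g n x" for f g n
    by (simp add: conservation_rep_def distrib_left split: nat.split)
  show "AE x in orthant n. conservation_rep b (\<lambda>n x. c * f n x) n x = c * conservation_rep b f n x" for f c n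
    by (simp add: conservation_rep_def split: nat.split)
qed

lemmas conservation_lift = fock_lift[OF conservation_aux, folded conservation_def]

lemma annihilation_aux:
  assumes h: "square_integrable half_line h"
  shows "\<And>f n. f \<in> fock_carrier \<Longrightarrow> annihilation_rep h f n \<in> borel_measurable (orthant n)"
    and "\<And>f. f \<in> fock_carrier \<Longrightarrow> nn_norm_sq (annihilation_rep h f) \<le> ennreal (l2_norm_sq h) * nn_norm_sq f"
    and "\<And>f g n. f \<in> fock_carrier \<Longrightarrow> g \<in> fock_carrier \<Longrightarrow>
        (\<And>n. AE x in orthant n. f n x = g n x) \<Longrightarrow> AE x in orthant n. annihilation_rep h f n x = annihilation_rep h g n x"
    and "\<And>f g n. f \<in> fock_carrier \<Longrightarrow> g \<in> fock_carrier \<Longrightarrow>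
        AE x in orthant n. annihilation_rep h (\<lambda>n x. f n x + g n x) n x = annihilation_rep h f n x + annihilation_rep h g n x"
    and "\<And>f c n. f \<in> fock_carrier \<Longrightarrow> AE x in orthant n. annihilation_rep h (\<lambda>n x. c * f n x) n x = c * annihilation_rep h f n x"
proof -
  have hm[measurable]: "h \<in> borel_measurable half_line" using h by (simp add: square_integrable_def)
  have fm: "f n \<in> borel_measurable (orthant n)" if "f \<in> fock_carrier" for f n
    using that by (simp add: fock_carrier_iff)
  have sm: "(\<lambda>y. f (Suc n) (case_nat y x)) \<in> borel_measurable half_line"
    if "f \<in> fock_carrier" "x \<in> space (orthant n)" for f n x
    using measurable_compose[OF measurable_Pair1'[OF that(2)] measurable_cons_orthant_swap[OF fm[OF that(1)]]]
    by simp
  show meas: "annihilation_rep h f n \<in> borel_measurable (orthant n)" if f: "f \<in> fock_carrier" for f n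
  proof -
    note [measurable] = measurable_cons_orthant_swap[OF fm[OF f, of "Suc n"]]
    have "(\<lambda>q. complex_of_real (h (snd q)) * f (Suc n) (case_nat (snd q) (fst q)))
        \<in> borel_measurable (orthant n \<Otimes>\<^sub>M half_line)"
      by measurable
    then show ?thesis
      unfolding annihilation_rep_def by (intro half_line.borel_measurable_lebesgue_integral) (simp add: case_prod_beta')
  qed
  have cs: "(\<integral>\<^sup>+y. ennreal (norm (of_real (h y) * f (Suc n) (case_nat y x))) \<partial>half_line)\<^sup>2
      \<le> ennreal (l2_norm_sq h) * (\<integral>\<^sup>+y. ennreal ((norm (f (Suc n) (case_nat y x)))\<^sup>2) \<partial>half_line)"
    if "f \<in> fock_carrier" "x \<in> space (orthant n)" for f n x
  proof -
    note [measurable] = sm[OF that]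
    have "(\<integral>\<^sup>+y. ennreal (norm (of_real (h y) * f (Suc n) (case_nat y x))) \<partial>half_line)\<^sup>2 =
       (\<integral>\<^sup>+y. ennreal \<bar>h y\<bar> * ennreal (norm (f (Suc n) (case_nat y x))) \<partial>half_line)\<^sup>2"
      by (simp add: norm_mult ennreal_mult)
    also have "\<dots> \<le> (\<integral>\<^sup>+y. (ennreal \<bar>h y\<bar>)\<^sup>2 \<partial>half_line) *
        (\<integral>\<^sup>+y. (ennreal (norm (f (Suc n) (case_nat y x))))\<^sup>2 \<partial>half_line)"
      by (intro Cauchy_Schwarz_nn_integral) measurable
    finally show ?thesis
      by (simp add: ennreal_power nn_l2_norm_sq[OF h])
  qed
  have fin: "AE x in orthant n. integrable half_line (\<lambda>y. of_real (h y) * f (Suc n) (case_nat y x))"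
    if f: "f \<in> fock_carrier" for f n
  proof -
    note [measurable] = measurable_cons_orthant_swap[OF fm[OF f, of "Suc n"]] fm[OF f]
    have "(\<integral>\<^sup>+x. ennreal ((norm (f (Suc n) x))\<^sup>2) \<partial>orthant (Suc n)) \<le> nn_norm_sq f"
      unfolding nn_norm_sq_def
      using sum_le_suminf[OF summableI, of "{Suc n}" "\<lambda>n. \<integral>\<^sup>+x. ennreal ((norm (f n x))\<^sup>2) \<partial>orthant n"] by simp
    also have "\<dots> < \<infinity>" using f by (simp add: fock_carrier_iff)
    finally have "(\<integral>\<^sup>+x. \<integral>\<^sup>+y. ennreal ((norm (f (Suc n) (case_nat y x)))\<^sup>2) \<partial>half_line \<partial>orthant n) \<noteq> \<infinity>"
      by (subst nn_integral_orthant_Suc(2)[symmetric]) auto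
    moreover have "(\<lambda>q. ennreal ((norm (f (Suc n) (case_nat (snd q) (fst q))))\<^sup>2))
        \<in> borel_measurable (orthant n \<Otimes>\<^sub>M half_line)" by measurable
    ultimately have "AE x in orthant n. (\<integral>\<^sup>+y. ennreal ((norm (f (Suc n) (case_nat y x)))\<^sup>2) \<partial>half_line) \<noteq> \<infinity>"
      by (intro nn_integral_PInf_AE half_line.borel_measurable_nn_integral) (simp_all add: case_prod_beta')
    note * = this
    show ?thesis
    proof (rule AE_mp[OF *], rule AE_I2, rule impI)
      fix x assume x: "x \<in> space (orthant n)"
        and z: "(\<integral>\<^sup>+y. ennreal ((norm (f (Suc n) (case_nat y x)))\<^sup>2) \<partial>half_line) \<noteq> \<infinity>"
      note [measurable] = sm[OF f x]
      have "ennreal (l2_norm_sq h) * (\<integral>\<^sup>+y. ennreal ((norm (f (Suc n) (case_nat y x)))\<^sup>2) \<partial>half_line) < \<infinity>"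
        using z by (simp add: ennreal_mult_less_top top.not_eq_extremum)
      with cs[OF f x] have "(\<integral>\<^sup>+y. ennreal (norm (of_real (h y) * f (Suc n) (case_nat y x))) \<partial>half_line)\<^sup>2 < \<infinity>"
        by (rule order.strict_trans1)
      then have "(\<integral>\<^sup>+y. ennreal (norm (of_real (h y) * f (Suc n) (case_nat y x))) \<partial>half_line) < \<infinity>"
        by (simp add: power2_eq_square ennreal_mult_less_top) (elim disjE, simp_all)
      then show "integrable half_line (\<lambda>y. of_real (h y) * f (Suc n) (case_nat y x))"
        by (intro integrableI_bounded) simp_all
    qed
  qed
  show "nn_norm_sq (annihilation_rep h f) \<le> ennreal (l2_norm_sq h) * nn_norm_sq f" if f: "f \<in> fock_carrier" for f
  proof -
    have "(\<integral>\<^sup>+x. ennreal ((norm (annihilation_rep h f n x))\<^sup>2) \<partial>orthant n) \<le>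
        ennreal (l2_norm_sq h) * (\<integral>\<^sup>+x. ennreal ((norm (f (Suc n) x))\<^sup>2) \<partial>orthant (Suc n))" for n
    proof -
      note [measurable] = measurable_cons_orthant_swap[OF fm[OF f, of "Suc n"]] fm[OF f]
      have mq: "(\<lambda>q. ennreal ((norm (f (Suc n) (case_nat (snd q) (fst q))))\<^sup>2))
        \<in> borel_measurable (orthant n \<Otimes>\<^sub>M half_line)" by measurable
      have "(\<integral>\<^sup>+x. ennreal ((norm (annihilation_rep h f n x))\<^sup>2) \<partial>orthant n) \<le>
        (\<integral>\<^sup>+x. ennreal (l2_norm_sq h) *
           (\<integral>\<^sup>+y. ennreal ((norm (f (Suc n) (case_nat y x)))\<^sup>2) \<partial>half_line) \<partial>orthant n)"
      proof (rule nn_integral_mono_AE, rule AE_mp[OF fin[OF f, of n]], rule AE_I2, rule impI)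
        fix x assume x: "x \<in> space (orthant n)"
          and i: "integrable half_line (\<lambda>y. of_real (h y) * f (Suc n) (case_nat y x))"
        have "ennreal ((norm (annihilation_rep h f n x))\<^sup>2) = (ennreal (norm (annihilation_rep h f n x)))\<^sup>2"
          by (simp add: ennreal_power)
        also have "\<dots> \<le> (\<integral>\<^sup>+y. ennreal (norm (of_real (h y) * f (Suc n) (case_nat y x))) \<partial>half_line)\<^sup>2"
          unfolding annihilation_rep_def by (intro power_mono integral_norm_bound_ennreal i) simp
        also note cs[OF f x]
        finally show "ennreal ((norm (annihilation_rep h f n x))\<^sup>2) \<le> ennreal (l2_norm_sq h) *
           (\<integral>\<^sup>+y. ennreal ((norm (f (Suc n) (case_nat y x)))\<^sup>2) \<partial>half_line)" .
      qed
      also have "\<dots> = ennreal (l2_norm_sq h) *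
          (\<integral>\<^sup>+x. \<integral>\<^sup>+y. ennreal ((norm (f (Suc n) (case_nat y x)))\<^sup>2) \<partial>half_line \<partial>orthant n)"
        using mq by (intro nn_integral_cmult half_line.borel_measurable_nn_integral) (simp add: case_prod_beta')
      also have "(\<integral>\<^sup>+x. \<integral>\<^sup>+y. ennreal ((norm (f (Suc n) (case_nat y x)))\<^sup>2) \<partial>half_line \<partial>orthant n) =
          (\<integral>\<^sup>+x. ennreal ((norm (f (Suc n) x))\<^sup>2) \<partial>orthant (Suc n))"
        by (rule nn_integral_orthant_Suc(2)[symmetric]) measurable
      finally show ?thesis .
    qed
    then have "nn_norm_sq (annihilation_rep h f) \<le> (\<Sum>n. ennreal (l2_norm_sq h) *
        (\<integral>\<^sup>+x. ennreal ((norm (f (Suc n) x))\<^sup>2) \<partial>orthant (Suc n)))"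
      unfolding nn_norm_sq_def by (intro suminf_le summableI)
    also have "\<dots> = ennreal (l2_norm_sq h) * (\<Sum>n. \<integral>\<^sup>+x. ennreal ((norm (f (Suc n) x))\<^sup>2) \<partial>orthant (Suc n))"
      by simp
    also have "\<dots> \<le> ennreal (l2_norm_sq h) * nn_norm_sq f"
      unfolding nn_norm_sq_def
      by (subst (2) suminf_ennreal_Suc) (intro mult_left_mono, auto)
    finally show ?thesis .
  qed
  show "AE x in orthant n. annihilation_rep h f n x = annihilation_rep h g n x"
    if f: "f \<in> fock_carrier" and g: "g \<in> fock_carrier" and e: "\<And>n. AE x in orthant n. f n x = g n x" for f g n
  proof (rule AE_mp[OF AE_cons_orthant[OF e[of "Suc n"]]], rule AE_I2, rule impI)
    fix x assume x: "x \<in> space (orthant n)"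
      and ae: "AE y in half_line. f (Suc n) (case_nat y x) = g (Suc n) (case_nat y x)"
    note [measurable] = sm[OF f x] sm[OF g x]
    show "annihilation_rep h f n x = annihilation_rep h g n x"
      unfolding annihilation_rep_def using ae by (intro integral_cong_AE) (measurable, auto)
  qed
  show "AE x in orthant n. annihilation_rep h (\<lambda>n x. f n x + g n x) n x = annihilation_rep h f n x + annihilation_rep h g n x"
    if f: "f \<in> fock_carrier" and g: "g \<in> fock_carrier" for f g n
    using fin[OF f, of n] fin[OF g, of n]
    by eventually_elim (simp add: annihilation_rep_def distrib_left)
  show "AE x in orthant n. annihilation_rep h (\<lambda>n x. c * f n x) n x = c * annihilation_rep h f n x" for f c n
    by (simp add: annihilation_rep_def mult.left_commute)
qed

lemmas annihilation_lift = fock_lift[OF annihilation_aux, folded annihilation_def]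

lemma norm_fock_scale: "norm (fock_scale c F) = norm c * norm F"
proof -
  have "(norm (fock_scale c F))\<^sup>2 = (norm c * norm F)\<^sup>2"
  proof -
    have "fock_cinner (fock_scale c F) (fock_scale c F) = cnj c * c * fock_cinner F F"
      by (subst fock_cinner_scale_right, subst fock_cinner_commute, subst fock_cinner_scale_right)
        (simp add: fock_cinner_commute[of F F, symmetric])
    moreover have "cnj c * c = of_real ((norm c)\<^sup>2)"
      using complex_norm_square[of c] by (simp add: mult.commute)
    ultimately show ?thesis
      by (simp add: power2_norm_eq_inner inner_fock_def power_mult_distrib)
  qed
  then show ?thesis
    by (metis norm_ge_zero mult_nonneg_nonneg power2_eq_imp_eq)
qed

lemma time_operator_apply: "blinfun_apply (time_operator b) F = fock_scale (\<integral>x. b x \<partial>half_line) F"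
proof -
  have "bounded_linear (fock_scale c)" for c
    by (rule bounded_linear_intro[where K = "norm c"])
       (simp_all add: fock_scale_add_right scaleR_fock_def fock_scale_scale norm_fock_scale mult.commute)
  then show ?thesis by (simp add: time_operator_def bounded_linear_Blinfun_apply)
qed

interpretation fock_complex: vector_space fock_scale
  by unfold_locales (simp_all add: fock_scale_add_right fock_scale_add_left fock_scale_scale fock_scale_one)

definition is_partition :: "(nat \<Rightarrow> real) \<Rightarrow> bool"
  where "is_partition t \<longleftrightarrow> t 0 = 0 \<and> strict_mono t \<and> (\<Union>i. {t i..<t (Suc i)}) = {0..}"

text \<open>The mesh takes values in \<^typ>\<open>ennreal\<close> because the steps of a partition may be unbounded.\<close>

definition mesh :: "(nat \<Rightarrow> real) \<Rightarrow> ennreal"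
  where "mesh t = (SUP i. ennreal \<bar>t (Suc i) - t i\<bar>)"

definition toy_step :: "(nat \<Rightarrow> real) \<Rightarrow> nat \<Rightarrow> real \<Rightarrow> real"
  where "toy_step t i x = indicator {t i..<t (Suc i)} x / sqrt (t (Suc i) - t i)"

text \<open>
  The tensor product of the steps indexed by the letters of a word.  For the empty word it is the
  constant \<open>1\<close> on the one-point space \<open>orthant 0\<close>, that is, the vacuum \<open>\<Omega>\<close>.
\<close>

definition toy_word_rep :: "(nat \<Rightarrow> real) \<Rightarrow> nat list \<Rightarrow> nat \<Rightarrow> (nat \<Rightarrow> real) \<Rightarrow> complex"
  where "toy_word_rep t \<sigma> n x =
           (if n = length \<sigma> then \<Prod>j<n. of_real (toy_step t (\<sigma> ! j) (x j)) else 0)"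

definition toy_word :: "(nat \<Rightarrow> real) \<Rightarrow> nat list \<Rightarrow> fock"
  where "toy_word t \<sigma> = abs_fock (toy_word_rep t \<sigma>)"

lemma square_integrable_toy_step: "square_integrable half_line (toy_step t i)"
proof -
  have s: "{t i..<t (Suc i)} \<inter> {0..} = {max 0 (t i)..<t (Suc i)}" by auto
  have "integrable half_line (indicator ({t i..<t (Suc i)} \<inter> {0..}) :: real \<Rightarrow> real)"
    unfolding half_line_def s
  proof (rule integrable_real_indicator)
    show "{max 0 (t i)..<t (Suc i)} \<in> sets (restrict_space lborel {0..})"
      by (auto simp: sets_restrict_space_iff)
    have "emeasure (restrict_space lborel {0..}) {max 0 (t i)..<t (Suc i)} =
        emeasure lborel {max 0 (t i)..<t (Suc i)}"
      by (rule emeasure_restrict_space) auto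
    also have "\<dots> < \<infinity>" by (rule emeasure_bounded_finite) simp
    finally show "emeasure (restrict_space lborel {0..}) {max 0 (t i)..<t (Suc i)} < \<infinity>" .
  qed
  then have "integrable half_line (\<lambda>x. indicator ({t i..<t (Suc i)} \<inter> {0..}) x / (sqrt (t (Suc i) - t i))\<^sup>2 :: real)"
    by (rule integrable_divide_zero[rotated])
  moreover have "(\<lambda>x. (norm (toy_step t i x))\<^sup>2) x =
      indicator ({t i..<t (Suc i)} \<inter> {0..}) x / (sqrt (t (Suc i) - t i))\<^sup>2" if "x \<in> space half_line" for x
    using that by (auto simp: toy_step_def power_divide space_half_line split: split_indicator)
  ultimately have "integrable half_line (\<lambda>x. (norm (toy_step t i x))\<^sup>2)"
    by (subst Bochner_Integration.integrable_cong[OF refl]) auto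
  moreover have "toy_step t i \<in> borel_measurable half_line"
    unfolding half_line_def toy_step_def[abs_def] by (intro measurable_restrict_space1) measurable
  ultimately show ?thesis by (simp add: square_integrable_def)
qed

lemma toy_word_rep_in_fock_carrier: "toy_word_rep t \<sigma> \<in> fock_carrier"
proof -
  let ?n = "length \<sigma>"
  have sm[measurable]: "toy_step t i \<in> borel_measurable half_line" for i
    using square_integrable_toy_step by (simp add: square_integrable_def)
  have cm: "(\<lambda>x. toy_step t i (x j)) \<in> borel_measurable (orthant n)" if "j < n" for i j n
    by (rule measurable_compose[OF measurable_coord[OF that] sm])
  have "toy_word_rep t \<sigma> n \<in> borel_measurable (orthant n)" for n
    unfolding toy_word_rep_def[abs_def]
    by (cases "n = ?n") (auto intro!: borel_measurable_prod borel_measurable_of_real cm)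
  moreover have "nn_norm_sq (toy_word_rep t \<sigma>) < \<infinity>"
  proof -
    have "nn_norm_sq (toy_word_rep t \<sigma>) = (\<Sum>n. if n = ?n then
        \<integral>\<^sup>+x. ennreal ((norm (toy_word_rep t \<sigma> n x))\<^sup>2) \<partial>orthant n else 0)"
      unfolding nn_norm_sq_def by (intro suminf_cong) (simp add: toy_word_rep_def)
    also have "\<dots> = (\<integral>\<^sup>+x. ennreal ((norm (toy_word_rep t \<sigma> ?n x))\<^sup>2) \<partial>orthant ?n)"
      by (subst suminf_finite[of "{?n}"]) auto
    also have "\<dots> = (\<integral>\<^sup>+x. (\<Prod>j<?n. ennreal ((toy_step t (\<sigma> ! j) (x j))\<^sup>2)) \<partial>orthant ?n)"
      by (intro nn_integral_cong)
        (simp add: toy_word_rep_def prod_norm[symmetric] prod_power_distrib[symmetric] prod_ennreal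
          flip: abs_prod)
    also have "\<dots> = (\<Prod>j<?n. \<integral>\<^sup>+y. ennreal ((toy_step t (\<sigma> ! j) y)\<^sup>2) \<partial>half_line)"
      unfolding orthant_def by (intro half_line_power.product_nn_integral_prod) auto
    also have "\<dots> < \<infinity>"
      by (simp add: nn_l2_norm_sq[OF square_integrable_toy_step] prod_ennreal l2_norm_sq_def)
    finally show ?thesis .
  qed
  ultimately show ?thesis by (simp add: fock_carrier_iff)
qed

text \<open>The words without equal adjacent letters are the adapted ones.\<close>

definition toy_fock :: "(nat \<Rightarrow> real) \<Rightarrow> fock set"
  where "toy_fock t = closure (fock_complex.span {toy_word t \<sigma> |\<sigma>. distinct_adj \<sigma>})"

definition orthogonal_projection :: "fock set \<Rightarrow> fock \<Rightarrow>\<^sub>L fock"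
  where "orthogonal_projection M = (THE P. \<forall>F. blinfun_apply P F \<in> M \<and>
           (\<forall>G\<in>M. fock_cinner G (F - blinfun_apply P F) = 0))"

definition toy_proj :: "(nat \<Rightarrow> real) \<Rightarrow> fock \<Rightarrow>\<^sub>L fock"
  where "toy_proj t = orthogonal_projection (toy_fock t)"

definition toy_creation :: "(nat \<Rightarrow> real) \<Rightarrow> nat \<Rightarrow> fock \<Rightarrow>\<^sub>L fock"
  where "toy_creation t i = toy_proj t o\<^sub>L creation (toy_step t i) o\<^sub>L toy_proj t"

definition toy_annihilation :: "(nat \<Rightarrow> real) \<Rightarrow> nat \<Rightarrow> fock \<Rightarrow>\<^sub>L fock"
  where "toy_annihilation t i = toy_proj t o\<^sub>L annihilation (toy_step t i) o\<^sub>L toy_proj t"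

definition toy_conservation :: "(nat \<Rightarrow> real) \<Rightarrow> nat \<Rightarrow> fock \<Rightarrow>\<^sub>L fock"
  where "toy_conservation t i =
           toy_proj t o\<^sub>L conservation (indicator {t i..<t (Suc i)}) o\<^sub>L toy_proj t"

definition toy_time :: "(nat \<Rightarrow> real) \<Rightarrow> nat \<Rightarrow> fock \<Rightarrow>\<^sub>L fock"
  where "toy_time t i = toy_proj t o\<^sub>L (id_blinfun - toy_conservation t i) o\<^sub>L toy_proj t"

end

theory Submission
  imports Defs
begin

text \<open>
  Call a closed complex subspace of \<open>\<Phi>\<close> invariant if it contains the vacuum and is mapped into itself by
  all \<open>a\<^sup>+(1\<^bsub>[0,s)\<^esub>)\<close>.  Such a subspace is all of \<open>\<Phi>\<close>: a vector orthogonal to it has vanishing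
  integrals over the boxes with a corner at the origin, which generate the Borel sets.  Hence strong
  convergence of contractions need only be propagated along creation.  For \<open>P\<^sub>n\<close>, if \<open>P\<^sub>n F \<rightarrow> F\<close>, the
  vectors \<open>\<Sum>\<^sub>i sqrt (\<Delta>\<^sub>i) a\<^sup>+(X\<^sub>i) (Id - a\<^sup>\<circ>(1\<^sub>i)) P\<^sub>n F\<close> belong to the toy space and tend to
  \<open>a\<^sup>+(1\<^bsub>[0,s)\<^esub>) F\<close>, because the nonadapted part, that with \<open>a\<^sup>\<circ>\<close>, has norm at most \<open>sqrt \<delta> \<parallel>F\<parallel>\<close>.

  By linearity \<open>a\<^sub>t\<^sup>\<plusminus>(n) = P\<^sub>n a\<^sup>\<plusminus>(1\<^bsub>[0,\<tau>)\<^esub>) P\<^sub>n\<close> with \<open>\<tau>\<close> the first partition point after \<open>t\<close>, and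
  similarly for \<open>a\<^sup>\<circ>\<close>; moreover \<open>a\<^sub>t\<^sup>\<times>(n) = \<tau> P\<^sub>n - P\<^sub>n (\<Sum>\<^sub>i \<Delta>\<^sub>i a\<^sup>\<circ>(1\<^sub>i)) P\<^sub>n\<close>, whose second term has norm
  at most \<open>\<delta>\<close>.
\<close>

section \<open>Completeness and orthogonal projections\<close>

text \<open>Fatou's lemma is used twice, on each orthant and then over the levels, the series being
  an integral against counting measure.\<close>

lemma nn_norm_sq_Fatou:
  assumes u: "\<And>i n. u i n \<in> borel_measurable (orthant n)"
    and lim: "\<And>n. AE x in orthant n. (\<lambda>i. u i n x) \<longlonglongrightarrow> g n x"
  shows "nn_norm_sq g \<le> liminf (\<lambda>i. nn_norm_sq (u i))"
proof -
  note [measurable] = u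
  let ?I = "\<lambda>i n. \<integral>\<^sup>+x. ennreal ((norm (u i n x))\<^sup>2) \<partial>orthant n"
  have "(\<integral>\<^sup>+x. ennreal ((norm (g n x))\<^sup>2) \<partial>orthant n) \<le> liminf (\<lambda>i. ?I i n)" for n
  proof -
    have "(\<integral>\<^sup>+x. ennreal ((norm (g n x))\<^sup>2) \<partial>orthant n) =
        (\<integral>\<^sup>+x. liminf (\<lambda>i. ennreal ((norm (u i n x))\<^sup>2)) \<partial>orthant n)"
    proof (rule nn_integral_cong_AE, use lim[of n] in eventually_elim)
      fix x assume "(\<lambda>i. u i n x) \<longlonglongrightarrow> g n x"
      then have "(\<lambda>i. ennreal ((norm (u i n x))\<^sup>2)) \<longlonglongrightarrow> ennreal ((norm (g n x))\<^sup>2)"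
        by (intro tendsto_intros)
      then show "ennreal ((norm (g n x))\<^sup>2) = liminf (\<lambda>i. ennreal ((norm (u i n x))\<^sup>2))"
        by (intro lim_imp_Liminf[symmetric]) simp_all
    qed
    also have "\<dots> \<le> liminf (\<lambda>i. ?I i n)"
      by (intro nn_integral_liminf) measurable
    finally show ?thesis .
  qed
  then have "nn_norm_sq g \<le> (\<integral>\<^sup>+n. liminf (\<lambda>i. ?I i n) \<partial>count_space UNIV)"
    unfolding nn_norm_sq_def nn_integral_count_space_nat by (intro suminf_le summableI)
  also have "\<dots> \<le> liminf (\<lambda>i. \<integral>\<^sup>+n. ?I i n \<partial>count_space UNIV)"
    by (intro nn_integral_liminf) simp
  finally show ?thesis by (simp add: nn_integral_count_space_nat nn_norm_sq_def)
qed

lemma abs_fock_diff: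
  assumes f: "f \<in> fock_carrier" and g: "g \<in> fock_carrier"
  shows "(\<lambda>n x. f n x - g n x) \<in> fock_carrier"
    and "abs_fock f - abs_fock g = abs_fock (\<lambda>n x. f n x - g n x)"
proof -
  have g': "(\<lambda>n x. (- 1) * g n x) \<in> fock_carrier" by (rule scale_in_fock_carrier[OF g])
  show "(\<lambda>n x. f n x - g n x) \<in> fock_carrier"
    using add_in_fock_carrier[OF f g'] by simp
  have "- abs_fock g = abs_fock (\<lambda>n x. (- 1) * g n x)"
    using g unfolding uminus_fock_def by (simp only: fock_scale.abs_eq fock_rel_self)
  then show "abs_fock f - abs_fock g = abs_fock (\<lambda>n x. f n x - g n x)"
    using f g' unfolding minus_fock_def by (simp only: plus_fock.abs_eq fock_rel_self) simp
qed

lemma nn_level_le_nn_norm_sq: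
  "(\<integral>\<^sup>+x. ennreal ((norm (f n x))\<^sup>2) \<partial>orthant n) \<le> nn_norm_sq f"
  unfolding nn_norm_sq_def
  using sum_le_suminf[OF summableI, of "{n}" "\<lambda>n. \<integral>\<^sup>+x. ennreal ((norm (f n x))\<^sup>2) \<partial>orthant n"] by simp

lemma Cauchy_subseq_power:
  fixes X :: "nat \<Rightarrow> 'a::metric_space"
  assumes "Cauchy X"
  obtains r where "strict_mono r" "\<And>n i. r n \<le> i \<Longrightarrow> dist (X i) (X (r n)) < (1/2)^n"
proof -
  have "\<forall>n. \<exists>N. \<forall>i\<ge>N. \<forall>j\<ge>N. dist (X i) (X j) < (1/2)^n"
    using assms by (auto intro: metric_CauchyD)
  then obtain N where N: "\<And>n i j. i \<ge> N n \<Longrightarrow> j \<ge> N n \<Longrightarrow> dist (X i) (X j) < (1/2)^n"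
    by metis
  \<comment> \<open>Summing makes \<open>r n\<close> at least \<open>N n\<close>, and the
    \<open>Suc\<close> makes \<open>r\<close> strictly increasing.\<close>
  define r where "r n = (\<Sum>i\<le>n. Suc (N i))" for n
  have "N n \<le> r n" for n
  proof -
    have "Suc (N n) \<le> r n" unfolding r_def by (rule member_le_sum) auto
    then show ?thesis by simp
  qed
  moreover have "strict_mono r" by (rule strict_monoI_Suc) (simp add: r_def)
  ultimately show ?thesis using N by (intro that[of r]) (blast intro: order_trans)+
qed

text \<open>The Riesz-Fischer argument: a geometrically fast subsequence converges almost everywhere
  on each level, and Fatou's lemma shows that its pointwise limit is also its limit in norm.\<close>

lemma fock_Cauchy_convergent:
  fixes X :: "nat \<Rightarrow> fock"
  assumes X: "Cauchy X"
  shows "convergent X"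
proof -
  obtain r where r: "strict_mono r" "\<And>n i. r n \<le> i \<Longrightarrow> dist (X i) (X (r n)) < (1/2)^n"
    using Cauchy_subseq_power[OF X] by blast
  define f where "f i = rep_fock (X (r i))" for i
  have fc: "f i \<in> fock_carrier" for i by (simp add: f_def fock_rep_carrier)
  then have fm[measurable]: "f i m \<in> borel_measurable (orthant m)" for i m
    by (simp add: fock_carrier_iff)
  have sq: "((1/2)^i)\<^sup>2 = ((1/4)^i :: real)" for i :: nat
    by (simp add: power2_eq_square power_mult_distrib[symmetric] del: power_mult_distrib)
  have norm_diff: "nn_norm_sq (\<lambda>m x. f j m x - f i m x) = ennreal ((dist (X (r j)) (X (r i)))\<^sup>2)" for i j
    using fock_norm_abs[OF abs_fock_diff(1)[OF fc fc]] abs_fock_diff(2)[OF fc fc]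
    by (simp add: dist_norm f_def fock_abs_rep)
  have norm_le: "nn_norm_sq (\<lambda>m x. f j m x - f i m x) \<le> ennreal ((1/4)^i)" if "i \<le> j" for i j
  proof -
    have "dist (X (r j)) (X (r i)) \<le> (1/2)^i"
      using r(2)[of i "r j"] that r(1) by (simp add: strict_mono_less_eq less_imp_le)
    then have "(dist (X (r j)) (X (r i)))\<^sup>2 \<le> ((1/2)^i)\<^sup>2" by (intro power_mono) auto
    also note sq
    finally show ?thesis unfolding norm_diff by (rule ennreal_leI)
  qed
  have conv: "AE x in orthant m. convergent (\<lambda>i. f i m x)" for m
  proof -
    \<comment> \<open>The squared norms of the increments are at most \<open>(1/4)^i\<close>, so the
      weight \<open>2^i\<close> still leaves a convergent series of integrals.\<close>
    let ?d = "\<lambda>i x. f (Suc i) m x - f i m x"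
    have "(\<integral>\<^sup>+x. (\<Sum>i. ennreal (2^i * (norm (?d i x))\<^sup>2)) \<partial>orthant m) =
        (\<Sum>i. ennreal (2^i) * (\<integral>\<^sup>+x. ennreal ((norm (?d i x))\<^sup>2) \<partial>orthant m))"
      by (simp add: nn_integral_suminf ennreal_mult nn_integral_cmult)
    also have "\<dots> \<le> (\<Sum>i. ennreal (2^i) * ennreal ((1/4)^i))"
      by (intro suminf_le summableI mult_left_mono order_trans[OF nn_level_le_nn_norm_sq norm_le]) auto
    also have "\<dots> = (\<Sum>i. ennreal ((1/2)^i))"
      by (simp add: ennreal_mult[symmetric] power_mult_distrib[symmetric])
    also have "\<dots> = ennreal (\<Sum>i. (1/2)^i)"
      by (intro suminf_ennreal2) auto
    finally have "(\<integral>\<^sup>+x. (\<Sum>i. ennreal (2^i * (norm (?d i x))\<^sup>2)) \<partial>orthant m) \<noteq> \<infinity>"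
      by (auto simp: top_unique)
    then have "AE x in orthant m. (\<Sum>i. ennreal (2^i * (norm (?d i x))\<^sup>2)) \<noteq> \<infinity>"
      by (intro nn_integral_PInf_AE) measurable
    then show ?thesis
    proof eventually_elim
      fix x assume fin: "(\<Sum>i. ennreal (2^i * (norm (?d i x))\<^sup>2)) \<noteq> \<infinity>"
      have "summable (\<lambda>i. 2^i * (norm (?d i x))\<^sup>2)"
        using fin by (intro summable_suminf_not_top) auto
      then have s: "summable (\<lambda>i. (1/2)^i + 2^i * (norm (?d i x))\<^sup>2)"
        by (intro summable_add) auto
      \<comment> \<open>The inequality \<open>a \<le> 1 + a\<^sup>2\<close> at
        \<open>a = 2^i * norm (?d i x)\<close> turns summable weighted squares into an absolutely
        convergent telescoping series.\<close>
      have "norm (?d i x) \<le> (1/2)^i + 2^i * (norm (?d i x))\<^sup>2" for i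
      proof -
        have "a \<le> 1 + a\<^sup>2" for a :: real
          using zero_le_power2[of "a - 1"] zero_le_power2[of a]
          by (simp only: power2_diff one_power2)
        then have "(1/2)^i * (2^i * norm (?d i x)) \<le> (1/2)^i * (1 + (2^i * norm (?d i x))\<^sup>2)"
          by (intro mult_left_mono) auto
        also have "(1/2)^i * (2^i * norm (?d i x)) = norm (?d i x)"
          by (simp add: power_one_over)
        also have "(1/2)^i * (1 + (2^i * norm (?d i x))\<^sup>2) = (1/2)^i + 2^i * (norm (?d i x))\<^sup>2"
          by (simp add: power_one_over power2_eq_square distrib_left)
        finally show ?thesis .
      qed
      then have "summable (\<lambda>i. ?d i x)"
        by (intro summable_comparison_test'[OF s]) auto
      then have "convergent (\<lambda>n. \<Sum>i<n. ?d i x)" by (simp add: summable_iff_convergent)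
      then have "convergent (\<lambda>n. (\<Sum>i<n. ?d i x) + f 0 m x)"
        by (rule convergent_add[OF _ convergent_const])
      then show "convergent (\<lambda>i. f i m x)"
        by (simp add: sum_lessThan_telescope[of "\<lambda>i. f i m x"])
    qed
  qed
  \<comment> \<open>\<open>lim\<close> is total, so \<open>g\<close> is measurable everywhere; the
    points where the sequence diverges form only a null set.\<close>
  define g where "g m x = lim (\<lambda>i. f i m x)" for m x
  have [measurable]: "g m \<in> borel_measurable (orthant m)" for m
    unfolding g_def by measurable
  have lim: "AE x in orthant m. (\<lambda>i. f i m x) \<longlonglongrightarrow> g m x" for m
    using conv[of m] by eventually_elim (simp add: g_def convergent_LIMSEQ_iff)
  have g_le: "nn_norm_sq (\<lambda>m x. g m x - f i m x) \<le> ennreal ((1/4)^i)" for i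
  proof -
    have "nn_norm_sq (\<lambda>m x. g m x - f i m x) \<le> liminf (\<lambda>j. nn_norm_sq (\<lambda>m x. f j m x - f i m x))"
    proof (rule nn_norm_sq_Fatou)
      show "AE x in orthant n. (\<lambda>j. f j n x - f i n x) \<longlonglongrightarrow> g n x - f i n x" for n
        using lim[of n] by eventually_elim (intro tendsto_intros)
    qed measurable
    also have "\<dots> \<le> limsup (\<lambda>j. nn_norm_sq (\<lambda>m x. f j m x - f i m x))"
      by (intro Liminf_le_Limsup) simp
    also have "\<dots> \<le> ennreal ((1/4)^i)"
      by (intro Limsup_bounded) (auto intro!: eventually_sequentiallyI[of i] norm_le)
    finally show ?thesis .
  qed
  have dc: "(\<lambda>m x. g m x - f i m x) \<in> fock_carrier" for i
    using order.strict_trans1[OF g_le[of i]] unfolding fock_carrier_iff by auto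
  have gc: "g \<in> fock_carrier"
    using add_in_fock_carrier[OF dc[of 0] fc[of 0]] by simp
  have le: "norm (abs_fock g - X (r i)) \<le> (1/2)^i" for i
  proof -
    have "ennreal ((norm (abs_fock g - X (r i)))\<^sup>2) = nn_norm_sq (\<lambda>m x. g m x - f i m x)"
      using fock_norm_abs[OF dc[of i]] abs_fock_diff(2)[OF gc fc[of i]] by (simp add: f_def fock_abs_rep)
    also have "\<dots> \<le> ennreal (((1/2)^i)\<^sup>2)"
      using g_le[of i] by (simp only: sq)
    finally have "(norm (abs_fock g - X (r i)))\<^sup>2 \<le> ((1/2)^i)\<^sup>2" by (simp add: ennreal_le_iff)
    then show ?thesis by (rule power2_le_imp_le) simp
  qed
  have "(\<lambda>i. X (r i) - abs_fock g) \<longlonglongrightarrow> 0"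
    by (rule Lim_null_comparison[where g = "\<lambda>i. (1/2)^i"])
       (use le in \<open>auto simp: norm_minus_commute intro: LIMSEQ_realpow_zero\<close>)
  then have "(X \<circ> r) \<longlonglongrightarrow> abs_fock g" by (simp add: LIM_zero_iff o_def)
  then show ?thesis using Cauchy_converges_subseq[OF X r(1)] by (auto simp: convergent_def)
qed

section \<open>Complex subspaces, nearest points and orthogonal projections\<close>

lemma fock_scale_of_real: "fock_scale (of_real r) F = r *\<^sub>R F"
  by (simp add: scaleR_fock_def)

lemma bounded_linear_fock_scale: "bounded_linear (fock_scale c)"
  by (rule bounded_linear_intro[where K = "norm c"])
     (simp_all add: fock_scale_add_right scaleR_fock_def fock_scale_scale norm_fock_scale mult.commute)

lemma fock_cinner_diff_right: "fock_cinner F (G - H) = fock_cinner F G - fock_cinner F H"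
  unfolding minus_fock_def uminus_fock_def fock_cinner_add_right fock_cinner_scale_right by simp

lemma fock_cinner_scale_left: "fock_cinner (fock_scale c F) G = cnj c * fock_cinner F G"
  by (metis fock_cinner_scale_right fock_cinner_commute complex_cnj_mult)

lemma fock_cinner_eq_zero: "fock_cinner F F = 0 \<Longrightarrow> F = 0"
  using fock_inner_eq_0[of F] by (simp add: inner_fock_def)

lemma fock_scaleR_in_subspace: "fock_complex.subspace M \<Longrightarrow> F \<in> M \<Longrightarrow> r *\<^sub>R F \<in> M"
  by (metis fock_scale_of_real fock_complex.subspace_scale)

lemma subspace_closure_fock:
  assumes "fock_complex.subspace M"
  shows "fock_complex.subspace (closure M)"
proof (rule fock_complex.subspaceI)
  show "0 \<in> closure M"
    using fock_complex.subspace_0[OF assms] closure_subset by blast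
next
  fix F G assume "F \<in> closure M" "G \<in> closure M"
  then obtain f g where fg: "\<And>n. f n \<in> M" "f \<longlonglongrightarrow> F" "\<And>n. g n \<in> M" "g \<longlonglongrightarrow> G"
    unfolding closure_sequential by blast
  have "(\<lambda>n. f n + g n) \<longlonglongrightarrow> F + G" by (intro tendsto_intros fg)
  then show "F + G \<in> closure M"
    unfolding closure_sequential using fg fock_complex.subspace_add[OF assms]
    by (intro exI[of _ "\<lambda>n. f n + g n"]) auto
next
  fix c F assume "F \<in> closure M"
  then obtain f where f: "\<And>n. f n \<in> M" "f \<longlonglongrightarrow> F"
    unfolding closure_sequential by blast
  have "(\<lambda>n. fock_scale c (f n)) \<longlonglongrightarrow> fock_scale c F"
    by (intro bounded_linear.tendsto[OF bounded_linear_fock_scale] f)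
  then show "fock_scale c F \<in> closure M"
    unfolding closure_sequential using f fock_complex.subspace_scale[OF assms]
    by (intro exI[of _ "\<lambda>n. fock_scale c (f n)"]) auto
qed

text \<open>This is the parallelogram law for \<open>z - x\<close> and \<open>z - y\<close>, whose
  sum is twice the vector from the midpoint to \<open>z\<close>. It makes minimizing sequences
  Cauchy.\<close>

lemma dist_midpoint_sq:
  fixes x y z :: "'a::real_inner"
  shows "4 * (dist z ((1/2) *\<^sub>R (x + y)))\<^sup>2 = 2 * (dist z x)\<^sup>2 + 2 * (dist z y)\<^sup>2 - (dist x y)\<^sup>2"
proof -
  have "(norm (u + v))\<^sup>2 = 2 * (norm u)\<^sup>2 + 2 * (norm v)\<^sup>2 - (norm (v - u))\<^sup>2" for u v :: 'a
    unfolding power2_norm_eq_inner inner_add_left inner_add_right inner_diff_left inner_diff_right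
    by (simp add: inner_commute[of v u])
  from this[of "z - x" "z - y"]
  have "(norm ((z - x) + (z - y)))\<^sup>2 = 2 * (dist z x)\<^sup>2 + 2 * (dist z y)\<^sup>2 - (dist x y)\<^sup>2"
    by (simp add: dist_norm)
  moreover have "(z - x) + (z - y) = 2 *\<^sub>R (z - (1/2) *\<^sub>R (x + y))"
    by (simp add: scaleR_diff_right scaleR_2)
  ultimately show ?thesis
    by (simp only: dist_norm norm_scaleR power_mult_distrib) simp
qed

text \<open>Midpoints of a minimizing sequence stay in \<open>M\<close>, so the parallelogram law
  forces its terms together; completeness of the whole space and closedness of \<open>M\<close> then
  give the minimizer.\<close>

lemma fock_nearest_point:
  assumes M: "closed M" "fock_complex.subspace M"
  obtains G where "G \<in> M" "\<And>H. H \<in> M \<Longrightarrow> dist F G \<le> dist F H"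
proof -
  have ne: "M \<noteq> {}" using fock_complex.subspace_0[OF M(2)] by auto
  let ?d = "infdist F M"
  have "\<exists>G\<in>M. dist F G < ?d + 1 / (real n + 1)" for n
  proof -
    have "(INF G\<in>M. dist F G) < ?d + 1 / (real n + 1)"
      using ne by (simp add: infdist_def)
    then show ?thesis by (subst (asm) cINF_less_iff) (use ne in auto)
  qed
  then obtain g where g: "\<And>n. g n \<in> M" "\<And>n. dist F (g n) < ?d + 1 / (real n + 1)"
    by metis
  have lim: "(\<lambda>n. dist F (g n)) \<longlonglongrightarrow> ?d"
  proof (rule tendsto_sandwich)
    show "\<forall>\<^sub>F n in sequentially. ?d \<le> dist F (g n)" by (simp add: g infdist_le)
    show "\<forall>\<^sub>F n in sequentially. dist F (g n) \<le> ?d + 1 / (real n + 1)"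
      using g(2) by (intro always_eventually allI less_imp_le)
    show "(\<lambda>n. ?d + 1 / (real n + 1)) \<longlonglongrightarrow> ?d"
      using tendsto_add[OF tendsto_const[of ?d] LIMSEQ_inverse_real_of_nat]
      by (simp add: inverse_eq_divide add.commute)
  qed simp
  have par: "(dist (g m) (g n))\<^sup>2 \<le> 2 * ((dist F (g m))\<^sup>2 - ?d\<^sup>2) + 2 * ((dist F (g n))\<^sup>2 - ?d\<^sup>2)" for m n
  proof -
    let ?h = "(1/2) *\<^sub>R (g m + g n)"
    have "?h \<in> M"
      using g fock_complex.subspace_add[OF M(2)] by (auto intro!: fock_scaleR_in_subspace[OF M(2)])
    then have "?d \<le> dist F ?h" by (rule infdist_le)
    then have "4 * ?d\<^sup>2 \<le> 4 * (dist F ?h)\<^sup>2" by (intro mult_left_mono power_mono) (auto simp: infdist_nonneg)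
    also have "\<dots> = 2 * (dist F (g m))\<^sup>2 + 2 * (dist F (g n))\<^sup>2 - (dist (g m) (g n))\<^sup>2"
      by (rule dist_midpoint_sq)
    finally show ?thesis by simp
  qed
  have "Cauchy g"
  proof (rule metric_CauchyI)
    fix e :: real assume e: "e > 0"
    have "(\<lambda>n. 4 * ((dist F (g n))\<^sup>2 - ?d\<^sup>2)) \<longlonglongrightarrow> 4 * (?d\<^sup>2 - ?d\<^sup>2)"
      by (intro tendsto_intros lim)
    then have "\<forall>\<^sub>F n in sequentially. 4 * ((dist F (g n))\<^sup>2 - ?d\<^sup>2) < e\<^sup>2"
      using e by (intro order_tendstoD(2)) auto
    then obtain N where N: "\<And>n. n \<ge> N \<Longrightarrow> 4 * ((dist F (g n))\<^sup>2 - ?d\<^sup>2) < e\<^sup>2"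
      by (auto simp: eventually_sequentially)
    show "\<exists>N. \<forall>m\<ge>N. \<forall>n\<ge>N. dist (g m) (g n) < e"
    proof (intro exI allI impI)
      fix m n assume "N \<le> m" "N \<le> n"
      then have "(dist (g m) (g n))\<^sup>2 < e\<^sup>2" using par[of m n] N[of m] N[of n] by linarith
      then show "dist (g m) (g n) < e" using e by (auto intro: power_less_imp_less_base[of _ 2])
    qed
  qed
  then obtain G where G: "g \<longlonglongrightarrow> G" using fock_Cauchy_convergent by (auto simp: convergent_def)
  have "G \<in> M" using closed_sequentially[OF M(1) _ G] g by auto
  moreover have "dist F G \<le> dist F H" if "H \<in> M" for H
  proof -
    have "dist F G = ?d"
      using LIMSEQ_unique[OF lim tendsto_dist[OF tendsto_const G]] by simp
    then show ?thesis using infdist_le[OF that] by simp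
  qed
  ultimately show ?thesis by (rule that)
qed

text \<open>The nearest point is orthogonal in the real inner product, which sees only real parts.
  Testing against both \<open>H\<close> and \<open>fock_scale \<i> H\<close> recovers complex
  orthogonality.\<close>

lemma fock_projection_exists:
  assumes M: "closed M" "fock_complex.subspace M"
  obtains G where "G \<in> M" "\<And>H. H \<in> M \<Longrightarrow> fock_cinner H (F - G) = 0"
proof -
  obtain G where G: "G \<in> M" "\<And>H. H \<in> M \<Longrightarrow> dist F G \<le> dist F H"
    using fock_nearest_point[OF M] by blast
  have "convex M"
    using M(2) unfolding convex_def
    by (auto intro!: fock_complex.subspace_add fock_scaleR_in_subspace)
  \<comment> \<open>The nearest point of a convex set is characterized by an inequality for inner
    products. The test point \<open>G + H\<close> gives one sign here, and replacing
    \<open>H\<close> by its negative gives the other below.\<close>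
  have le: "inner (F - G) H \<le> 0" if "H \<in> M" for H
    using any_closest_point_dot[OF \<open>convex M\<close> M(1) G(1), of "G + H" F] that G
      fock_complex.subspace_add[OF M(2)] by simp
  have inner0: "inner (F - G) H = 0" if "H \<in> M" for H
    using le[OF that] le[of "(- 1) *\<^sub>R H"] fock_scaleR_in_subspace[OF M(2) that, of "- 1"] by simp
  have "fock_cinner H (F - G) = 0" if "H \<in> M" for H
  proof -
    have "Re (fock_cinner H (F - G)) = 0"
      using inner0[OF that] by (subst (asm) inner_commute) (simp add: inner_fock_def)
    moreover have "Re (fock_cinner (fock_scale \<i> H) (F - G)) = 0"
      using inner0[OF fock_complex.subspace_scale[OF M(2) that, of \<i>]]
      by (subst (asm) inner_commute) (simp add: inner_fock_def)
    ultimately show ?thesis by (simp add: fock_cinner_scale_left complex_eq_iff)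
  qed
  then show ?thesis using G(1) that by blast
qed

text \<open>The \<open>THE\<close> in the definition ranges over bounded operators. Uniqueness of
  the decomposition makes the pointwise choice of projected vectors additive and homogeneous, and
  Pythagoras bounds it by one, so exactly one such operator exists.\<close>

lemma orthogonal_projection:
  assumes M: "closed M" "fock_complex.subspace M"
  shows "blinfun_apply (orthogonal_projection M) F \<in> M"
    and "G \<in> M \<Longrightarrow> fock_cinner G (F - blinfun_apply (orthogonal_projection M) F) = 0"
    and "G \<in> M \<Longrightarrow> (\<And>H. H \<in> M \<Longrightarrow> fock_cinner H (F - G) = 0) \<Longrightarrow>
      blinfun_apply (orthogonal_projection M) F = G"
proof -
  let ?is = "\<lambda>F G. G \<in> M \<and> (\<forall>H\<in>M. fock_cinner H (F - G) = 0)"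
  have unique: "G = G'" if "?is F G" "?is F G'" for F G G'
  proof -
    have "G - G' \<in> M" using that fock_complex.subspace_diff[OF M(2)] by blast
    then have "fock_cinner (G - G') (F - G') = 0" "fock_cinner (G - G') (F - G) = 0"
      using that by blast+
    then have "fock_cinner (G - G') ((F - G') - (F - G)) = 0"
      by (subst fock_cinner_diff_right) simp
    then show ?thesis using fock_cinner_eq_zero[of "G - G'"] by simp
  qed
  have "\<forall>F. \<exists>G. ?is F G" using fock_projection_exists[OF M] by metis
  then obtain p where p: "\<And>F. ?is F (p F)" by metis
  have "bounded_linear p"
  proof (rule bounded_linear_intro[where K = 1])
    show "p (F + G) = p F + p G" for F G
    proof (rule unique[OF p])
      have "(F + G) - (p F + p G) = (F - p F) + (G - p G)" by simp
      then show "?is (F + G) (p F + p G)"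
        using p[of F] p[of G] by (auto simp only: fock_cinner_add_right add_0_left intro: fock_complex.subspace_add[OF M(2)])
    qed
    show "p (r *\<^sub>R F) = r *\<^sub>R p F" for r F
    proof (rule unique[OF p])
      have "r *\<^sub>R F - r *\<^sub>R p F = fock_scale (of_real r) (F - p F)"
        by (simp add: fock_scale_of_real scaleR_diff_right)
      then show "?is (r *\<^sub>R F) (r *\<^sub>R p F)"
        using p[of F] fock_scaleR_in_subspace[OF M(2)] by (simp add: fock_cinner_scale_right)
    qed
    show "norm (p F) \<le> norm F * 1" for F
    proof -
      have "fock_cinner (p F) (F - p F) = 0" using p by blast
      then have "inner (p F) (F - p F) = 0" by (simp add: inner_fock_def)
      then have "(norm (p F))\<^sup>2 + (norm (F - p F))\<^sup>2 = (norm F)\<^sup>2"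
        by (simp add: power2_norm_eq_inner inner_diff_left inner_diff_right inner_commute[of F "p F"])
      then have "(norm (p F))\<^sup>2 \<le> (norm F)\<^sup>2" using zero_le_power2[of "norm (F - p F)"] by linarith
      then have "norm (p F) \<le> norm F" by (rule power2_le_imp_le) simp
      then show ?thesis by simp
    qed
  qed
  then have "\<forall>F. ?is F (blinfun_apply (Blinfun p) F)" by (simp add: bounded_linear_Blinfun_apply p)
  moreover have "P = Blinfun p" if "\<forall>F. ?is F (blinfun_apply P F)" for P
    using that unique p by (intro blinfun_eqI) (metis bounded_linear_Blinfun_apply[OF \<open>bounded_linear p\<close>])
  ultimately have "\<forall>F. ?is F (blinfun_apply (orthogonal_projection M) F)"
    unfolding orthogonal_projection_def by (rule theI)
  then show "blinfun_apply (orthogonal_projection M) F \<in> M"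
    "G \<in> M \<Longrightarrow> fock_cinner G (F - blinfun_apply (orthogonal_projection M) F) = 0"
    "G \<in> M \<Longrightarrow> (\<And>H. H \<in> M \<Longrightarrow> fock_cinner H (F - G) = 0) \<Longrightarrow>
      blinfun_apply (orthogonal_projection M) F = G"
    using unique[of "blinfun_apply (orthogonal_projection M) F" F G] by blast+
qed

text \<open>The residual is orthogonal to \<open>M\<close>, which contains the other summand.
  Dropping one square gives best approximation; taking \<open>G = 0\<close> gives
  contractivity.\<close>

lemma orthogonal_projection_pythagoras:
  assumes M: "closed M" "fock_complex.subspace M" and G: "G \<in> M"
  shows "(norm (F - G))\<^sup>2 = (norm (F - blinfun_apply (orthogonal_projection M) F))\<^sup>2
    + (norm (blinfun_apply (orthogonal_projection M) F - G))\<^sup>2"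
proof -
  let ?p = "blinfun_apply (orthogonal_projection M) F"
  have "?p - G \<in> M"
    using orthogonal_projection(1)[OF M] G by (intro fock_complex.subspace_diff[OF M(2)])
  then have "fock_cinner (?p - G) (F - ?p) = 0" by (rule orthogonal_projection(2)[OF M])
  then have "orthogonal (F - ?p) (?p - G)"
    unfolding orthogonal_def by (subst inner_commute) (simp add: inner_fock_def)
  from norm_add_Pythagorean[OF this] show ?thesis by simp
qed

section \<open>The projection onto the toy space\<close>

lemma closed_toy_fock: "closed (toy_fock t)" by (simp add: toy_fock_def)

lemma subspace_toy_fock: "fock_complex.subspace (toy_fock t)"
  unfolding toy_fock_def by (intro subspace_closure_fock fock_complex.subspace_span)

lemma toy_proj_in: "blinfun_apply (toy_proj t) F \<in> toy_fock t"
  unfolding toy_proj_def by (rule orthogonal_projection(1)[OF closed_toy_fock subspace_toy_fock])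

text \<open>Every vector of the toy space thus bounds the defect of the projection, so convergence
  can be shown with convenient approximants.\<close>

lemma toy_proj_nearest:
  assumes "G \<in> toy_fock t"
  shows "norm (F - blinfun_apply (toy_proj t) F) \<le> norm (F - G)"
  using orthogonal_projection_pythagoras[OF closed_toy_fock subspace_toy_fock assms, of F]
  unfolding toy_proj_def[symmetric]
  by - (rule power2_le_imp_le, simp_all)

lemma toy_proj_contraction: "norm (blinfun_apply (toy_proj t) F) \<le> norm F"
  using orthogonal_projection_pythagoras[OF closed_toy_fock subspace_toy_fock
      fock_complex.subspace_0[OF subspace_toy_fock], of F t]
  unfolding toy_proj_def[symmetric]
  by - (rule power2_le_imp_le, simp_all)

lemma toy_proj_fixes:
  assumes "G \<in> toy_fock t"
  shows "blinfun_apply (toy_proj t) G = G"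
  using toy_proj_nearest[OF assms, of G] by simp

text \<open>The type of bounded operators records real linearity only; complex homogeneity is
  recovered from the uniqueness of the projected vector.\<close>

lemma toy_proj_scale: "blinfun_apply (toy_proj t) (fock_scale c F) = fock_scale c (blinfun_apply (toy_proj t) F)"
  unfolding toy_proj_def
proof (rule orthogonal_projection(3)[OF closed_toy_fock subspace_toy_fock])
  let ?p = "blinfun_apply (orthogonal_projection (toy_fock t)) F"
  note P = orthogonal_projection(1,2)[OF closed_toy_fock subspace_toy_fock]
  show "fock_scale c ?p \<in> toy_fock t"
    by (rule fock_complex.subspace_scale[OF subspace_toy_fock P(1)])
  show "fock_cinner H (fock_scale c F - fock_scale c ?p) = 0" if "H \<in> toy_fock t" for H
    using P(2)[OF that, of F] by (simp add: fock_cinner_scale_right flip: fock_complex.scale_right_diff_distrib)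
qed

section \<open>Totality of iterated creation\<close>

text \<open>The rays \<open>{..<a}\<close> generate the Borel sets of the line, and restricting the
  space takes traces of the generators.\<close>

lemma sets_half_line: "sets half_line = sigma_sets {0..} (range (\<lambda>a. {0..<a}))"
proof -
  have borel: "sets (borel :: real measure) = sigma_sets UNIV (range (\<lambda>a. {..<a}))"
    unfolding borel_eq_lessThan by (simp add: eucl_lessThan)
  have "{0..} \<in> sets (borel :: real measure)" by simp
  then have half: "{0..} \<in> sigma_sets UNIV (range (\<lambda>a::real. {..<a}))"
    by (rule subst[OF borel, of "\<lambda>S. {0..} \<in> S"])
  from borel have "sets half_line = (\<inter>) {0..} ` sigma_sets UNIV (range (\<lambda>a. {..<a}))"
    by (simp add: half_line_def sets_restrict_space)
  also have "(\<inter>) {0..} ` sigma_sets UNIV (range (\<lambda>a::real. {..<a})) = sigma_sets {0..} ((\<inter>) {0..} ` range (\<lambda>a. {..<a}))"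
    by (rule sigma_sets_Int) (simp_all only: half subset_UNIV)
  also have "(\<inter>) {0..} ` range (\<lambda>a. {..<a}) = range (\<lambda>a::real. {0..<a})"
    by (auto simp: image_image intro!: image_cong)
  finally show ?thesis .
qed

lemma space_orthant: "space (orthant n) = (\<Pi>\<^sub>E i\<in>{..<n}. {0..})"
  by (simp add: orthant_def space_PiM space_half_line)

lemma sets_orthant:
  "sets (orthant n) = sigma_sets (space (orthant n)) (range (\<lambda>s. \<Pi>\<^sub>E i\<in>{..<n}. {0..<s i}))"
proof -
  let ?E = "range (\<lambda>a::real. {0..<a})"
  have half: "sets half_line = sets (sigma {0..} ?E)"
    by (subst sets_measure_of) (auto simp: sets_half_line)
  have "sets (orthant n) = sets (\<Pi>\<^sub>M i\<in>{..<n}. sigma {0..} ?E)"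
    unfolding orthant_def by (intro sets_PiM_cong refl half)
  \<comment> \<open>The index set is covered by the single block \<open>{..<n}\<close>, so the
    generators of the product are whole boxes.\<close>
  also have "\<dots> = sets (sigma (\<Pi>\<^sub>E i\<in>{..<n}. {0..})
      {{f\<in>(\<Pi>\<^sub>E i\<in>{..<n}. {0..}). \<forall>i\<in>j. f i \<in> A i} | A j. j \<in> {{..<n}} \<and> A \<in> Pi j (\<lambda>_. ?E)})"
  proof (rule sets_PiM_sigma)
    fix i
    have "{0..} = (\<Union>m. {0..<real m})"
      by (auto dest: less_le_trans intro: reals_Archimedean2)
    then show "\<exists>S\<subseteq>?E. countable S \<and> {0..} = \<Union> S"
      by (intro exI[of _ "range (\<lambda>m. {0..<real m})"]) auto
  qed auto
  also have "{{f\<in>(\<Pi>\<^sub>E i\<in>{..<n}. {0..}). \<forall>i\<in>j. f i \<in> A i} | A j. j \<in> {{..<n}} \<and> A \<in> Pi j (\<lambda>_. ?E)} =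
      range (\<lambda>s. \<Pi>\<^sub>E i\<in>{..<n}. {0..<s i})" (is "?L = ?R")
  proof (intro set_eqI iffI)
    fix B assume "B \<in> ?L"
    then obtain A where B: "B = {f\<in>(\<Pi>\<^sub>E i\<in>{..<n}. {0..}). \<forall>i\<in>{..<n}. f i \<in> A i}"
      and "\<forall>i\<in>{..<n}. \<exists>a. A i = {0..<a}" by blast
    then obtain s where s: "\<And>i. i < n \<Longrightarrow> A i = {0..<s i}" by (metis lessThan_iff)
    have "B = (\<Pi>\<^sub>E i\<in>{..<n}. {0..<s i})"
    proof (intro set_eqI iffI)
      fix x assume x: "x \<in> B"
      then have "x i \<in> A i" if "i < n" for i using that by (auto simp: B)
      then show "x \<in> (\<Pi>\<^sub>E i\<in>{..<n}. {0..<s i})" using x s by (simp add: B PiE_iff)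
    next
      fix x assume "x \<in> (\<Pi>\<^sub>E i\<in>{..<n}. {0..<s i})"
      then show "x \<in> B" using s by (simp add: B PiE_iff)
    qed
    then show "B \<in> ?R" by blast
  next
    fix B assume "B \<in> ?R"
    then obtain s where B: "B = (\<Pi>\<^sub>E i\<in>{..<n}. {0..<s i :: real})" by blast
    have "B = {f\<in>(\<Pi>\<^sub>E i\<in>{..<n}. {0..}). \<forall>i\<in>{..<n}. f i \<in> {0..<s i}}"
      unfolding B by (intro set_eqI) (simp add: PiE_iff, blast)
    moreover have "(\<lambda>i. {0..<s i}) \<in> Pi {..<n} (\<lambda>_. ?E)" by simp
    ultimately show "B \<in> ?L"
      by (intro CollectI exI[of _ "\<lambda>i. {0..<s i}"] exI[of _ "{..<n}"] conjI singletonI)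
  qed
  also have "sets (sigma (\<Pi>\<^sub>E i\<in>{..<n}. {0..}) ?R) = sigma_sets (\<Pi>\<^sub>E i\<in>{..<n}. {0..}) ?R"
    by (intro sets_measure_of image_subsetI PowI PiE_mono) auto
  finally show ?thesis by (simp only: space_orthant)
qed

lemma box_in_sets: "(\<Pi>\<^sub>E i\<in>{..<n}. {0..<s i :: real}) \<in> sets (orthant n)"
  unfolding sets_orthant by (rule sigma_sets.Basic) simp

lemma emeasure_box_finite: "emeasure (orthant n) (\<Pi>\<^sub>E i\<in>{..<n}. {0..<s i :: real}) < \<infinity>"
proof -
  have s: "{0..<a} \<in> sets half_line" for a :: real
    unfolding sets_half_line by (rule sigma_sets.Basic) simp
  have "emeasure half_line {0..<a} < \<infinity>" for a
    unfolding half_line_def by (subst emeasure_restrict_space) (auto simp: emeasure_bounded_finite[unfolded infinity_ennreal_def])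
  then have "(\<Prod>i<n. emeasure half_line {0..<s i}) < \<infinity>"
    by (induction n) (simp_all add: ennreal_mult_less_top)
  then show ?thesis
    unfolding orthant_def using s by (subst half_line_power.emeasure_PiM) auto
qed

lemma cnj_indicator: "cnj (indicator A x) = indicator A x"
  by (simp split: split_indicator)

lemma square_integrable_indicator:
  "A \<in> sets M \<Longrightarrow> emeasure M A < \<infinity> \<Longrightarrow> square_integrable M (\<lambda>x. indicator A x :: complex)"
proof -
  assume A: "A \<in> sets M" "emeasure M A < \<infinity>"
  have "(\<lambda>x. (norm (indicator A x :: complex))\<^sup>2) = (indicator A :: _ \<Rightarrow> real)"
    by (auto simp: fun_eq_iff split: split_indicator)
  then show ?thesis using A by (simp add: square_integrable_def)
qed

text \<open>Cutting \<open>f\<close> off to a cube makes it integrable, and a pi-lambda argument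
  spreads the hypothesis from boxes to all measurable sets; the cubes exhaust the orthant.\<close>

lemma AE_zero_if_box_integrals_zero:
  fixes f :: "(nat \<Rightarrow> real) \<Rightarrow> complex"
  assumes f: "square_integrable (orthant n) f"
    and zero: "\<And>s. (\<integral>x. indicator (\<Pi>\<^sub>E i\<in>{..<n}. {0..<s i}) x * f x \<partial>orthant n) = 0"
  shows "AE x in orthant n. f x = 0"
proof -
  let ?M = "orthant n" and ?Q = "\<lambda>s. (\<Pi>\<^sub>E i\<in>{..<n}. {0..<s i :: real})"
  have int: "integrable ?M (\<lambda>x. indicator (?Q s) x * f x)" for s
    using integrable_cnj_mult[OF square_integrable_indicator[OF box_in_sets emeasure_box_finite, of n s] f]
    by (simp add: cnj_indicator)
  have "AE x in ?M. indicator (?Q (\<lambda>_. real N)) x * f x = 0" for N :: nat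
  proof (rule sigma_finite_measure.density_zero[OF sigma_finite_orthant int])
    let ?g = "\<lambda>x. indicator (?Q (\<lambda>_. real N)) x * f x"
    note g = int[of "\<lambda>_. real N"]
    have si: "set_integrable ?M A ?g" if "A \<in> sets ?M" for A
      unfolding set_integrable_def using that by (intro integrable_mult_indicator g)
    have inter: "?Q s \<inter> ?Q s' = ?Q (\<lambda>i. min (s i) (s' i))" for s s'
      by (simp add: PiE_Int)
    have stable: "Int_stable (range ?Q)"
    proof (rule Int_stableI_image)
      show "\<exists>k\<in>UNIV. ?Q s \<inter> ?Q s' = ?Q k" for s s'
        by (rule bexI[of _ "\<lambda>i. min (s i) (s' i)"]) (simp_all only: inter UNIV_I)
    qed
    have closed: "range ?Q \<subseteq> Pow (space ?M)"
      by (intro image_subsetI PowI sets.sets_into_space box_in_sets)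
    fix A assume "A \<in> sets ?M"
    then have "A \<in> sigma_sets (space ?M) (range ?Q)" by (simp add: sets_orthant)
    then show "(LINT x:A|?M. ?g x) = 0"
    proof (induction rule: sigma_sets_induct_disjoint[OF stable closed, consumes 1, case_names basic empty compl union])
      case (basic A)
      then obtain s where A: "A = ?Q s" by blast
      \<comment> \<open>Intersecting the box with the cutoff cube gives another box, so
        \<open>zero\<close> applies.\<close>
      have "(\<lambda>x. indicator A x *\<^sub>R ?g x) = (\<lambda>x. indicator (?Q (\<lambda>i. min (s i) (real N))) x * f x)"
        unfolding A inter[symmetric] by (simp add: fun_eq_iff split: split_indicator)
      then show ?case
        unfolding set_lebesgue_integral_def using zero by simp
    next
      case empty
      show ?case by (simp add: set_lebesgue_integral_def)
    next
      case (compl A)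
      then have A: "A \<in> sets ?M" by (simp add: sets_orthant)
      have sp: "(LINT x:space ?M|?M. ?g x) = 0"
        using zero by (simp add: set_integral_space g)
      have "(LINT x:space ?M - A|?M. ?g x) + (LINT x:A|?M. ?g x) = (LINT x:(space ?M - A) \<union> A|?M. ?g x)"
        using A by (intro set_integral_Un[symmetric] si) auto
      also have "(space ?M - A) \<union> A = space ?M" using sets.sets_into_space[OF A] by blast
      finally show ?case using compl sp by simp
    next
      case (union A)
      then have A: "\<And>i. A i \<in> sets ?M" by (auto simp: sets_orthant)
      have "(LINT x:(\<Union>i. A i)|?M. ?g x) = (\<Sum>i. LINT x:A i|?M. ?g x)"
        using A union(1) by (intro lebesgue_integral_countable_add si) (auto simp: disjoint_family_on_def)
      then show ?case using union by simp
    qed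
  qed
  then have "AE x in ?M. \<forall>N::nat. indicator (?Q (\<lambda>_. real N)) x * f x = 0"
    unfolding AE_all_countable by blast
  then show ?thesis
  proof (rule AE_mp, intro AE_I2 impI)
    fix x assume x: "x \<in> space ?M" and z: "\<forall>N::nat. indicator (?Q (\<lambda>_. real N)) x * f x = 0"
    \<comment> \<open>The sum of the absolute coordinates bounds each of them, so one cube contains
      \<open>x\<close>.\<close>
    obtain N where N: "(\<Sum>i<n. \<bar>x i\<bar>) < real N" using reals_Archimedean2 by blast
    have "x i < real N" if "i < n" for i
    proof -
      have "\<bar>x i\<bar> \<le> (\<Sum>i<n. \<bar>x i\<bar>)" using that by (intro member_le_sum) auto
      then show ?thesis using N by linarith
    qed
    then have "x \<in> ?Q (\<lambda>_. real N)" using x by (auto simp: space_orthant PiE_iff)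
    then show "f x = 0" using z[rule_format, of N] by simp
  qed
qed

text \<open>Arbitrary factors put tensors of indicators and toy words into one family; the empty
  list gives the vacuum.\<close>

definition tensor_rep :: "(real \<Rightarrow> real) list \<Rightarrow> nat \<Rightarrow> (nat \<Rightarrow> real) \<Rightarrow> complex"
  where "tensor_rep hs n x = (if n = length hs then \<Prod>j<n. of_real ((hs ! j) (x j)) else 0)"

text \<open>Creation fills the first coordinate and shifts the others, so prepending a factor is
  creation for representatives at every point, not only almost everywhere.\<close>

lemma tensor_rep_Cons: "tensor_rep (h # hs) = creation_rep h (tensor_rep hs)"
  by (auto simp: fun_eq_iff tensor_rep_def creation_rep_def prod.lessThan_Suc_shift
      simp del: prod.lessThan_Suc split: nat.split)

lemma tensor_rep_Nil_carrier: "tensor_rep [] \<in> fock_carrier"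
proof -
  \<comment> \<open>The representative of the empty word ignores the sequence of points, so any
    sequence serves here.\<close>
  have "toy_word_rep (\<lambda>_. 0) [] = tensor_rep []"
    by (simp add: fun_eq_iff toy_word_rep_def tensor_rep_def)
  then show ?thesis using toy_word_rep_in_fock_carrier[of "\<lambda>_. 0" "[]"] by simp
qed

lemma tensor_rep_carrier:
  "(\<And>h. h \<in> set hs \<Longrightarrow> square_integrable half_line h) \<Longrightarrow> tensor_rep hs \<in> fock_carrier"
  by (induction hs) (simp_all add: tensor_rep_Nil_carrier tensor_rep_Cons creation_lift(2))

lemma tensor_Cons:
  assumes "\<And>h'. h' \<in> set (h # hs) \<Longrightarrow> square_integrable half_line h'"
  shows "abs_fock (tensor_rep (h # hs)) = blinfun_apply (creation h) (abs_fock (tensor_rep hs))"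
  using assms by (simp add: tensor_rep_Cons creation_lift(3) tensor_rep_carrier)

abbreviation vacuum :: fock where "vacuum \<equiv> abs_fock (tensor_rep [])"

lemma toy_word_Nil: "toy_word t [] = vacuum"
proof -
  have "toy_word_rep t [] = tensor_rep []"
    by (simp add: fun_eq_iff toy_word_rep_def tensor_rep_def)
  then show ?thesis by (simp add: toy_word_def)
qed

lemma toy_word_Cons: "toy_word t (i # \<sigma>) = blinfun_apply (creation (toy_step t i)) (toy_word t \<sigma>)"
proof -
  have "toy_word_rep t \<sigma> = tensor_rep (map (toy_step t) \<sigma>)" for \<sigma>
    by (auto simp: fun_eq_iff toy_word_rep_def tensor_rep_def)
  then show ?thesis
    unfolding toy_word_def by (simp only: list.map) (rule tensor_Cons, auto simp: square_integrable_toy_step)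
qed

lemma integrable_indicator_half_line:
  "square_integrable half_line (indicator {a..<b} :: real \<Rightarrow> real)"
  "integrable half_line (indicator {a..<b} :: real \<Rightarrow> real)"
  "0 \<le> a \<Longrightarrow> a \<le> b \<Longrightarrow> (\<integral>x. indicator {a..<b} x \<partial>half_line) = (b - a :: real)"
  "0 \<le> a \<Longrightarrow> a \<le> b \<Longrightarrow> l2_norm_sq (indicator {a..<b}) = b - a"
proof -
  \<comment> \<open>Restricting to the half line cuts the interval at zero, hence the premise
    \<open>0 \<le> a\<close> in the two claims about its length.\<close>
  have ind: "indicator {0..} x *\<^sub>R (indicator {a..<b} x :: real) = indicator {max 0 a..<b} x" for x :: real
    by (auto split: split_indicator)
  have sq: "(indicator A x :: real)\<^sup>2 = indicator A x" for A and x :: real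
    by (simp split: split_indicator)
  show int: "integrable half_line (indicator {a..<b} :: real \<Rightarrow> real)"
    unfolding half_line_def
    by (subst integrable_restrict_space) (auto simp: ind emeasure_bounded_finite[unfolded infinity_ennreal_def] simp del: real_scaleR_def)
  then show "square_integrable half_line (indicator {a..<b} :: real \<Rightarrow> real)"
    by (auto simp: square_integrable_def sq)
  show "(\<integral>x. indicator {a..<b} x \<partial>half_line) = (b - a :: real)" if "0 \<le> a" "a \<le> b"
    unfolding half_line_def using that
    by (subst integral_restrict_space) (auto simp: ind simp del: real_scaleR_def)
  then show "l2_norm_sq (indicator {a..<b}) = b - a" if "0 \<le> a" "a \<le> b"
    using that by (simp add: l2_norm_sq_def sq)
qed

lemma fock_cinner_abs:
  "f \<in> fock_carrier \<Longrightarrow> g \<in> fock_carrier \<Longrightarrow>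
    fock_cinner (abs_fock f) (abs_fock g) = (\<Sum>n. \<integral>x. cnj (f n x) * g n x \<partial>orthant n)"
  by (simp add: fock_cinner.abs_eq fock_rel_self)

text \<open>A tensor of \<open>n\<close> indicators lives on level \<open>n\<close>, where its inner
  product with \<open>F - G\<close> is a box integral. All of these vanish, so \<open>F\<close>
  agrees with its projection \<open>G\<close>.\<close>

lemma fock_eq_UNIV_if_creation_invariant:
  assumes V: "closed V" "fock_complex.subspace V"
    and vac: "vacuum \<in> V"
    and inv: "\<And>F s. 0 \<le> s \<Longrightarrow> F \<in> V \<Longrightarrow> blinfun_apply (creation (indicator {0..<s})) F \<in> V"
  shows "F \<in> V"
proof -
  obtain G where G: "G \<in> V" "\<And>H. H \<in> V \<Longrightarrow> fock_cinner H (F - G) = 0"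
    using fock_projection_exists[OF V] by blast
  obtain d where d: "d \<in> fock_carrier" "F - G = abs_fock d" by (rule fock_abs_cases)
  let ?t = "\<lambda>ss. tensor_rep (map (\<lambda>s. indicator {0..<s}) ss)"
  have tc: "?t ss \<in> fock_carrier" for ss
    by (rule tensor_rep_carrier) (auto simp: integrable_indicator_half_line)
  have t_in: "abs_fock (?t ss) \<in> V" for ss
  proof (induction ss)
    case (Cons s ss)
    \<comment> \<open>A negative endpoint gives the empty interval, as does endpoint zero, which
      \<open>inv\<close> covers.\<close>
    have "indicator {0..<s} = (indicator {0..<max 0 s} :: real \<Rightarrow> real)"
      by (auto simp: fun_eq_iff indicator_def)
    then have "blinfun_apply (creation (indicator {0..<s})) (abs_fock (?t ss)) \<in> V"
      using inv[OF _ Cons, of "max 0 s"] by simp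
    then show ?case
      unfolding list.map by (subst tensor_Cons) (auto simp: integrable_indicator_half_line)
  qed (use vac in simp)
  have "AE x in orthant n. d n x = 0" for n
  proof (rule AE_zero_if_box_integrals_zero)
    show "square_integrable (orthant n) (d n)" using d by (simp add: fock_carrier_def)
    fix s :: "nat \<Rightarrow> real"
    let ?ss = "map s [0..<n]"
    have "0 = fock_cinner (abs_fock (?t ?ss)) (F - G)"
      by (rule G(2)[OF t_in, symmetric])
    also have "\<dots> = (\<Sum>m. \<integral>x. cnj (?t ?ss m x) * d m x \<partial>orthant m)"
      unfolding d(2) by (rule fock_cinner_abs[OF tc d(1)])
    \<comment> \<open>Only level \<open>n\<close> contributes, because the tensor vanishes on the
      others.\<close>
    also have "\<dots> = (\<integral>x. cnj (?t ?ss n x) * d n x \<partial>orthant n)"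
      by (subst suminf_finite[of "{n}"]) (auto simp: tensor_rep_def)
    also have "\<dots> = (\<integral>x. indicator (\<Pi>\<^sub>E i\<in>{..<n}. {0..<s i}) x * d n x \<partial>orthant n)"
    proof (intro Bochner_Integration.integral_cong refl)
      fix x assume "x \<in> space (orthant n)"
      then have "cnj (?t ?ss n x) = indicator (\<Pi>\<^sub>E i\<in>{..<n}. {0..<s i}) x"
        by (auto simp: tensor_rep_def space_orthant PiE_iff indicator_def prod_zero_iff)
      then show "cnj (?t ?ss n x) * d n x = indicator (\<Pi>\<^sub>E i\<in>{..<n}. {0..<s i}) x * d n x"
        by simp
    qed
    finally show "(\<integral>x. indicator (\<Pi>\<^sub>E i\<in>{..<n}. {0..<s i}) x * d n x \<partial>orthant n) = 0" by simp
  qed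
  then have "fock_rel d (\<lambda>n x. 0)"
    using d zero_in_fock_carrier by (simp add: fock_rel_def)
  then have "F - G = 0"
    unfolding d(2) zero_fock_def by (rule fock_abs_eq)
  then show ?thesis using G(1) by simp
qed

section \<open>Linearity and norms of the operators\<close>

lemma square_integrable_lincomb:
  fixes h k :: "'a \<Rightarrow> real"
  assumes "square_integrable M h" "square_integrable M k"
  shows "square_integrable M (\<lambda>x. a * h x + b * k x)"
proof -
  have m[measurable]: "h \<in> borel_measurable M" "k \<in> borel_measurable M"
    using assms by (auto simp: square_integrable_def)
  have "integrable M (\<lambda>x. (norm (a * h x + b * k x))\<^sup>2)"
  proof (rule Bochner_Integration.integrable_bound)
    show "integrable M (\<lambda>x. 2 * (a\<^sup>2 * (norm (h x))\<^sup>2) + 2 * (b\<^sup>2 * (norm (k x))\<^sup>2))"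
      using assms by (intro Bochner_Integration.integrable_add integrable_mult_right)
        (auto simp: square_integrable_def)
    show "AE x in M. norm ((norm (a * h x + b * k x))\<^sup>2) \<le>
        norm (2 * (a\<^sup>2 * (norm (h x))\<^sup>2) + 2 * (b\<^sup>2 * (norm (k x))\<^sup>2))"
    proof (rule AE_I2)
      fix x
      show "norm ((norm (a * h x + b * k x))\<^sup>2) \<le>
        norm (2 * (a\<^sup>2 * (norm (h x))\<^sup>2) + 2 * (b\<^sup>2 * (norm (k x))\<^sup>2))"
        using norm_add_sq_le[of "a * h x" "b * k x"] by (simp add: power_mult_distrib)
    qed
  qed measurable
  then show ?thesis by (simp add: square_integrable_def)
qed

lemma abs_fock_lincomb:
  assumes f: "f \<in> fock_carrier" and g: "g \<in> fock_carrier"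
  shows "(\<lambda>n x. of_real a * f n x + of_real b * g n x) \<in> fock_carrier"
    and "a *\<^sub>R abs_fock f + b *\<^sub>R abs_fock g = abs_fock (\<lambda>n x. of_real a * f n x + of_real b * g n x)"
proof -
  note c = scale_in_fock_carrier[OF f, of "of_real a"] scale_in_fock_carrier[OF g, of "of_real b"]
  show "(\<lambda>n x. of_real a * f n x + of_real b * g n x) \<in> fock_carrier"
    by (rule add_in_fock_carrier[OF c])
  show "a *\<^sub>R abs_fock f + b *\<^sub>R abs_fock g = abs_fock (\<lambda>n x. of_real a * f n x + of_real b * g n x)"
    using f g c unfolding scaleR_fock_def by (simp only: fock_scale.abs_eq plus_fock.abs_eq fock_rel_self)
qed

lemma norm_abs_fock_le:
  assumes "f \<in> fock_carrier" "g \<in> fock_carrier" "0 \<le> K" "nn_norm_sq g \<le> ennreal K * nn_norm_sq f"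
  shows "norm (abs_fock g) \<le> sqrt K * norm (abs_fock f)"
proof -
  have "ennreal ((norm (abs_fock g))\<^sup>2) \<le> ennreal (K * (norm (abs_fock f))\<^sup>2)"
    using assms by (simp add: fock_norm_abs ennreal_mult)
  then have "(norm (abs_fock g))\<^sup>2 \<le> K * (norm (abs_fock f))\<^sup>2"
    using assms by (simp add: ennreal_le_iff)
  then have "sqrt ((norm (abs_fock g))\<^sup>2) \<le> sqrt (K * (norm (abs_fock f))\<^sup>2)" by (rule real_sqrt_le_mono)
  then show ?thesis by (simp add: real_sqrt_mult)
qed

lemma l2_norm_sq_nonneg: "0 \<le> l2_norm_sq h"
  by (simp add: l2_norm_sq_def)

section \<open>Norm bounds and linearity in the test function or symbol\<close>

lemma creation_apply:
  assumes "square_integrable half_line h" "f \<in> fock_carrier"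
  shows "creation_rep h f \<in> fock_carrier"
    and "blinfun_apply (creation h) (abs_fock f) = abs_fock (creation_rep h f)"
  using assms by (auto intro: creation_lift(2) creation_lift(3))

lemma annihilation_apply:
  assumes "square_integrable half_line h" "f \<in> fock_carrier"
  shows "annihilation_rep h f \<in> fock_carrier"
    and "blinfun_apply (annihilation h) (abs_fock f) = abs_fock (annihilation_rep h f)"
  using assms by (auto intro: annihilation_lift(2) annihilation_lift(3))

lemma creation_scale:
  assumes "square_integrable half_line h"
  shows "blinfun_apply (creation h) (fock_scale c F) = fock_scale c (blinfun_apply (creation h) F)"
  using assms by (auto intro: creation_lift(4))

text \<open>The lifting lemma asserts boundedness without exposing a constant; the later limits rest
  on this explicit one.\<close>

lemma creation_norm:
  assumes "square_integrable half_line h"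
  shows "norm (blinfun_apply (creation h) F) \<le> sqrt (l2_norm_sq h) * norm F"
proof -
  obtain f where f: "f \<in> fock_carrier" "F = abs_fock f" by (rule fock_abs_cases)
  then show ?thesis
    using assms by (auto simp: creation_apply(2) intro!: norm_abs_fock_le creation_apply(1) creation_aux(2) l2_norm_sq_nonneg)
qed

lemma annihilation_norm:
  assumes "square_integrable half_line h"
  shows "norm (blinfun_apply (annihilation h) F) \<le> sqrt (l2_norm_sq h) * norm F"
proof -
  obtain f where f: "f \<in> fock_carrier" "F = abs_fock f" by (rule fock_abs_cases)
  then show ?thesis
    using assms by (auto simp: annihilation_apply(2) intro!: norm_abs_fock_le annihilation_apply(1) annihilation_aux(2) l2_norm_sq_nonneg)
qed

lemma creation_lincomb:
  assumes h: "square_integrable half_line h" and k: "square_integrable half_line k"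
  shows "blinfun_apply (creation (\<lambda>x. a * h x + b * k x)) F =
    a *\<^sub>R blinfun_apply (creation h) F + b *\<^sub>R blinfun_apply (creation k) F"
proof -
  obtain f where f: "f \<in> fock_carrier" "F = abs_fock f" by (rule fock_abs_cases)
  have "creation_rep (\<lambda>x. a * h x + b * k x) f =
      (\<lambda>n x. of_real a * creation_rep h f n x + of_real b * creation_rep k f n x)"
    by (auto simp: fun_eq_iff creation_rep_def algebra_simps split: nat.split)
  then show ?thesis
    unfolding f(2) creation_apply(2)[OF h f(1)] creation_apply(2)[OF k f(1)]
      creation_apply(2)[OF square_integrable_lincomb[OF h k] f(1)]
    by (simp add: abs_fock_lincomb(2) creation_apply(1)[OF h f(1)] creation_apply(1)[OF k f(1)])
qed

text \<open>By Tonelli's theorem almost every fibre of \<open>f (Suc n)\<close> is square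
  integrable, and its product with \<open>h\<close> is then integrable.\<close>

lemma annihilation_integrable:
  assumes h: "square_integrable half_line h" and f: "f \<in> fock_carrier"
  shows "AE x in orthant n. integrable half_line (\<lambda>y. of_real (h y) * f (Suc n) (case_nat y x))"
proof -
  have fm[measurable]: "f (Suc n) \<in> borel_measurable (orthant (Suc n))"
    using f by (simp add: fock_carrier_iff)
  note m[measurable] = measurable_cons_orthant_swap[OF fm]
  have "(\<integral>\<^sup>+x. \<integral>\<^sup>+y. ennreal ((norm (f (Suc n) (case_nat y x)))\<^sup>2) \<partial>half_line \<partial>orthant n) \<le> nn_norm_sq f"
    using nn_level_le_nn_norm_sq[where f = f and n = "Suc n"] by (subst nn_integral_orthant_Suc(2)[symmetric]) auto
  also have "\<dots> < \<infinity>" using f by (simp add: fock_carrier_iff)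
  finally have fin: "(\<integral>\<^sup>+x. \<integral>\<^sup>+y. ennreal ((norm (f (Suc n) (case_nat y x)))\<^sup>2) \<partial>half_line \<partial>orthant n) \<noteq> \<infinity>"
    by simp
  have "(\<lambda>q. ennreal ((norm (f (Suc n) (case_nat (snd q) (fst q))))\<^sup>2))
      \<in> borel_measurable (orthant n \<Otimes>\<^sub>M half_line)" by measurable
  with fin have "AE x in orthant n. (\<integral>\<^sup>+y. ennreal ((norm (f (Suc n) (case_nat y x)))\<^sup>2) \<partial>half_line) \<noteq> \<infinity>"
    by (intro nn_integral_PInf_AE half_line.borel_measurable_nn_integral) (simp_all add: case_prod_beta')
  then show ?thesis
  proof (rule AE_mp, intro AE_I2 impI)
    fix x assume x: "x \<in> space (orthant n)"
      and z: "(\<integral>\<^sup>+y. ennreal ((norm (f (Suc n) (case_nat y x)))\<^sup>2) \<partial>half_line) \<noteq> \<infinity>"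
    have [measurable]: "(\<lambda>y. f (Suc n) (case_nat y x)) \<in> borel_measurable half_line"
      using measurable_compose[OF measurable_Pair1'[OF x] m] by simp
    have "integrable half_line (\<lambda>y. (norm (f (Suc n) (case_nat y x)))\<^sup>2)"
      using z by (intro integrableI_nonneg) (auto simp: less_top)
    then have "square_integrable half_line (\<lambda>y. f (Suc n) (case_nat y x))"
      by (simp add: square_integrable_def)
    moreover have "square_integrable half_line (\<lambda>y. complex_of_real (h y))"
      using h by (auto simp: square_integrable_def intro: borel_measurable_of_real)
    ultimately show "integrable half_line (\<lambda>y. of_real (h y) * f (Suc n) (case_nat y x))"
      using integrable_cnj_mult[of half_line "\<lambda>y. complex_of_real (h y)"] by simp
  qed
qed

text \<open>The defining integral is split where both integrands are integrable, so the
  representatives are shown equal almost everywhere, which is equality in the quotient.\<close>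

lemma annihilation_lincomb:
  assumes h: "square_integrable half_line h" and k: "square_integrable half_line k"
  shows "blinfun_apply (annihilation (\<lambda>x. a * h x + b * k x)) F =
    a *\<^sub>R blinfun_apply (annihilation h) F + b *\<^sub>R blinfun_apply (annihilation k) F"
proof -
  obtain f where f: "f \<in> fock_carrier" "F = abs_fock f" by (rule fock_abs_cases)
  note hk = square_integrable_lincomb[OF h k, of a b]
  note c = annihilation_apply(1)[OF h f(1)] annihilation_apply(1)[OF k f(1)]
  have "AE x in orthant n. annihilation_rep (\<lambda>x. a * h x + b * k x) f n x =
      of_real a * annihilation_rep h f n x + of_real b * annihilation_rep k f n x" for n
    using annihilation_integrable[OF h f(1), of n] annihilation_integrable[OF k f(1), of n]
  proof eventually_elim
    fix x assume i: "integrable half_line (\<lambda>y. complex_of_real (h y) * f (Suc n) (case_nat y x))"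
      "integrable half_line (\<lambda>y. complex_of_real (k y) * f (Suc n) (case_nat y x))"
    have "annihilation_rep (\<lambda>x. a * h x + b * k x) f n x =
      (\<integral>y. of_real a * (of_real (h y) * f (Suc n) (case_nat y x)) +
        of_real b * (of_real (k y) * f (Suc n) (case_nat y x)) \<partial>half_line)"
      unfolding annihilation_rep_def
      by (intro Bochner_Integration.integral_cong refl) (simp add: algebra_simps)
    also have "\<dots> = of_real a * annihilation_rep h f n x + of_real b * annihilation_rep k f n x"
      unfolding annihilation_rep_def using i
      by (subst Bochner_Integration.integral_add) simp_all
    finally show "annihilation_rep (\<lambda>x. a * h x + b * k x) f n x =
      of_real a * annihilation_rep h f n x + of_real b * annihilation_rep k f n x" .
  qed
  then have "fock_rel (annihilation_rep (\<lambda>x. a * h x + b * k x) f)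
      (\<lambda>n x. of_real a * annihilation_rep h f n x + of_real b * annihilation_rep k f n x)"
    using annihilation_apply(1)[OF hk f(1)] abs_fock_lincomb(1)[OF c] by (simp add: fock_rel_def)
  then show ?thesis
    unfolding f(2) annihilation_apply(2)[OF h f(1)] annihilation_apply(2)[OF k f(1)]
      annihilation_apply(2)[OF hk f(1)] abs_fock_lincomb(2)[OF c] by (rule fock_abs_eq)
qed

text \<open>These symbols give bounded conservation operators. Being closed under real combinations,
  the predicate can serve as the domain \<open>C\<close> in \<open>lincomb_sum\<close>.\<close>

definition bounded_symbol :: "(real \<Rightarrow> complex) \<Rightarrow> bool"
  where "bounded_symbol b \<longleftrightarrow> b \<in> borel_measurable half_line \<and> (\<exists>B. AE x in half_line. norm (b x) \<le> B)"

lemma bounded_symbol_lincomb: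
  assumes "bounded_symbol b" "bounded_symbol c"
  shows "bounded_symbol (\<lambda>x. r *\<^sub>R b x + s *\<^sub>R c x)"
proof -
  obtain B C where B: "AE x in half_line. norm (b x) \<le> B" and C: "AE x in half_line. norm (c x) \<le> C"
    using assms by (auto simp: bounded_symbol_def)
  have "AE x in half_line. norm (r *\<^sub>R b x + s *\<^sub>R c x) \<le> \<bar>r\<bar> * B + \<bar>s\<bar> * C"
    using B C
  proof eventually_elim
    fix x assume "norm (b x) \<le> B" "norm (c x) \<le> C"
    then have "\<bar>r\<bar> * norm (b x) + \<bar>s\<bar> * norm (c x) \<le> \<bar>r\<bar> * B + \<bar>s\<bar> * C"
      by (intro add_mono mult_left_mono) auto
    then show "norm (r *\<^sub>R b x + s *\<^sub>R c x) \<le> \<bar>r\<bar> * B + \<bar>s\<bar> * C"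
      using norm_triangle_ineq[of "r *\<^sub>R b x" "s *\<^sub>R c x"] by simp
  qed
  then show ?thesis using assms by (auto simp: bounded_symbol_def)
qed

lemma bounded_symbol_indicator: "bounded_symbol (indicator {a..<b})"
proof -
  have "(indicator {a..<b} :: real \<Rightarrow> complex) \<in> borel_measurable half_line"
    unfolding half_line_def by (intro measurable_restrict_space1) simp
  moreover have "AE x in half_line. norm (indicator {a..<b} x :: complex) \<le> 1"
    by (intro AE_I2) (simp split: split_indicator)
  ultimately show ?thesis unfolding bounded_symbol_def by blast
qed

lemma conservation_apply:
  assumes "bounded_symbol b" "f \<in> fock_carrier"
  shows "conservation_rep b f \<in> fock_carrier"
    and "blinfun_apply (conservation b) (abs_fock f) = abs_fock (conservation_rep b f)"
  using assms unfolding bounded_symbol_def by (auto intro: conservation_lift(2) conservation_lift(3))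

lemma conservation_scale:
  assumes "bounded_symbol b"
  shows "blinfun_apply (conservation b) (fock_scale c F) = fock_scale c (blinfun_apply (conservation b) F)"
  using assms unfolding bounded_symbol_def by (auto intro: conservation_lift(4))

lemma conservation_lincomb:
  assumes b: "bounded_symbol b" and c: "bounded_symbol c"
  shows "blinfun_apply (conservation (\<lambda>x. r *\<^sub>R b x + s *\<^sub>R c x)) F =
    r *\<^sub>R blinfun_apply (conservation b) F + s *\<^sub>R blinfun_apply (conservation c) F"
proof -
  obtain f where f: "f \<in> fock_carrier" "F = abs_fock f" by (rule fock_abs_cases)
  have "conservation_rep (\<lambda>x. r *\<^sub>R b x + s *\<^sub>R c x) f =
      (\<lambda>n x. of_real r * conservation_rep b f n x + of_real s * conservation_rep c f n x)"
    by (auto simp: fun_eq_iff conservation_rep_def scaleR_conv_of_real algebra_simps split: nat.split)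
  then show ?thesis
    unfolding f(2) conservation_apply(2)[OF b f(1)] conservation_apply(2)[OF c f(1)]
      conservation_apply(2)[OF bounded_symbol_lincomb[OF b c] f(1)]
    by (simp add: abs_fock_lincomb(2) conservation_apply(1)[OF b f(1)] conservation_apply(1)[OF c f(1)])
qed

lemma conservation_indicator_norm: "norm (blinfun_apply (conservation (indicator {a..<b})) F) \<le> norm F"
proof -
  obtain f where f: "f \<in> fock_carrier" "F = abs_fock f" by (rule fock_abs_cases)
  have "nn_norm_sq (conservation_rep (indicator {a..<b}) f) \<le> ennreal (1\<^sup>2) * nn_norm_sq f"
    using bounded_symbol_indicator[of a b] f(1)
    by (intro conservation_aux(2)) (auto simp: bounded_symbol_def split: split_indicator)
  then have "norm (abs_fock (conservation_rep (indicator {a..<b}) f)) \<le> sqrt (1\<^sup>2) * norm (abs_fock f)"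
    by (intro norm_abs_fock_le f conservation_apply bounded_symbol_indicator) auto
  then show ?thesis by (simp add: f(2) conservation_apply(2)[OF bounded_symbol_indicator f(1)])
qed

text \<open>Induction from two terms to finite sums, for a map that is linear on the class
  \<open>C\<close> only: square integrable test functions or bounded symbols.\<close>

lemma lincomb_sum:
  fixes A :: "('a \<Rightarrow> 'b::real_vector) \<Rightarrow> 'c::real_vector"
  assumes "finite I" and lin: "\<And>a b h k. C h \<Longrightarrow> C k \<Longrightarrow> A (\<lambda>x. a *\<^sub>R h x + b *\<^sub>R k x) = a *\<^sub>R A h + b *\<^sub>R A k"
    and closed: "\<And>a b h k. C h \<Longrightarrow> C k \<Longrightarrow> C (\<lambda>x. a *\<^sub>R h x + b *\<^sub>R k x)"
    and C: "\<And>i. C (h i)"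
  shows "A (\<lambda>x. \<Sum>i\<in>I. c i *\<^sub>R h i x) = (\<Sum>i\<in>I. c i *\<^sub>R A (h i))"
proof -
  have "A (\<lambda>x. \<Sum>i\<in>I. c i *\<^sub>R h i x) = (\<Sum>i\<in>I. c i *\<^sub>R A (h i)) \<and> C (\<lambda>x. \<Sum>i\<in>I. c i *\<^sub>R h i x)"
    using assms(1)
  proof (induction I rule: finite_induct)
    case empty
    \<comment> \<open>The empty sum is a combination, with zero coefficients, of arbitrary members
      of the family.\<close>
    show ?case
      using lin[OF C C, of 0 undefined 0 undefined] closed[OF C C, of 0 undefined 0 undefined] by simp
  next
    case (insert i I)
    then show ?case
      using lin[OF C, of "\<lambda>x. \<Sum>i\<in>I. c i *\<^sub>R h i x" "c i" i 1] closed[OF C, of "\<lambda>x. \<Sum>i\<in>I. c i *\<^sub>R h i x" "c i" i 1]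
      by simp
  qed
  then show ?thesis ..
qed

section \<open>Orthogonality and products of the operators\<close>

lemma fock_cinner_eq_0I:
  assumes fg: "f \<in> fock_carrier" "g \<in> fock_carrier" and z: "\<And>n x. f n x = 0 \<or> g n x = 0"
  shows "fock_cinner (abs_fock f) (abs_fock g) = 0"
proof -
  have "cnj (f n x) * g n x = 0" for n x using z[of n x] by auto
  then show ?thesis by (simp only: fock_cinner_abs[OF fg]) simp
qed

text \<open>On positive levels the first coordinate contributes the vanishing product of
  \<open>h\<close> and \<open>k\<close>, whatever \<open>F\<close> and \<open>G\<close> are; on
  level zero both vectors vanish.\<close>

lemma creation_orthogonal:
  assumes h: "square_integrable half_line h" and k: "square_integrable half_line k"
    and hk: "\<And>x. h x * k x = 0"
  shows "orthogonal (blinfun_apply (creation h) F) (blinfun_apply (creation k) G)"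
proof -
  obtain f where f: "f \<in> fock_carrier" "F = abs_fock f" by (rule fock_abs_cases)
  obtain g where g: "g \<in> fock_carrier" "G = abs_fock g" by (rule fock_abs_cases)
  have "creation_rep h f n x = 0 \<or> creation_rep k g n x = 0" for n x
    using hk[of "x 0"] by (auto simp: creation_rep_def split: nat.split)
  then show ?thesis
    by (simp add: orthogonal_def inner_fock_def f g creation_apply[OF h] creation_apply[OF k] fock_cinner_eq_0I)
qed

lemma conservation_orthogonal:
  assumes b: "bounded_symbol b" and c: "bounded_symbol c" and bc: "\<And>x. b x * c x = 0"
  shows "orthogonal (blinfun_apply (conservation b) F) (blinfun_apply (conservation c) G)"
proof -
  obtain f where f: "f \<in> fock_carrier" "F = abs_fock f" by (rule fock_abs_cases)
  obtain g where g: "g \<in> fock_carrier" "G = abs_fock g" by (rule fock_abs_cases)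
  have "conservation_rep b f n x = 0 \<or> conservation_rep c g n x = 0" for n x
    using bc[of "x 0"] by (auto simp: conservation_rep_def split: nat.split)
  then show ?thesis
    by (simp add: orthogonal_def inner_fock_def f g conservation_apply[OF b] conservation_apply[OF c] fock_cinner_eq_0I)
qed

lemma square_integrable_indicator_mult:
  fixes h :: "real \<Rightarrow> real"
  assumes "square_integrable half_line h"
  shows "square_integrable half_line (\<lambda>x. indicator {a..<b} x * h x)"
proof -
  have h[measurable]: "h \<in> borel_measurable half_line"
    and i: "(indicator {a..<b} :: real \<Rightarrow> real) \<in> borel_measurable half_line"
    using assms integrable_indicator_half_line(1)[of a b] by (simp_all only: square_integrable_def)
  have "integrable half_line (\<lambda>x. (norm (indicator {a..<b} x * h x))\<^sup>2)"
  proof (rule Bochner_Integration.integrable_bound)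
    show "integrable half_line (\<lambda>x. (norm (h x))\<^sup>2)" using assms by (simp add: square_integrable_def)
    show "(\<lambda>x. (norm (indicator {a..<b} x * h x))\<^sup>2) \<in> borel_measurable half_line"
      using i by measurable
  qed (auto split: split_indicator)
  moreover have "(\<lambda>x. indicator {a..<b} x * h x) \<in> borel_measurable half_line"
    using i by measurable
  ultimately show ?thesis by (simp add: square_integrable_def)
qed

text \<open>Conservation reads the first coordinate, which is the one that creation has just
  inserted.\<close>

lemma conservation_creation:
  assumes h: "square_integrable half_line h"
  shows "blinfun_apply (conservation (indicator {a..<b})) (blinfun_apply (creation h) F) =
    blinfun_apply (creation (\<lambda>x. indicator {a..<b} x * h x)) F"
proof -
  obtain f where f: "f \<in> fock_carrier" "F = abs_fock f" by (rule fock_abs_cases)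
  note h' = square_integrable_indicator_mult[OF h, of a b]
  have "conservation_rep (indicator {a..<b}) (creation_rep h f) = creation_rep (\<lambda>x. indicator {a..<b} x * h x) f"
    by (auto simp: fun_eq_iff conservation_rep_def creation_rep_def split: nat.split split_indicator)
  then show ?thesis
    unfolding f(2) creation_apply(2)[OF h f(1)] creation_apply(2)[OF h' f(1)]
    by (simp add: conservation_apply(2)[OF bounded_symbol_indicator creation_apply(1)[OF h f(1)]])
qed

lemma conservation_vacuum:
  assumes b: "bounded_symbol b"
  shows "blinfun_apply (conservation b) vacuum = 0"
proof -
  have "conservation_rep b (tensor_rep []) = (\<lambda>n x. 0)"
    by (auto simp: fun_eq_iff conservation_rep_def tensor_rep_def split: nat.split)
  then show ?thesis
    unfolding conservation_apply(2)[OF b tensor_rep_Nil_carrier] by (simp add: zero_fock_def)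
qed

section \<open>Discretization along a partition\<close>

text \<open>\<open>k\<close> is the index of the interval containing \<open>s\<close>. Sums over the
  indices with \<open>t i \<le> s\<close> include this interval and so reach to
  \<open>t (Suc k)\<close>, beyond \<open>s\<close>.\<close>

lemma partition_index:
  assumes t: "is_partition t" and s: "0 \<le> s"
  obtains k where "{i. t i \<le> s} = {..k}" "t k \<le> s" "s < t (Suc k)"
proof -
  have mono: "strict_mono t" and "s \<in> (\<Union>i. {t i..<t (Suc i)})"
    using t s by (auto simp: is_partition_def)
  then obtain k where k: "t k \<le> s" "s < t (Suc k)" by auto
  have "t i \<le> s \<longleftrightarrow> i \<le> k" for i
  proof
    assume "t i \<le> s"
    then have "t i < t (Suc k)" using k by simp
    then show "i \<le> k" using strict_mono_less[OF mono] by simp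
  next
    assume "i \<le> k"
    then have "t i \<le> t k" using strict_mono_less_eq[OF mono] by simp
    then show "t i \<le> s" using k by simp
  qed
  then show ?thesis using that k by auto
qed

lemma partition_nonneg:
  assumes "is_partition t" shows "0 \<le> t i"
  using assms strict_mono_less_eq[of t 0 i] by (simp add: is_partition_def)

lemma partition_less:
  assumes "is_partition t" shows "t i < t (Suc i)"
  using assms strict_mono_less[of t i "Suc i"] by (simp add: is_partition_def)

lemma partition_disjoint:
  assumes "is_partition t" "i \<noteq> j" shows "{t i..<t (Suc i)} \<inter> {t j..<t (Suc j)} = {}"
proof -
  have mono: "strict_mono t" using assms by (simp add: is_partition_def)
  have "t (Suc i) \<le> t j" if "i < j" for i j
    using that strict_mono_less_eq[OF mono, of "Suc i" j] by simp
  then show ?thesis using assms(2) by (cases i j rule: linorder_cases) fastforce+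
qed

lemma partition_indicator_mult:
  assumes "is_partition t" "i \<noteq> j"
  shows "indicator {t i..<t (Suc i)} x * indicator {t j..<t (Suc j)} x = (0 :: 'a::semiring_1)"
  using partition_disjoint[OF assms] by (auto simp: indicator_def)

text \<open>\<open>enn2real\<close> sends infinity to zero, so finiteness is what makes the real
  bound valid.\<close>

lemma partition_steps_le_mesh:
  assumes "mesh t < \<infinity>" shows "t (Suc i) - t i \<le> enn2real (mesh t)"
proof -
  have "ennreal \<bar>t (Suc i) - t i\<bar> \<le> mesh t" unfolding mesh_def by (rule SUP_upper) simp
  also have "\<dots> = ennreal (enn2real (mesh t))" using assms by simp
  finally show ?thesis by (simp add: ennreal_le_iff)
qed

lemma sum_indicator_steps:
  assumes t: "is_partition t"
  shows "(\<Sum>i\<le>k. indicator {t i..<t (Suc i)} x) = (indicator {0..<t (Suc k)} x :: 'a::real_algebra_1)"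
proof (induction k)
  case 0
  then show ?case using t by (simp add: is_partition_def)
next
  case (Suc k)
  have "{0..<t (Suc (Suc k))} = {0..<t (Suc k)} \<union> {t (Suc k)..<t (Suc (Suc k))}"
    using partition_nonneg[OF t, of "Suc k"] partition_less[OF t, of "Suc k"] by auto
  then have "indicator {0..<t (Suc (Suc k))} x =
      (indicator {0..<t (Suc k)} x + indicator {t (Suc k)..<t (Suc (Suc k))} x :: 'a)"
    by (auto simp: indicator_def)
  then show ?case
    unfolding sum.atMost_Suc Suc by (rule sym)
qed

text \<open>The square roots cancel the normalization of the steps, and adjacent intervals join
  up.\<close>

lemma sum_toy_steps:
  assumes t: "is_partition t"
  shows "(\<Sum>i\<le>k. sqrt (t (Suc i) - t i) *\<^sub>R toy_step t i x) = indicator {0..<t (Suc k)} x"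
proof -
  have "sqrt (t (Suc i) - t i) *\<^sub>R toy_step t i x = indicator {t i..<t (Suc i)} x" for i
    using partition_less[OF t, of i] by (simp add: toy_step_def)
  then show ?thesis by (simp add: sum_indicator_steps[OF t])
qed

lemma sum_scaled_field:
  fixes A :: "(real \<Rightarrow> real) \<Rightarrow> fock"
  assumes t: "is_partition t"
    and lin: "\<And>a b h k. square_integrable half_line h \<Longrightarrow> square_integrable half_line k \<Longrightarrow>
      A (\<lambda>x. a * h x + b * k x) = a *\<^sub>R A h + b *\<^sub>R A k"
  shows "(\<Sum>i\<le>k. sqrt (t (Suc i) - t i) *\<^sub>R A (toy_step t i)) = A (indicator {0..<t (Suc k)})"
proof -
  have "A (\<lambda>x. \<Sum>i\<le>k. sqrt (t (Suc i) - t i) *\<^sub>R toy_step t i x) =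
      (\<Sum>i\<le>k. sqrt (t (Suc i) - t i) *\<^sub>R A (toy_step t i))"
    by (rule lincomb_sum[where C = "square_integrable half_line"])
      (simp_all add: lin square_integrable_lincomb square_integrable_toy_step)
  then show ?thesis by (simp only: sum_toy_steps[OF t])
qed

lemma sum_conservation:
  assumes t: "is_partition t"
  shows "(\<Sum>i\<le>k. blinfun_apply (conservation (indicator {t i..<t (Suc i)})) F) =
    blinfun_apply (conservation (indicator {0..<t (Suc k)})) F"
proof -
  have "blinfun_apply (conservation (\<lambda>x. \<Sum>i\<le>k. 1 *\<^sub>R indicator {t i..<t (Suc i)} x)) F =
      (\<Sum>i\<le>k. 1 *\<^sub>R blinfun_apply (conservation (indicator {t i..<t (Suc i)})) F)"
    by (rule lincomb_sum[where C = bounded_symbol])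
      (simp_all only: conservation_lincomb bounded_symbol_lincomb bounded_symbol_indicator finite_atMost)
  then show ?thesis by (simp add: sum_indicator_steps[OF t])
qed

text \<open>A Bessel inequality: disjoint intervals give orthogonal pieces, and their sum is
  conservation by an indicator again, hence a contraction applied to \<open>F\<close>.\<close>

lemma sum_norm_conservation_sq:
  assumes t: "is_partition t"
  shows "(\<Sum>i\<le>k. (norm (blinfun_apply (conservation (indicator {t i..<t (Suc i)})) F))\<^sup>2) \<le> (norm F)\<^sup>2"
proof -
  have "(norm (\<Sum>i\<le>k. blinfun_apply (conservation (indicator {t i..<t (Suc i)})) F))\<^sup>2 =
      (\<Sum>i\<le>k. (norm (blinfun_apply (conservation (indicator {t i..<t (Suc i)})) F))\<^sup>2)"
  proof (rule norm_sum_Pythagorean)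
    show "pairwise (\<lambda>i j. orthogonal (blinfun_apply (conservation (indicator {t i..<t (Suc i)})) F)
        (blinfun_apply (conservation (indicator {t j..<t (Suc j)})) F)) {..k}"
      unfolding pairwise_def
      by (intro ballI impI conservation_orthogonal bounded_symbol_indicator partition_indicator_mult[OF t])
  qed simp
  then show ?thesis
    unfolding sum_conservation[OF t]
    by (metis power_mono[OF conservation_indicator_norm norm_ge_zero])
qed

text \<open>Orthogonality gives a sum of squares, from which the common bound of the coefficients is
  taken out; the Bessel inequality controls the rest uniformly in \<open>k\<close>.\<close>

lemma norm_sum_le_mesh:
  assumes t: "is_partition t" and d: "\<And>i. t (Suc i) - t i \<le> d"
    and orth: "\<And>i j. i \<noteq> j \<Longrightarrow> orthogonal (v i) (v j)"
    and v: "\<And>i. norm (v i) \<le> norm (blinfun_apply (conservation (indicator {t i..<t (Suc i)})) F)"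
  shows "norm (\<Sum>i\<le>k. (t (Suc i) - t i) *\<^sub>R v i) \<le> d * norm F"
    and "norm (\<Sum>i\<le>k. sqrt (t (Suc i) - t i) *\<^sub>R v i) \<le> sqrt d * norm F"
proof -
  have d0: "0 \<le> d" using d[of 0] partition_less[OF t, of 0] by simp
  \<comment> \<open>Both families of coefficients, the step lengths and their square roots, are
    instances.\<close>
  have le: "norm (\<Sum>i\<le>k. c i *\<^sub>R v i) \<le> e * norm F" if c: "\<And>i. 0 \<le> c i" "\<And>i. c i \<le> e" for c e
  proof -
    have e: "0 \<le> e" using c order_trans by blast
    have "(norm (\<Sum>i\<le>k. c i *\<^sub>R v i))\<^sup>2 = (\<Sum>i\<le>k. (norm (c i *\<^sub>R v i))\<^sup>2)"
      using orth by (intro norm_sum_Pythagorean) (auto simp: pairwise_def orthogonal_def)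
    also have "\<dots> \<le> (\<Sum>i\<le>k. e\<^sup>2 * (norm (blinfun_apply (conservation (indicator {t i..<t (Suc i)})) F))\<^sup>2)"
    proof (rule sum_mono)
      fix i
      have "norm (c i *\<^sub>R v i) \<le> e * norm (blinfun_apply (conservation (indicator {t i..<t (Suc i)})) F)"
        using c[of i] v[of i] e by (auto intro!: mult_mono)
      then show "(norm (c i *\<^sub>R v i))\<^sup>2 \<le>
          e\<^sup>2 * (norm (blinfun_apply (conservation (indicator {t i..<t (Suc i)})) F))\<^sup>2"
        unfolding power_mult_distrib[symmetric] by (rule power_mono) simp
    qed
    also have "\<dots> \<le> (e * norm F)\<^sup>2"
      using sum_norm_conservation_sq[OF t, where k = k and F = F]
      by (simp add: power_mult_distrib mult_left_mono flip: sum_distrib_left)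
    finally show ?thesis by (rule power2_le_imp_le) (simp add: e)
  qed
  show "norm (\<Sum>i\<le>k. (t (Suc i) - t i) *\<^sub>R v i) \<le> d * norm F"
    using partition_less[OF t] d by (intro le) (auto intro: less_imp_le)
  show "norm (\<Sum>i\<le>k. sqrt (t (Suc i) - t i) *\<^sub>R v i) \<le> sqrt d * norm F"
    using partition_less[OF t] d by (intro le) (auto intro: less_imp_le)
qed

section \<open>Mesh estimates and adapted creation\<close>

lemma l2_norm_sq_toy_step:
  assumes t: "is_partition t"
  shows "l2_norm_sq (toy_step t i) = 1"
proof -
  have "l2_norm_sq (toy_step t i) = (\<integral>x. indicator {t i..<t (Suc i)} x / (t (Suc i) - t i) \<partial>half_line)"
    unfolding l2_norm_sq_def using partition_less[OF t, of i]
    by (intro Bochner_Integration.integral_cong refl) (simp add: toy_step_def power_divide split: split_indicator)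
  also have "\<dots> = (\<integral>x. indicator {t i..<t (Suc i)} x \<partial>half_line) / (t (Suc i) - t i)"
    by (rule integral_divide_zero)
  also have "\<dots> = 1"
    using partition_less[OF t, of i]
    by (subst integrable_indicator_half_line(3)) (simp_all add: partition_nonneg[OF t])
  finally show ?thesis .
qed

lemma creation_toy_step_norm:
  assumes t: "is_partition t"
  shows "norm (blinfun_apply (creation (toy_step t i)) F) \<le> norm F"
  using creation_norm[OF square_integrable_toy_step, of t i F] by (simp add: l2_norm_sq_toy_step[OF t])

lemma creation_zero: "blinfun_apply (creation (\<lambda>x. 0)) F = 0"
  using creation_lincomb[OF square_integrable_toy_step square_integrable_toy_step, of 0 undefined undefined 0 undefined undefined F]
  by simp

lemma toy_step_mult: "toy_step t i x * toy_step t j x = 0" if "is_partition t" "i \<noteq> j"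
  using partition_disjoint[OF that] by (auto simp: toy_step_def indicator_def)

text \<open>This is the part of the discretized creation that repeats the first interval. The outer
  creations make its summands orthogonal, and creation by a normalized step does not enlarge the
  inner pieces.\<close>

lemma toy_creation_conservation_norm:
  assumes t: "is_partition t" and d: "\<And>i. t (Suc i) - t i \<le> d"
  shows "norm (\<Sum>i\<le>k. sqrt (t (Suc i) - t i) *\<^sub>R blinfun_apply (creation (toy_step t i))
      (blinfun_apply (conservation (indicator {t i..<t (Suc i)})) F)) \<le> sqrt d * norm F"
  using t d by (intro norm_sum_le_mesh(2))
    (auto intro!: creation_orthogonal creation_toy_step_norm square_integrable_toy_step toy_step_mult)

lemma conservation_norm_mesh:
  assumes t: "is_partition t" and d: "\<And>i. t (Suc i) - t i \<le> d"
  shows "norm (\<Sum>i\<le>k. (t (Suc i) - t i) *\<^sub>R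
      blinfun_apply (conservation (indicator {t i..<t (Suc i)})) F) \<le> d * norm F"
  by (intro norm_sum_le_mesh(1) t d conservation_orthogonal bounded_symbol_indicator
      partition_indicator_mult[OF t]) simp_all

text \<open>On words this composition prepends the letter \<open>i\<close> if the result is adapted, and gives \<open>0\<close> otherwise.\<close>

lemma adapted_creation_toy_fock:
  assumes t: "is_partition t" and F: "F \<in> toy_fock t"
  shows "blinfun_apply (creation (toy_step t i))
      (F - blinfun_apply (conservation (indicator {t i..<t (Suc i)})) F) \<in> toy_fock t"
proof -
  let ?c = "blinfun_apply (creation (toy_step t i))"
  let ?n = "blinfun_apply (conservation (indicator {t i..<t (Suc i)}))"
  let ?A = "\<lambda>F. ?c (F - ?n F)"
  \<comment> \<open>This preimage of the toy space is a closed complex subspace, so it is enough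
    that it contains the adapted words.\<close>
  let ?W = "{F. ?A F \<in> toy_fock t}"
  have word: "toy_word t \<sigma> \<in> toy_fock t" if "distinct_adj \<sigma>" for \<sigma>
    unfolding toy_fock_def using that
    by (intro subsetD[OF closure_subset] fock_complex.span_base) blast
  have "{toy_word t \<sigma> |\<sigma>. distinct_adj \<sigma>} \<subseteq> ?W"
  proof clarify
    fix \<sigma> :: "nat list" assume \<sigma>: "distinct_adj \<sigma>"
    show "?A (toy_word t \<sigma>) \<in> toy_fock t"
    proof (cases \<sigma>)
      case Nil
      then have "?A (toy_word t \<sigma>) = toy_word t [i]"
        by (simp add: toy_word_Cons toy_word_Nil conservation_vacuum bounded_symbol_indicator)
      then show ?thesis by (simp add: word)
    next
      case (Cons j \<tau>)
      have n: "?n (toy_word t \<sigma>) = blinfun_apply (creation (\<lambda>x. indicator {t i..<t (Suc i)} x * toy_step t j x)) (toy_word t \<tau>)"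
        unfolding Cons toy_word_Cons by (rule conservation_creation[OF square_integrable_toy_step])
      show ?thesis
      proof (cases "i = j")
        case True
        \<comment> \<open>The word already starts in this interval: conservation fixes it, and the
          difference is zero.\<close>
        have "(\<lambda>x. indicator {t i..<t (Suc i)} x * toy_step t j x) = toy_step t j"
          by (auto simp: True toy_step_def fun_eq_iff split: split_indicator)
        then have "?A (toy_word t \<sigma>) = ?c 0"
          unfolding n by (simp add: Cons toy_word_Cons)
        also have "\<dots> = 0" by (rule blinfun.zero_right)
        finally show ?thesis using fock_complex.subspace_0[OF subspace_toy_fock] by simp
      next
        case False
        \<comment> \<open>The word starts in another interval: conservation kills it, and creation
          prepends a letter different from its first, so the result is adapted.\<close>
        have "(\<lambda>x. indicator {t i..<t (Suc i)} x * toy_step t j x) = (\<lambda>x. 0)"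
          using partition_disjoint[OF t False] by (auto simp: toy_step_def fun_eq_iff split: split_indicator)
        then have "?A (toy_word t \<sigma>) = toy_word t (i # \<sigma>)"
          unfolding n by (simp add: creation_zero toy_word_Cons[of t i \<sigma>])
        then show ?thesis using \<sigma> False by (simp add: word Cons)
      qed
    qed
  qed
  moreover have "fock_complex.subspace ?W"
  proof (rule fock_complex.subspaceI)
    show "0 \<in> ?W"
      using fock_complex.subspace_0[OF subspace_toy_fock] by (simp add: blinfun.zero_right)
    show "F + G \<in> ?W" if "F \<in> ?W" "G \<in> ?W" for F G
    proof -
      have "?A (F + G) = ?A F + ?A G" by (simp add: blinfun.add_right blinfun.diff_right)
      then show ?thesis using that fock_complex.subspace_add[OF subspace_toy_fock] by simp
    qed
    show "fock_scale c F \<in> ?W" if "F \<in> ?W" for c F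
    proof -
      have "?A (fock_scale c F) = fock_scale c (?A F)"
        by (simp add: conservation_scale bounded_symbol_indicator creation_scale square_integrable_toy_step
            flip: fock_complex.scale_right_diff_distrib)
      then show ?thesis using that fock_complex.subspace_scale[OF subspace_toy_fock] by simp
    qed
  qed
  ultimately have "fock_complex.span {toy_word t \<sigma> |\<sigma>. distinct_adj \<sigma>} \<subseteq> ?W"
    by (rule fock_complex.span_minimal)
  moreover have "closed ?W"
  proof -
    have "continuous_on UNIV ?A" by (intro continuous_intros)
    then have "closed (?A -` toy_fock t)" using closed_toy_fock by (simp add: closed_vimage)
    then show ?thesis by (simp add: vimage_def)
  qed
  ultimately have "toy_fock t \<subseteq> ?W" unfolding toy_fock_def by (rule closure_minimal)
  then show ?thesis using F by blast
qed

text \<open>Uniform contractivity makes the set of vectors with null limit closed, and complex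
  homogeneity makes it a complex subspace, so iterated creation from the vacuum reaches
  everything.\<close>

lemma strong_null_if_creation_invariant:
  fixes T :: "nat \<Rightarrow> fock \<Rightarrow>\<^sub>L fock"
  assumes contr: "\<And>n F. norm (blinfun_apply (T n) F) \<le> norm F"
    and scale: "\<And>n c F. blinfun_apply (T n) (fock_scale c F) = fock_scale c (blinfun_apply (T n) F)"
    and vac: "(\<lambda>n. blinfun_apply (T n) vacuum) \<longlonglongrightarrow> 0"
    and inv: "\<And>F s. 0 \<le> s \<Longrightarrow> (\<lambda>n. blinfun_apply (T n) F) \<longlonglongrightarrow> 0 \<Longrightarrow>
      (\<lambda>n. blinfun_apply (T n) (blinfun_apply (creation (indicator {0..<s})) F)) \<longlonglongrightarrow> 0"
  shows "(\<lambda>n. blinfun_apply (T n) F) \<longlonglongrightarrow> 0"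
proof -
  let ?V = "{F. (\<lambda>n. blinfun_apply (T n) F) \<longlonglongrightarrow> 0}"
  have "closed ?V"
    unfolding closed_sequential_limits
  proof (intro allI impI, elim conjE)
    fix f F assume f: "\<forall>m. f m \<in> ?V" "f \<longlonglongrightarrow> F"
    have "(\<lambda>n. blinfun_apply (T n) F) \<longlonglongrightarrow> 0"
    proof (rule LIMSEQ_I)
      fix e :: real assume e: "0 < e"
      obtain m where m: "norm (f m - F) < e / 2"
        using LIMSEQ_D[OF f(2), of "e / 2"] e by auto
      obtain N where N: "\<And>n. n \<ge> N \<Longrightarrow> norm (blinfun_apply (T n) (f m)) < e / 2"
        using LIMSEQ_D[of "\<lambda>n. blinfun_apply (T n) (f m)" 0 "e / 2"] f(1) e by auto
      show "\<exists>N. \<forall>n\<ge>N. norm (blinfun_apply (T n) F - 0) < e"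
      proof (intro exI allI impI)
        fix n assume n: "N \<le> n"
        have "blinfun_apply (T n) F = blinfun_apply (T n) (f m) - blinfun_apply (T n) (f m - F)"
          by (simp add: blinfun.diff_right)
        then have "norm (blinfun_apply (T n) F) \<le> norm (blinfun_apply (T n) (f m)) + norm (blinfun_apply (T n) (f m - F))"
          by (simp only: norm_triangle_ineq4)
        then show "norm (blinfun_apply (T n) F - 0) < e"
          using N[OF n] m contr[of n "f m - F"] by simp
      qed
    qed
    then show "F \<in> ?V" by simp
  qed
  moreover have "fock_complex.subspace ?V"
  proof (rule fock_complex.subspaceI)
    show "0 \<in> ?V" by (simp add: blinfun.zero_right)
    show "F + G \<in> ?V" if "F \<in> ?V" "G \<in> ?V" for F G
      using that tendsto_add[of "\<lambda>n. blinfun_apply (T n) F" 0 sequentially "\<lambda>n. blinfun_apply (T n) G" 0]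
      by (simp add: blinfun.add_right)
    show "fock_scale c F \<in> ?V" if "F \<in> ?V" for c F
      using that bounded_linear.tendsto[OF bounded_linear_fock_scale, of "\<lambda>n. blinfun_apply (T n) F" 0 sequentially c]
      by (simp add: scale)
  qed
  ultimately have "F \<in> ?V"
    using vac inv by - (rule fock_eq_UNIV_if_creation_invariant, simp_all)
  then show ?thesis by simp
qed

text \<open>The strong operator topology is the pullback along \<open>blinfun_apply\<close> of the
  product topology, in which convergence is pointwise.\<close>

lemma limitin_strong_operator_topology:
  assumes "\<And>x. (\<lambda>n. blinfun_apply (A n) x) \<longlonglongrightarrow> blinfun_apply B x"
  shows "limitin strong_operator_topology A B sequentially"
proof -
  have "limitin (product_topology (\<lambda>_. euclidean) UNIV) (\<lambda>n. blinfun_apply (A n)) (blinfun_apply B) sequentially"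
    using assms by (simp add: limitin_componentwise)
  then have "(\<lambda>n. blinfun_apply (A n)) \<longlonglongrightarrow> blinfun_apply B"
    by (simp only: euclidean_product_topology limitin_canonical_iff)
  then show ?thesis
    unfolding limitin_def strong_operator_topology_topspace
    by (auto simp: strong_operator_topology_def openin_pullback_topology dest: topological_tendstoD)
qed

text \<open>The uniform bound on \<open>B n\<close> allows replacing the inner \<open>P n F\<close>
  by \<open>F\<close>; contractivity of the outer \<open>P n\<close> then allows replacing its
  argument by \<open>G\<close>.\<close>

lemma tendsto_compression:
  fixes P B :: "nat \<Rightarrow> 'a::real_normed_vector \<Rightarrow>\<^sub>L 'a"
  assumes P: "\<And>n F. norm (blinfun_apply (P n) F) \<le> norm F" "\<And>F. (\<lambda>n. blinfun_apply (P n) F) \<longlonglongrightarrow> F"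
    and K: "\<forall>\<^sub>F n in sequentially. \<forall>F. norm (blinfun_apply (B n) F) \<le> K * norm F"
    and B: "(\<lambda>n. blinfun_apply (B n) F) \<longlonglongrightarrow> G"
  shows "(\<lambda>n. blinfun_apply (P n) (blinfun_apply (B n) (blinfun_apply (P n) F))) \<longlonglongrightarrow> G"
proof -
  have "(\<lambda>n. blinfun_apply (B n) (blinfun_apply (P n) F - F)) \<longlonglongrightarrow> 0"
  proof (rule Lim_null_comparison)
    show "\<forall>\<^sub>F n in sequentially. norm (blinfun_apply (B n) (blinfun_apply (P n) F - F)) \<le> K * norm (blinfun_apply (P n) F - F)"
      using K by eventually_elim blast
    show "(\<lambda>n. K * norm (blinfun_apply (P n) F - F)) \<longlonglongrightarrow> 0"
      using P(2)[of F] by (intro tendsto_mult_right_zero tendsto_norm_zero LIM_zero)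
  qed
  from tendsto_add[OF this B] have "(\<lambda>n. blinfun_apply (B n) (blinfun_apply (P n) F)) \<longlonglongrightarrow> G"
    by (simp add: blinfun.diff_right)
  then have "(\<lambda>n. blinfun_apply (B n) (blinfun_apply (P n) F) - G) \<longlonglongrightarrow> 0" by (rule LIM_zero)
  then have "(\<lambda>n. blinfun_apply (P n) (blinfun_apply (B n) (blinfun_apply (P n) F) - G)) \<longlonglongrightarrow> 0"
    by (rule Lim_null_comparison[rotated, OF tendsto_norm_zero]) (simp add: P(1))
  from tendsto_add[OF this P(2)[of G]] show ?thesis by (simp add: blinfun.diff_right)
qed

section \<open>Convergence\<close>

text \<open>A real bound replaces the extended real mesh. It is demanded only eventually, since
  early meshes may be infinite and the given sequence starts at index one.\<close>

definition fine_partitions :: "(nat \<Rightarrow> nat \<Rightarrow> real) \<Rightarrow> (nat \<Rightarrow> real) \<Rightarrow> bool"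
  where "fine_partitions S d \<longleftrightarrow> d \<longlonglongrightarrow> 0 \<and>
    (\<forall>\<^sub>F n in sequentially. is_partition (S n) \<and> (\<forall>i. S n (Suc i) - S n i \<le> d n))"

lemma fine_partitions_mesh:
  assumes partition: "\<And>n. n \<ge> 1 \<Longrightarrow> is_partition (S n)" and mesh: "(\<lambda>n. mesh (S n)) \<longlonglongrightarrow> 0"
  shows "fine_partitions S (\<lambda>n. enn2real (mesh (S n)))"
proof -
  have "(\<lambda>n. enn2real (mesh (S n))) \<longlonglongrightarrow> 0"
    using tendsto_enn2real[of "\<lambda>n. mesh (S n)" 0 sequentially] mesh by simp
  moreover have "\<forall>\<^sub>F n in sequentially. mesh (S n) < \<infinity>"
    using order_tendstoD(2)[OF mesh, of \<infinity>] by simp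
  then have "\<forall>\<^sub>F n in sequentially. is_partition (S n) \<and> (\<forall>i. S n (Suc i) - S n i \<le> enn2real (mesh (S n)))"
    using eventually_ge_at_top[of 1]
    by eventually_elim (simp add: partition partition_steps_le_mesh)
  ultimately show ?thesis by (simp add: fine_partitions_def)
qed

text \<open>\<open>S n (Suc (k n))\<close> is the first partition point after \<open>s\<close>; it
  exceeds \<open>s\<close> by at most one step, so it tends to \<open>s\<close>.\<close>

lemma fine_partitions_index:
  assumes S: "fine_partitions S d" and s: "0 \<le> s"
  obtains k where
    "\<forall>\<^sub>F n in sequentially. is_partition (S n) \<and> (\<forall>i. S n (Suc i) - S n i \<le> d n) \<and> {i. S n i \<le> s} = {..k n}
      \<and> s \<le> S n (Suc (k n))"
    "(\<lambda>n. S n (Suc (k n))) \<longlonglongrightarrow> s"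
proof -
  \<comment> \<open>Being a partition stands as a premise inside, so that \<open>k\<close> can be
    chosen for all \<open>n\<close> at once.\<close>
  have "\<forall>n. \<exists>k. is_partition (S n) \<longrightarrow> {i. S n i \<le> s} = {..k} \<and> S n k \<le> s \<and> s < S n (Suc k)"
    using partition_index[OF _ s] by metis
  then obtain k where k: "\<And>n. is_partition (S n) \<Longrightarrow> {i. S n i \<le> s} = {..k n} \<and> S n (k n) \<le> s \<and> s < S n (Suc (k n))"
    by metis
  have ev: "\<forall>\<^sub>F n in sequentially. is_partition (S n) \<and> (\<forall>i. S n (Suc i) - S n i \<le> d n)"
    using S by (simp add: fine_partitions_def)
  have "(\<lambda>n. S n (Suc (k n))) \<longlonglongrightarrow> s"
  proof (rule tendsto_sandwich)
    show "\<forall>\<^sub>F n in sequentially. s \<le> S n (Suc (k n))"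
      using ev by eventually_elim (auto dest: k)
    show "\<forall>\<^sub>F n in sequentially. S n (Suc (k n)) \<le> s + d n"
      using ev
    proof eventually_elim
      case (elim n)
      then have "S n (k n) \<le> s" "S n (Suc (k n)) - S n (k n) \<le> d n" using k by blast+
      then show ?case by linarith
    qed
    show "(\<lambda>n. s + d n) \<longlonglongrightarrow> s"
      using S tendsto_add[OF tendsto_const[of s], of d 0] by (simp add: fine_partitions_def)
  qed simp
  moreover have "\<forall>\<^sub>F n in sequentially. is_partition (S n) \<and> (\<forall>i. S n (Suc i) - S n i \<le> d n) \<and> {i. S n i \<le> s} = {..k n}
      \<and> s \<le> S n (Suc (k n))"
    using ev by eventually_elim (use k in \<open>auto intro: less_imp_le\<close>)
  ultimately show ?thesis by (intro that)
qed

text \<open>Linearity in the test function and the norm bound are all that the limit uses, so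
  creation and annihilation share one proof.\<close>

definition field_operator :: "((real \<Rightarrow> real) \<Rightarrow> fock \<Rightarrow>\<^sub>L fock) \<Rightarrow> bool"
  where "field_operator A \<longleftrightarrow>
    (\<forall>h k a b F. square_integrable half_line h \<longrightarrow> square_integrable half_line k \<longrightarrow>
      blinfun_apply (A (\<lambda>x. a * h x + b * k x)) F = a *\<^sub>R blinfun_apply (A h) F + b *\<^sub>R blinfun_apply (A k) F) \<and>
    (\<forall>h F. square_integrable half_line h \<longrightarrow> norm (blinfun_apply (A h) F) \<le> sqrt (l2_norm_sq h) * norm F)"

lemma field_operator_creation: "field_operator creation"
  by (simp add: field_operator_def creation_lincomb creation_norm)

lemma field_operator_annihilation: "field_operator annihilation"
  by (simp add: field_operator_def annihilation_lincomb annihilation_norm)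

lemma field_operator_lincomb:
  "field_operator A \<Longrightarrow> square_integrable half_line h \<Longrightarrow> square_integrable half_line k \<Longrightarrow>
    blinfun_apply (A (\<lambda>x. a * h x + b * k x)) F = a *\<^sub>R blinfun_apply (A h) F + b *\<^sub>R blinfun_apply (A k) F"
  by (simp add: field_operator_def)

lemma field_operator_norm_indicator:
  "field_operator A \<Longrightarrow> 0 \<le> a \<Longrightarrow> a \<le> b \<Longrightarrow>
    norm (blinfun_apply (A (indicator {a..<b})) F) \<le> sqrt (b - a) * norm F"
  unfolding field_operator_def using integrable_indicator_half_line(1,4)[of a b] by metis

text \<open>The difference is the operator of \<open>{s..<\<tau> n}\<close>, of norm at most
  \<open>sqrt (\<tau> n - s)\<close>.\<close>

lemma field_operator_tendsto:
  assumes A: "field_operator A" and s: "0 \<le> s" "\<forall>\<^sub>F n in sequentially. s \<le> \<tau> n" "\<tau> \<longlonglongrightarrow> s"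
  shows "(\<lambda>n. blinfun_apply (A (indicator {0..<\<tau> n})) F) \<longlonglongrightarrow> blinfun_apply (A (indicator {0..<s})) F"
proof (rule LIM_zero_cancel, rule Lim_null_comparison)
  show "\<forall>\<^sub>F n in sequentially. norm (blinfun_apply (A (indicator {0..<\<tau> n})) F - blinfun_apply (A (indicator {0..<s})) F)
      \<le> sqrt (\<tau> n - s) * norm F"
    using s(2)
  proof eventually_elim
    case (elim n)
    have "(indicator {s..<\<tau> n} :: real \<Rightarrow> real) = (\<lambda>x. 1 * indicator {0..<\<tau> n} x + (- 1) * indicator {0..<s} x)"
      using s(1) elim by (auto simp: fun_eq_iff indicator_def)
    then have "blinfun_apply (A (indicator {s..<\<tau> n})) F =
        1 *\<^sub>R blinfun_apply (A (indicator {0..<\<tau> n})) F + (- 1) *\<^sub>R blinfun_apply (A (indicator {0..<s})) F"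
      by (simp only: field_operator_lincomb[OF A integrable_indicator_half_line(1) integrable_indicator_half_line(1)])
    then show ?case
      using field_operator_norm_indicator[OF A s(1) elim, of F] by simp
  qed
  have "(\<lambda>n. sqrt (\<tau> n - s) * norm F) \<longlonglongrightarrow> sqrt (s - s) * norm F"
    by (intro tendsto_intros s(3))
  then show "(\<lambda>n. sqrt (\<tau> n - s) * norm F) \<longlonglongrightarrow> 0" by simp
qed

lemma sum_steps_field_operator:
  assumes "field_operator A" "is_partition t"
  shows "(\<Sum>i\<le>k. sqrt (t (Suc i) - t i) *\<^sub>R blinfun_apply (A (toy_step t i)) F) =
    blinfun_apply (A (indicator {0..<t (Suc k)})) F"
  using assms by (intro sum_scaled_field[where A = "\<lambda>h. blinfun_apply (A h) F"] field_operator_lincomb)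

lemma toy_proj_tendsto:
  assumes S: "fine_partitions S d"
  shows "(\<lambda>n. blinfun_apply (toy_proj (S n)) F) \<longlonglongrightarrow> F"
proof -
  \<comment> \<open>The complementary projection is a contraction too, and the goal becomes that it
    tends strongly to zero.\<close>
  define T where "T n = id_blinfun - toy_proj (S n)" for n
  have T: "blinfun_apply (T n) F = F - blinfun_apply (toy_proj (S n)) F" for n F
    by (simp add: T_def blinfun.diff_left)
  have "(\<lambda>n. blinfun_apply (T n) F) \<longlonglongrightarrow> 0"
  proof (rule strong_null_if_creation_invariant)
    show "norm (blinfun_apply (T n) F) \<le> norm F" for n F
      using toy_proj_nearest[OF fock_complex.subspace_0[OF subspace_toy_fock], of F] by (simp add: T)
    show "blinfun_apply (T n) (fock_scale c F) = fock_scale c (blinfun_apply (T n) F)" for n c F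
      by (simp add: T toy_proj_scale fock_complex.scale_right_diff_distrib)
    \<comment> \<open>The vacuum is the empty word, hence fixed by every projection.\<close>
    have "vacuum \<in> toy_fock t" for t
      unfolding toy_fock_def toy_word_Nil[of t, symmetric]
      by (intro subsetD[OF closure_subset] fock_complex.span_base CollectI exI[of _ "[]"]) simp
    then show "(\<lambda>n. blinfun_apply (T n) vacuum) \<longlonglongrightarrow> 0"
      by (simp add: T toy_proj_fixes)
    fix F s assume s: "0 \<le> (s::real)" and "(\<lambda>n. blinfun_apply (T n) F) \<longlonglongrightarrow> 0"
    then have PF: "(\<lambda>n. F - blinfun_apply (toy_proj (S n)) F) \<longlonglongrightarrow> 0" by (simp add: T)
    obtain k where k: "\<forall>\<^sub>F n in sequentially. is_partition (S n) \<and> (\<forall>i. S n (Suc i) - S n i \<le> d n)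
        \<and> {i. S n i \<le> s} = {..k n} \<and> s \<le> S n (Suc (k n))" and \<tau>: "(\<lambda>n. S n (Suc (k n))) \<longlonglongrightarrow> s"
      using fine_partitions_index[OF S s] by blast
    have s\<tau>: "\<forall>\<^sub>F n in sequentially. s \<le> S n (Suc (k n))" using k by eventually_elim simp
    let ?p = "\<lambda>n. blinfun_apply (toy_proj (S n)) F"
    let ?C = "\<lambda>n. blinfun_apply (creation (indicator {0..<S n (Suc (k n))}))"
    let ?G = "blinfun_apply (creation (indicator {0..<s})) F"
    \<comment> \<open>The nonadapted part of the creation: the new coordinate falls into the same
      interval as the first coordinate of \<open>?p n\<close>.\<close>
    define N where "N n = (\<Sum>i\<le>k n. sqrt (S n (Suc i) - S n i) *\<^sub>R blinfun_apply (creation (toy_step (S n) i))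
      (blinfun_apply (conservation (indicator {S n i..<S n (Suc i)})) (?p n)))" for n
    \<comment> \<open>Removing this part leaves a sum of creations that preserve the toy space,
      hence an admissible approximant.\<close>
    have U: "\<forall>\<^sub>F n in sequentially. ?C n (?p n) - N n \<in> toy_fock (S n)"
      using k
    proof eventually_elim
      case (elim n)
      have "?C n (?p n) - N n = (\<Sum>i\<le>k n. sqrt (S n (Suc i) - S n i) *\<^sub>R blinfun_apply (creation (toy_step (S n) i))
        (?p n - blinfun_apply (conservation (indicator {S n i..<S n (Suc i)})) (?p n)))"
        using elim sum_steps_field_operator[OF field_operator_creation, where t = "S n" and k = "k n" and F = "?p n"]
        by (simp add: N_def blinfun.diff_right scaleR_diff_right sum_subtractf)
      also have "\<dots> \<in> toy_fock (S n)"
        using elim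
        by (intro fock_complex.subspace_sum[OF subspace_toy_fock] fock_scaleR_in_subspace[OF subspace_toy_fock]
            adapted_creation_toy_fock toy_proj_in) simp
      finally show ?case .
    qed
    have "N \<longlonglongrightarrow> 0"
    proof (rule Lim_null_comparison)
      show "\<forall>\<^sub>F n in sequentially. norm (N n) \<le> sqrt (d n) * norm F"
        using k
      proof eventually_elim
        case (elim n)
        then have d0: "0 \<le> d n" using partition_less[of "S n" 0] by (smt (verit))
        have "norm (N n) \<le> sqrt (d n) * norm (?p n)"
          unfolding N_def using elim by (intro toy_creation_conservation_norm) auto
        also have "\<dots> \<le> sqrt (d n) * norm F"
          using d0 by (intro mult_left_mono toy_proj_contraction) simp
        finally show ?case .
      qed
      have "(\<lambda>n. sqrt (d n) * norm F) \<longlonglongrightarrow> sqrt 0 * norm F"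
        using S by (intro tendsto_intros) (simp add: fine_partitions_def)
      then show "(\<lambda>n. sqrt (d n) * norm F) \<longlonglongrightarrow> 0" by simp
    qed
    moreover have "(\<lambda>n. ?C n (F - ?p n)) \<longlonglongrightarrow> 0"
    proof (rule Lim_null_comparison)
      show "\<forall>\<^sub>F n in sequentially. norm (?C n (F - ?p n)) \<le> sqrt (S n (Suc (k n)) - 0) * norm (F - ?p n)"
        using s\<tau>
      proof eventually_elim
        case (elim n)
        then show ?case using s by (intro field_operator_norm_indicator[OF field_operator_creation]) auto
      qed
      have "(\<lambda>n. sqrt (S n (Suc (k n)) - 0) * norm (F - ?p n)) \<longlonglongrightarrow> sqrt (s - 0) * 0"
        using PF by (intro tendsto_intros \<tau> tendsto_norm_zero)
      then show "(\<lambda>n. sqrt (S n (Suc (k n)) - 0) * norm (F - ?p n)) \<longlonglongrightarrow> 0" by simp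
    qed
    moreover have "(\<lambda>n. ?C n F) \<longlonglongrightarrow> ?G"
      by (rule field_operator_tendsto[OF field_operator_creation s s\<tau> \<tau>])
    \<comment> \<open>By linearity \<open>?C n F - ?C n (F - ?p n)\<close> is
      \<open>?C n (?p n)\<close>, so the approximants tend to \<open>?G\<close>.\<close>
    ultimately have "(\<lambda>n. ?G - (?C n F - ?C n (F - ?p n) - N n)) \<longlonglongrightarrow> ?G - (?G - 0 - 0)"
      by (intro tendsto_diff tendsto_const)
    then have lim: "(\<lambda>n. ?G - (?C n (?p n) - N n)) \<longlonglongrightarrow> 0"
      by (simp add: blinfun.diff_right)
    show "(\<lambda>n. blinfun_apply (T n) ?G) \<longlonglongrightarrow> 0"
    proof (rule Lim_null_comparison[OF _ tendsto_norm_zero[OF lim]])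
      show "\<forall>\<^sub>F n in sequentially. norm (blinfun_apply (T n) ?G) \<le> norm (?G - (?C n (?p n) - N n))"
        using U unfolding T by eventually_elim (rule toy_proj_nearest)
    qed
  qed
  then have "(\<lambda>n. F - blinfun_apply (T n) F) \<longlonglongrightarrow> F - 0" by (intro tendsto_intros)
  then show ?thesis by (simp add: T)
qed

lemma conservation_tendsto:
  assumes s: "0 \<le> s" "\<forall>\<^sub>F n in sequentially. s \<le> \<tau> n" "\<tau> \<longlonglongrightarrow> s"
  shows "(\<lambda>n. blinfun_apply (conservation (indicator {0..<\<tau> n})) F) \<longlonglongrightarrow>
    blinfun_apply (conservation (indicator {0..<s})) F"
proof -
  let ?T = "\<lambda>n. conservation (indicator {s..<\<tau> n})"
  have "(\<lambda>n. blinfun_apply (?T n) F) \<longlonglongrightarrow> 0"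
  proof (rule strong_null_if_creation_invariant)
    show "norm (blinfun_apply (?T n) F) \<le> norm F" for n F by (rule conservation_indicator_norm)
    show "blinfun_apply (?T n) (fock_scale c F) = fock_scale c (blinfun_apply (?T n) F)" for n c F
      by (rule conservation_scale[OF bounded_symbol_indicator])
    show "(\<lambda>n. blinfun_apply (?T n) vacuum) \<longlonglongrightarrow> 0"
      by (simp add: conservation_vacuum bounded_symbol_indicator)
    fix F r assume r: "0 \<le> (r::real)"
    let ?F = "blinfun_apply (creation (indicator {0..<r})) F"
    show "(\<lambda>n. blinfun_apply (?T n) ?F) \<longlonglongrightarrow> 0"
    proof (rule Lim_null_comparison)
      show "\<forall>\<^sub>F n in sequentially. norm (blinfun_apply (?T n) ?F) \<le> sqrt (\<tau> n - s) * norm F"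
        using s(2)
      proof eventually_elim
        case (elim n)
        \<comment> \<open>The right end of the overlap of the two intervals; the outer
          \<open>max\<close> makes the overlap empty and keeps \<open>s \<le> ?m\<close> when
          \<open>r\<close> lies below \<open>s\<close>.\<close>
        let ?m = "max s (min (\<tau> n) r)"
        have "(\<lambda>x. indicator {s..<\<tau> n} x * indicator {0..<r} x) = (indicator {s..<?m} :: real \<Rightarrow> real)"
          using s(1) by (auto simp: fun_eq_iff indicator_def)
        then have "blinfun_apply (?T n) ?F = blinfun_apply (creation (indicator {s..<?m})) F"
          by (simp only: conservation_creation[OF integrable_indicator_half_line(1)])
        then have "norm (blinfun_apply (?T n) ?F) \<le> sqrt (?m - s) * norm F"
          using field_operator_norm_indicator[OF field_operator_creation s(1), of ?m F] by simp
        also have "\<dots> \<le> sqrt (\<tau> n - s) * norm F"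
          using elim by (intro mult_right_mono) auto
        finally show ?case .
      qed
      have "(\<lambda>n. sqrt (\<tau> n - s) * norm F) \<longlonglongrightarrow> sqrt (s - s) * norm F"
        by (intro tendsto_intros s(3))
      then show "(\<lambda>n. sqrt (\<tau> n - s) * norm F) \<longlonglongrightarrow> 0" by simp
    qed
  qed
  moreover have "\<forall>\<^sub>F n in sequentially. blinfun_apply (?T n) F =
      blinfun_apply (conservation (indicator {0..<\<tau> n})) F - blinfun_apply (conservation (indicator {0..<s})) F"
    using s(2)
  proof eventually_elim
    case (elim n)
    have "(indicator {s..<\<tau> n} :: real \<Rightarrow> complex) =
        (\<lambda>x. 1 *\<^sub>R indicator {0..<\<tau> n} x + (- 1) *\<^sub>R indicator {0..<s} x)"
      using s(1) elim by (auto simp: fun_eq_iff indicator_def)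
    then have "blinfun_apply (?T n) F = 1 *\<^sub>R blinfun_apply (conservation (indicator {0..<\<tau> n})) F +
        (- 1) *\<^sub>R blinfun_apply (conservation (indicator {0..<s})) F"
      by (simp only: conservation_lincomb[OF bounded_symbol_indicator bounded_symbol_indicator])
    then show ?case by simp
  qed
  ultimately have "(\<lambda>n. blinfun_apply (conservation (indicator {0..<\<tau> n})) F -
      blinfun_apply (conservation (indicator {0..<s})) F) \<longlonglongrightarrow> 0"
    by (rule Lim_transform_eventually)
  then show ?thesis by (rule LIM_zero_cancel)
qed

text \<open>The two outer projections do not depend on \<open>i\<close>, so the sum is a single
  compression of the operator for the interval up to the first partition point after
  \<open>t\<close>.\<close>

lemma toy_field_operator_tendsto:
  assumes A: "field_operator A" and S: "fine_partitions S d" and t: "0 \<le> t"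
  shows "limitin strong_operator_topology
    (\<lambda>n. \<Sum>i | S n i \<le> t. sqrt (S n (Suc i) - S n i) *\<^sub>R
      (toy_proj (S n) o\<^sub>L A (toy_step (S n) i) o\<^sub>L toy_proj (S n)))
    (A (indicator {0..<t})) sequentially"
proof (rule limitin_strong_operator_topology)
  fix F
  obtain k where k: "\<forall>\<^sub>F n in sequentially. is_partition (S n) \<and> (\<forall>i. S n (Suc i) - S n i \<le> d n)
      \<and> {i. S n i \<le> t} = {..k n} \<and> t \<le> S n (Suc (k n))" and \<tau>: "(\<lambda>n. S n (Suc (k n))) \<longlonglongrightarrow> t"
    using fine_partitions_index[OF S t] by blast
  have t\<tau>: "\<forall>\<^sub>F n in sequentially. t \<le> S n (Suc (k n))" using k by eventually_elim simp
  let ?P = "\<lambda>n. toy_proj (S n)" and ?B = "\<lambda>n. A (indicator {0..<S n (Suc (k n))})"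
  have "(\<lambda>n. blinfun_apply (?P n) (blinfun_apply (?B n) (blinfun_apply (?P n) F)))
      \<longlonglongrightarrow> blinfun_apply (A (indicator {0..<t})) F"
  proof (rule tendsto_compression)
    \<comment> \<open>The right endpoint tends to \<open>t\<close> and is eventually below
      \<open>t + 1\<close>, which gives one bound for all late \<open>n\<close>.\<close>
    show "\<forall>\<^sub>F n in sequentially. \<forall>F. norm (blinfun_apply (?B n) F) \<le> sqrt (t + 1) * norm F"
      using t\<tau> order_tendstoD(2)[OF \<tau>, of "t + 1", simplified]
    proof eventually_elim
      case (elim n)
      show ?case
      proof
        fix F
        have "norm (blinfun_apply (?B n) F) \<le> sqrt (S n (Suc (k n)) - 0) * norm F"
          using elim t by (intro field_operator_norm_indicator[OF A]) auto
        also have "\<dots> \<le> sqrt (t + 1) * norm F"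
          using elim by (intro mult_right_mono) auto
        finally show "norm (blinfun_apply (?B n) F) \<le> sqrt (t + 1) * norm F" .
      qed
    qed
  qed (intro toy_proj_contraction toy_proj_tendsto[OF S] field_operator_tendsto[OF A t t\<tau> \<tau>])+
  then show "(\<lambda>n. blinfun_apply (\<Sum>i | S n i \<le> t. sqrt (S n (Suc i) - S n i) *\<^sub>R
      (?P n o\<^sub>L A (toy_step (S n) i) o\<^sub>L ?P n)) F) \<longlonglongrightarrow> blinfun_apply (A (indicator {0..<t})) F"
  proof (rule Lim_transform_eventually)
    show "\<forall>\<^sub>F n in sequentially. blinfun_apply (?P n) (blinfun_apply (?B n) (blinfun_apply (?P n) F)) =
        blinfun_apply (\<Sum>i | S n i \<le> t. sqrt (S n (Suc i) - S n i) *\<^sub>R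
          (?P n o\<^sub>L A (toy_step (S n) i) o\<^sub>L ?P n)) F"
      using k
    proof eventually_elim
      case (elim n)
      then show ?case
        by (simp add: sum_steps_field_operator[OF A, symmetric] blinfun.sum_left blinfun.sum_right
            blinfun.scaleR_left blinfun.scaleR_right)
    qed
  qed
qed

text \<open>The same compression argument, with one as the uniform bound.\<close>

lemma toy_conservation_tendsto:
  assumes S: "fine_partitions S d" and t: "0 \<le> t"
  shows "limitin strong_operator_topology (\<lambda>n. \<Sum>i | S n i \<le> t. toy_conservation (S n) i)
    (conservation (indicator {0..<t})) sequentially"
proof (rule limitin_strong_operator_topology)
  fix F
  obtain k where k: "\<forall>\<^sub>F n in sequentially. is_partition (S n) \<and> (\<forall>i. S n (Suc i) - S n i \<le> d n)
      \<and> {i. S n i \<le> t} = {..k n} \<and> t \<le> S n (Suc (k n))" and \<tau>: "(\<lambda>n. S n (Suc (k n))) \<longlonglongrightarrow> t"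
    using fine_partitions_index[OF S t] by blast
  have t\<tau>: "\<forall>\<^sub>F n in sequentially. t \<le> S n (Suc (k n))" using k by eventually_elim simp
  let ?P = "\<lambda>n. toy_proj (S n)" and ?B = "\<lambda>n. conservation (indicator {0..<S n (Suc (k n))})"
  have "(\<lambda>n. blinfun_apply (?P n) (blinfun_apply (?B n) (blinfun_apply (?P n) F)))
      \<longlonglongrightarrow> blinfun_apply (conservation (indicator {0..<t})) F"
  proof (rule tendsto_compression)
    show "\<forall>\<^sub>F n in sequentially. \<forall>F. norm (blinfun_apply (?B n) F) \<le> 1 * norm F"
      by (simp add: conservation_indicator_norm)
  qed (intro toy_proj_contraction toy_proj_tendsto[OF S] conservation_tendsto[OF t t\<tau> \<tau>])+
  then show "(\<lambda>n. blinfun_apply (\<Sum>i | S n i \<le> t. toy_conservation (S n) i) F)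
      \<longlonglongrightarrow> blinfun_apply (conservation (indicator {0..<t})) F"
  proof (rule Lim_transform_eventually)
    show "\<forall>\<^sub>F n in sequentially. blinfun_apply (?P n) (blinfun_apply (?B n) (blinfun_apply (?P n) F)) =
        blinfun_apply (\<Sum>i | S n i \<le> t. toy_conservation (S n) i) F"
      using k
    proof eventually_elim
      case (elim n)
      then show ?case
        by (simp add: sum_conservation[symmetric] toy_conservation_def blinfun.sum_left blinfun.sum_right)
    qed
  qed
qed

lemma time_operator_indicator:
  assumes "0 \<le> t"
  shows "blinfun_apply (time_operator (indicator {0..<t})) F = t *\<^sub>R F"
proof -
  have "(indicator {0..<t} :: real \<Rightarrow> complex) = (\<lambda>x. complex_of_real (indicator {0..<t} x))"
    by (auto simp: fun_eq_iff split: split_indicator)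
  then have "(\<integral>x. indicator {0..<t} x \<partial>half_line) = complex_of_real (\<integral>x. indicator {0..<t} x \<partial>half_line)"
    by (simp only: integral_complex_of_real)
  also have "\<dots> = complex_of_real t"
    using assms by (subst integrable_indicator_half_line(3)) auto
  finally show ?thesis by (simp add: time_operator_apply fock_scale_of_real)
qed

text \<open>The lengths telescope to \<open>t (Suc k)\<close> because the partition starts at zero,
  and idempotence of the projection absorbs its inner copies.\<close>

lemma toy_time_sum:
  assumes t: "is_partition t"
  shows "blinfun_apply (\<Sum>i\<le>k. (t (Suc i) - t i) *\<^sub>R toy_time t i) F =
    t (Suc k) *\<^sub>R blinfun_apply (toy_proj t) F - blinfun_apply (toy_proj t)
      (\<Sum>i\<le>k. (t (Suc i) - t i) *\<^sub>R blinfun_apply (conservation (indicator {t i..<t (Suc i)})) (blinfun_apply (toy_proj t) F))"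
proof -
  have "(\<Sum>i\<le>k. t (Suc i) - t i) = t (Suc k) - t 0"
    by (induction k) simp_all
  then have "(\<Sum>i\<le>k. t (Suc i) - t i) = t (Suc k)"
    using t by (simp add: is_partition_def)
  then show ?thesis
    by (simp add: toy_time_def toy_conservation_def blinfun.sum_left blinfun.sum_right blinfun.scaleR_left
        blinfun.scaleR_right blinfun.diff_left blinfun.diff_right toy_proj_fixes[OF toy_proj_in]
        scaleR_diff_right sum_subtractf flip: scaleR_sum_left)
qed

lemma toy_time_tendsto:
  assumes S: "fine_partitions S d" and t: "0 \<le> t"
  shows "limitin strong_operator_topology (\<lambda>n. \<Sum>i | S n i \<le> t. (S n (Suc i) - S n i) *\<^sub>R toy_time (S n) i)
    (time_operator (indicator {0..<t})) sequentially"
proof (rule limitin_strong_operator_topology)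
  fix F
  obtain k where k: "\<forall>\<^sub>F n in sequentially. is_partition (S n) \<and> (\<forall>i. S n (Suc i) - S n i \<le> d n)
      \<and> {i. S n i \<le> t} = {..k n} \<and> t \<le> S n (Suc (k n))" and \<tau>: "(\<lambda>n. S n (Suc (k n))) \<longlonglongrightarrow> t"
    using fine_partitions_index[OF S t] by blast
  let ?p = "\<lambda>n. blinfun_apply (toy_proj (S n))"
  \<comment> \<open>The correction by the conservation pieces is bounded by the mesh, so only the
    leading term, a multiple of the projected vector, survives in the limit.\<close>
  define R where "R n = ?p n (\<Sum>i\<le>k n. (S n (Suc i) - S n i) *\<^sub>R
      blinfun_apply (conservation (indicator {S n i..<S n (Suc i)})) (?p n F))" for n
  have "R \<longlonglongrightarrow> 0"
  proof (rule Lim_null_comparison)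
    show "\<forall>\<^sub>F n in sequentially. norm (R n) \<le> d n * norm F"
      using k
    proof eventually_elim
      case (elim n)
      then have d0: "0 \<le> d n" using partition_less[of "S n" 0] by (smt (verit))
      have "norm (R n) \<le> norm (\<Sum>i\<le>k n. (S n (Suc i) - S n i) *\<^sub>R
          blinfun_apply (conservation (indicator {S n i..<S n (Suc i)})) (?p n F))"
        unfolding R_def by (rule toy_proj_contraction)
      also have "\<dots> \<le> d n * norm (?p n F)"
        using elim by (intro conservation_norm_mesh) auto
      also have "\<dots> \<le> d n * norm F"
        using d0 by (intro mult_left_mono toy_proj_contraction)
      finally show ?case .
    qed
    show "(\<lambda>n. d n * norm F) \<longlonglongrightarrow> 0"
      using S by (intro tendsto_mult_left_zero) (simp add: fine_partitions_def)
  qed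
  then have "(\<lambda>n. S n (Suc (k n)) *\<^sub>R ?p n F - R n) \<longlonglongrightarrow> t *\<^sub>R F - 0"
    by (intro tendsto_intros \<tau> toy_proj_tendsto[OF S])
  then have "(\<lambda>n. S n (Suc (k n)) *\<^sub>R ?p n F - R n) \<longlonglongrightarrow> blinfun_apply (time_operator (indicator {0..<t})) F"
    by (simp add: time_operator_indicator[OF t])
  then show "(\<lambda>n. blinfun_apply (\<Sum>i | S n i \<le> t. (S n (Suc i) - S n i) *\<^sub>R toy_time (S n) i) F)
      \<longlonglongrightarrow> blinfun_apply (time_operator (indicator {0..<t})) F"
  proof (rule Lim_transform_eventually)
    show "\<forall>\<^sub>F n in sequentially. S n (Suc (k n)) *\<^sub>R ?p n F - R n =
        blinfun_apply (\<Sum>i | S n i \<le> t. (S n (Suc i) - S n i) *\<^sub>R toy_time (S n) i) F"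
      using k by eventually_elim (simp only: toy_time_sum R_def)
  qed
qed

theorem theorem1:
  fixes S :: "nat \<Rightarrow> nat \<Rightarrow> real"
  assumes partition: "\<And>n. n \<ge> 1 \<Longrightarrow> is_partition (S n)"
    and mesh: "(\<lambda>n. mesh (S n)) \<longlonglongrightarrow> 0"
  shows "(\<forall>f. (\<lambda>n. blinfun_apply (toy_proj (S n)) f) \<longlonglongrightarrow> f) \<and>
    (\<forall>t\<ge>0.
      limitin strong_operator_topology
        (\<lambda>n. \<Sum>i | S n i \<le> t. sqrt (S n (Suc i) - S n i) *\<^sub>R toy_creation (S n) i)
        (creation (indicator {0..<t})) sequentially \<and>
      limitin strong_operator_topology
        (\<lambda>n. \<Sum>i | S n i \<le> t. sqrt (S n (Suc i) - S n i) *\<^sub>R toy_annihilation (S n) i)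
        (annihilation (indicator {0..<t})) sequentially \<and>
      limitin strong_operator_topology
        (\<lambda>n. \<Sum>i | S n i \<le> t. toy_conservation (S n) i)
        (conservation (indicator {0..<t})) sequentially \<and>
      limitin strong_operator_topology
        (\<lambda>n. \<Sum>i | S n i \<le> t. (S n (Suc i) - S n i) *\<^sub>R toy_time (S n) i)
        (time_operator (indicator {0..<t})) sequentially)"
proof -
  note S = fine_partitions_mesh[OF partition mesh]
  show ?thesis
    \<comment> \<open>Creation and annihilation become compressions, the shape that the common lemma
      expects.\<close>
    unfolding toy_creation_def toy_annihilation_def
    by (intro conjI allI impI toy_proj_tendsto[OF S] toy_conservation_tendsto[OF S] toy_time_tendsto[OF S]
        toy_field_operator_tendsto[OF field_operator_creation S]
        toy_field_operator_tendsto[OF field_operator_annihilation S])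
qed

end
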